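(* Let $\alpha>0$. For $n\ge 1$, let $D_n$ be the density of fireproof vertices in the terminal state of the fire dynamics with firing rate $n^{-\alpha}$ on a uniform Cayley tree $\mathbf{t}_n$ on $[n]$, i.e. $$D_n=n^{-1}\,\mathrm{Card}\{i\in[n]:\ \text{all the edges adjacent to } i \text{ are fireproof}\}.$$ Then: (i) For $\alpha>1/2$, $\lim_{n\to\infty}D_n=1$ in probability. (ii) For $\alpha=1/2$, $\lim_{n\to\infty}D_n=D_\infty$ in distribution, where $$\mathbb{P}(D_\infty\in \mathrm{d}x)=\frac{1}{\sqrt{2\pi x(1-x)^3}}\exp\left(-\frac{x}{2(1-x)}\right)\mathrm{d}x,\qquad x\in(0,1).$$ (iii) For $\alpha<1/2$, $\lim_{n\to\infty}D_n=0$ in probability.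
   Context: For $n\ge1$, $[n]=\{1,\dots,n\}$. A uniform Cayley tree $\mathbf{t}_n$ is a tree picked uniformly at random among the $n^{n-2}$ trees on the labeled vertex set $[n]$. Fire dynamics with firing rate $r>0$ on a finite tree: this is a continuous-time Markov process in which each edge is in one of three states: inflammable, fireproof, or burnt. Initially every edge is inflammable. The only transitions are from inflammable to fireproof or burnt. Each inflammable edge becomes fireproof at rate $1$, independently of the other edges. Each inflammable edge is also set on fire at rate $r$; when this happens, the fire propagates instantaneously through neighboring inflammable edges (edges sharing a vertex) and is stopped only at fireproof edges, so that all edges in the connected cluster of inflammable edges containing the edge set on fire become burnt. After a finite time all edges are either burnt or fireproof; this is the terminal state. Given the random tree $\mathbf{t}_n$, the dynamics are run on $\mathbf{t}_n$ with $r=n^{-\alpha}$. A vertex is called fireproof if all its adjacent edges are fireproof in the terminal state, and burnt otherwise. *)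

theory Defs
  imports "HOL-Probability.Probability"
begin

text \<open>
  A simple graph is given by its vertex set and its set of edges, an edge being a two-element set
  of vertices.
\<close>

definition connected_graph :: "'v set \<Rightarrow> 'v set set \<Rightarrow> bool" where
  "connected_graph V E \<longleftrightarrow> (\<forall>u\<in>V. \<forall>v\<in>V. (u, v) \<in> {(a, b). {a, b} \<in> E}\<^sup>*)"

definition acyclic_graph :: "'v set set \<Rightarrow> bool" where
  "acyclic_graph E \<longleftrightarrow>
     \<not> (\<exists>vs. 3 \<le> length vs \<and> distinct vs \<and>
           (\<forall>i<length vs. {vs ! i, vs ! (Suc i mod length vs)} \<in> E))"

definition is_tree :: "'v set \<Rightarrow> 'v set set \<Rightarrow> bool" where
  "is_tree V E \<longleftrightarrow>
     V \<noteq> {} \<and> (\<forall>e\<in>E. e \<subseteq> V \<and> card e = 2) \<and> connected_graph V E \<and> acyclic_graph E"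

definition cayley_trees :: "nat \<Rightarrow> nat set set set" where
  "cayley_trees n = {E. is_tree {1..n} E}"


text \<open>
  Continuous-time Markov chains on a finite state space \<open>S\<close>. Here \<open>q x y\<close> is the rate of the
  transition from \<open>x\<close> to \<open>y\<close> for \<open>x \<noteq> y\<close>; the value of \<open>q x x\<close> is irrelevant.
\<close>

definition generator :: "'s set \<Rightarrow> ('s \<Rightarrow> 's \<Rightarrow> real) \<Rightarrow> 's \<Rightarrow> 's \<Rightarrow> real" where
  "generator S q x y = (if x = y then - (\<Sum>z\<in>S - {x}. q x z) else q x y)"

primrec kernel_power :: "'s set \<Rightarrow> ('s \<Rightarrow> 's \<Rightarrow> real) \<Rightarrow> nat \<Rightarrow> 's \<Rightarrow> 's \<Rightarrow> real" where
  "kernel_power S G 0 x y = of_bool (x = y)"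
| "kernel_power S G (Suc k) x y = (\<Sum>z\<in>S. kernel_power S G k x z * G z y)"

text \<open>The transition function is the matrix exponential of \<open>t\<close> times the generator.\<close>

definition transition_function ::
    "'s set \<Rightarrow> ('s \<Rightarrow> 's \<Rightarrow> real) \<Rightarrow> real \<Rightarrow> 's \<Rightarrow> 's \<Rightarrow> real" where
  "transition_function S q t x y =
     (\<Sum>k. t ^ k / fact k * kernel_power S (generator S q) k x y)"

text \<open>
  The last clause gives the finite-dimensional distributions, and thereby that the chain starts
  in \<open>x\<^sub>0\<close>, the Markov property, and that \<open>X t\<close> is almost surely in \<open>S\<close>. The paths are
  right-continuous for the discrete topology.
\<close>

definition markov_chain ::
    "'w measure \<Rightarrow> 's set \<Rightarrow> ('s \<Rightarrow> 's \<Rightarrow> real) \<Rightarrow> 's \<Rightarrow> (real \<Rightarrow> 'w \<Rightarrow> 's) \<Rightarrow> bool" where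
  "markov_chain M S q x\<^sub>0 X \<longleftrightarrow>
     prob_space M \<and>
     (\<forall>t\<ge>0. X t \<in> M \<rightarrow>\<^sub>M count_space UNIV) \<and>
     (\<forall>\<omega>\<in>space M. \<forall>t\<ge>0. \<forall>\<^sub>F u in at_right t. X u \<omega> = X t \<omega>) \<and>
     (\<forall>(k :: nat) (t :: nat \<Rightarrow> real) x.
        t 0 = 0 \<longrightarrow> (\<forall>i<k. t i \<le> t (Suc i)) \<longrightarrow> (\<forall>i\<le>k. x i \<in> S) \<longrightarrow>
        measure M {\<omega> \<in> space M. \<forall>i\<le>k. X (t i) \<omega> = x i} =
          of_bool (x 0 = x\<^sub>0) *
          (\<Prod>i<k. transition_function S q (t (Suc i) - t i) (x i) (x (Suc i))))"


datatype edge_state = Inflammable | Fireproof | Burnt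

text \<open>A configuration on an edge set \<open>E\<close> is a function on \<open>E\<close>, extended by \<open>undefined\<close>.\<close>

definition configurations :: "'v set set \<Rightarrow> ('v set \<Rightarrow> edge_state) set" where
  "configurations E = (E \<rightarrow>\<^sub>E UNIV)"

definition inflammable_edges :: "'v set set \<Rightarrow> ('v set \<Rightarrow> edge_state) \<Rightarrow> 'v set set" where
  "inflammable_edges E s = {e\<in>E. s e = Inflammable}"

definition inflammable_cluster ::
    "'v set set \<Rightarrow> ('v set \<Rightarrow> edge_state) \<Rightarrow> 'v set \<Rightarrow> 'v set set" where
  "inflammable_cluster E s e =
     {(f, g). f \<in> inflammable_edges E s \<and> g \<in> inflammable_edges E s \<and> f \<inter> g \<noteq> {}}\<^sup>* `` {e}"

definition set_on_fire ::
    "'v set set \<Rightarrow> ('v set \<Rightarrow> edge_state) \<Rightarrow> 'v set \<Rightarrow> 'v set \<Rightarrow> edge_state" where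
  "set_on_fire E s e = (\<lambda>f. if f \<in> inflammable_cluster E s e then Burnt else s f)"

text \<open>
  Fires started at different edges of one cluster lead to the same configuration; the sum adds up
  their rates.
\<close>

definition fire_rate ::
    "'v set set \<Rightarrow> real \<Rightarrow> ('v set \<Rightarrow> edge_state) \<Rightarrow> ('v set \<Rightarrow> edge_state) \<Rightarrow> real" where
  "fire_rate E r s s' =
     (\<Sum>e\<in>inflammable_edges E s.
        1 * of_bool (s' = s(e := Fireproof)) + r * of_bool (s' = set_on_fire E s e))"

definition fire_dynamics ::
    "'w measure \<Rightarrow> 'v set set \<Rightarrow> real \<Rightarrow> (real \<Rightarrow> 'w \<Rightarrow> 'v set \<Rightarrow> edge_state) \<Rightarrow> bool" where
  "fire_dynamics M E r X \<longleftrightarrow>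
     markov_chain M (configurations E) (fire_rate E r) (\<lambda>e\<in>E. Inflammable) X"

text \<open>
  \<open>T\<close> is a uniform Cayley tree on \<open>{1..n}\<close> and, conditionally on \<open>T = E\<close>, the process \<open>X\<close> is
  the fire dynamics on \<open>E\<close>.
\<close>

definition fire_on_cayley_tree ::
    "'w measure \<Rightarrow> nat \<Rightarrow> real \<Rightarrow> ('w \<Rightarrow> nat set set) \<Rightarrow>
     (real \<Rightarrow> 'w \<Rightarrow> nat set \<Rightarrow> edge_state) \<Rightarrow> bool" where
  "fire_on_cayley_tree M n r T X \<longleftrightarrow>
     prob_space M \<and>
     T \<in> M \<rightarrow>\<^sub>M count_space (cayley_trees n) \<and>
     distr M (count_space (cayley_trees n)) T = uniform_count_measure (cayley_trees n) \<and>
     (\<forall>E\<in>cayley_trees n. fire_dynamics (uniform_measure M {\<omega>\<in>space M. T \<omega> = E}) E r X)"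

text \<open>
  The terminal state is the eventual value of the path \<open>x\<close>; the path is almost surely constant
  from some time on.
\<close>

definition fireproof_vertex ::
    "'v set set \<Rightarrow> (real \<Rightarrow> 'v set \<Rightarrow> edge_state) \<Rightarrow> 'v \<Rightarrow> bool" where
  "fireproof_vertex E x i \<longleftrightarrow> (\<forall>e\<in>E. i \<in> e \<longrightarrow> (\<forall>\<^sub>F t in at_top. x t e = Fireproof))"

definition fireproof_density ::
    "nat \<Rightarrow> nat set set \<Rightarrow> (real \<Rightarrow> nat set \<Rightarrow> edge_state) \<Rightarrow> real" where
  "fireproof_density n E x = real (card {i\<in>{1..n}. fireproof_vertex E x i}) / real n"


definition tendsto_in_prob ::
    "(nat \<Rightarrow> 'w measure) \<Rightarrow> (nat \<Rightarrow> 'w \<Rightarrow> real) \<Rightarrow> real \<Rightarrow> bool" where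
  "tendsto_in_prob M Y c \<longleftrightarrow>
     (\<forall>\<epsilon>>0. (\<lambda>n. measure (M n) {\<omega>\<in>space (M n). \<bar>Y n \<omega> - c\<bar> > \<epsilon>}) \<longlonglongrightarrow> 0)"

definition limit_law :: "real measure" where
  "limit_law = density lborel (\<lambda>x. ennreal (indicator {0<..<1} x *
     (1 / sqrt (2 * pi * x * (1 - x) ^ 3) * exp (- x / (2 * (1 - x))))))"

end

theory Submission
  imports Defs "HOL-Computational_Algebra.Formal_Power_Series"
begin

text \<open>
  The first event in a uniform Cayley tree is, with probability \<open>1 / (1 + r)\<close>, that a uniformly
  chosen edge becomes fireproof, which leaves two components that are, given their sizes,
  independent uniform Cayley trees; otherwise the whole tree burns. So the factorial moments of
  the number \<open>F\<close> of fireproof vertices satisfy a convolution recursion in \<open>n\<close>. For the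
  generating functions, written in the variable
  \<open>T = x * exp T\<close>, it is a first-order linear differential equation, and solving it gives
  the expectation of \<open>F choose k\<close> as the sum over \<open>m\<close> of
  \<open>(1 + r) ^ (1 - m) * c(k, m) * w(n, m)\<close>, where \<open>w(n, m)\<close> is \<open>m\<close> times the product of
  \<open>1 - i / n\<close> over \<open>0 < i < m\<close>.

  If \<open>r = 0\<close>, then \<open>F = n\<close>, so that \<open>c(k, m) * w(n, m) / (n choose k)\<close> are probability weights
  on \<open>m\<close>; for \<open>r = n powr - \<alpha>\<close> they change by factors tending to 1 only. With
  \<open>m = u * sqrt n\<close> they converge to the density of \<open>u\<close> proportional to
  \<open>u ^ (2 * k - 1) * exp (- u ^ 2 / 2)\<close>, while \<open>(1 + r) ^ (1 - m)\<close> converges to \<open>1\<close>,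
  \<open>exp (- u)\<close> or \<open>0\<close> according to the sign of \<open>\<alpha> - 1 / 2\<close>. For \<open>\<alpha> = 1 / 2\<close> the resulting
  moments are those of \<open>N ^ 2 / (1 + N ^ 2)\<close> for a standard normal \<open>N\<close>, whose law is the one
  claimed.
\<close>

subsection \<open>Trees\<close>

text \<open>Binomials \<open>F choose k\<close> are preferred to powers because \<open>F\<close>
  adds up over the components left by a removed edge, so that Vandermonde's identity yields a finite
  convolution in \<open>k\<close>. Sums over all trees are kept instead of averages; the number of
  trees then appears as a common factor and cancels. The obstacle is \<open>c(k, m)\<close>: its
  recursion is quadratic, while \<open>r\<close> varies with \<open>n\<close>. Exact asymptotics are
  avoided by squeezing the dependence on \<open>r\<close> with a product over the recursion steps,
  and at \<open>r = 0\<close> by a one-sided bound with Catalan coefficients, which is enough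
  because the total mass is known exactly. The law is recognised by summing the limit moments into a
  power series in \<open>t\<close>; the two resulting integrals agree by Fubini and an integration
  by parts. Continuous time enters only through a harmonic function of the chain: its expectation is
  constant in time, and it equals \<open>F choose k\<close> once no edge is inflammable.\<close>

definition reach :: "'v set set \<Rightarrow> ('v \<times> 'v) set" where
  "reach E = {(a, b). {a, b} \<in> E}\<^sup>*"

lemma reach_refl [simp]: "(a, a) \<in> reach E"
  by (simp add: reach_def)

lemma reach_sym: "(a, b) \<in> reach E \<Longrightarrow> (b, a) \<in> reach E"
proof -
  have "sym {(a, b). {a, b} \<in> E}" by (auto simp: sym_def insert_commute)
  then show "(a, b) \<in> reach E \<Longrightarrow> (b, a) \<in> reach E"
    unfolding reach_def by (meson sym_rtrancl symD)
qed

lemma reach_trans: "(a, b) \<in> reach E \<Longrightarrow> (b, c) \<in> reach E \<Longrightarrow> (a, c) \<in> reach E"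
  unfolding reach_def by simp

lemma reach_edge: "{a, b} \<in> E \<Longrightarrow> (a, b) \<in> reach E"
  unfolding reach_def by auto

lemma reach_mono: "E \<subseteq> F \<Longrightarrow> (a, b) \<in> reach E \<Longrightarrow> (a, b) \<in> reach F"
proof -
  assume "E \<subseteq> F"
  then have "{(a, b). {a, b} \<in> E} \<subseteq> {(a, b). {a, b} \<in> F}" by auto
  then show "(a, b) \<in> reach E \<Longrightarrow> (a, b) \<in> reach F"
    unfolding reach_def using rtrancl_mono by blast
qed

lemma reach_induct [consumes 1, case_names base step]:
  assumes "(a, b) \<in> reach E" "P a"
    "\<And>y z. (a, y) \<in> reach E \<Longrightarrow> {y, z} \<in> E \<Longrightarrow> P y \<Longrightarrow> P z"
  shows "P b"
  using assms unfolding reach_def by (induct rule: rtrancl_induct) auto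

text \<open>No edge of \<open>F\<close> crosses the boundary of \<open>W\<close>, so a walk that
  starts in \<open>W\<close> can neither leave it nor use an edge outside it. This is how disjoint
  parts of a graph are kept apart below.\<close>

lemma reach_within:
  assumes "(a, x) \<in> reach F" "\<forall>e\<in>F. e \<subseteq> W \<or> e \<inter> W = {}" "a \<in> W"
  shows "x \<in> W \<and> (a, x) \<in> reach {e\<in>F. e \<subseteq> W}"
  using assms(1)
proof (induct rule: reach_induct)
  case (step y z)
  then have "{y, z} \<subseteq> W \<or> {y, z} \<inter> W = {}" "y \<in> W"
    using assms(2)[rule_format, OF step(2)] by blast+
  then have yz: "{y, z} \<subseteq> W" by simp
  with step(2) have "(y, z) \<in> reach {e\<in>F. e \<subseteq> W}" by (intro reach_edge) simp
  with step(3) have "(a, z) \<in> reach {e\<in>F. e \<subseteq> W}" using reach_trans by metis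
  with yz show ?case by simp
qed (use assms in simp)

text \<open>Cycles in \<open>acyclic_graph\<close> are lists of distinct vertices, so a walk has to
  be made simple. When it returns to a vertex already on the path, the path is truncated at that
  vertex.\<close>

lemma reach_simple_path:
  assumes "(a, x) \<in> reach F"
  shows "\<exists>vs. 0 < length vs \<and> distinct vs \<and> vs ! 0 = a \<and> vs ! (length vs - 1) = x \<and>
           (\<forall>i. Suc i < length vs \<longrightarrow> {vs ! i, vs ! Suc i} \<in> F)"
  using assms
proof (induct rule: reach_induct)
  case base
  show ?case by (rule exI[of _ "[a]"]) auto
next
  case (step y z)
  then obtain vs where vs: "0 < length vs" "distinct vs" "vs ! 0 = a" "vs ! (length vs - 1) = y"
      "\<forall>i. Suc i < length vs \<longrightarrow> {vs ! i, vs ! Suc i} \<in> F" by blast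
  show ?case
  proof (cases "z \<in> set vs")
    case True
    then obtain j where j: "j < length vs" "vs ! j = z" by (auto simp: in_set_conv_nth)
    show ?thesis
      by (rule exI[of _ "take (Suc j) vs"])
        (use vs j in \<open>auto simp: min_absorb2 Suc_le_eq\<close>)
  next
    case False
    have "{(vs @ [z]) ! i, (vs @ [z]) ! Suc i} \<in> F" if "Suc i < length (vs @ [z])" for i
    proof (cases "Suc i < length vs")
      case True then show ?thesis using vs by (simp add: nth_append)
    next
      case False
      then have "i = length vs - 1" using that vs(1) by auto
      then show ?thesis using step vs by (simp add: nth_append)
    qed
    then show ?thesis using vs False
      by (intro exI[of _ "vs @ [z]"]) (auto simp: nth_append)
  qed
qed

text \<open>A simple path between the ends of an edge that avoids the edge closes up to a cycle, and
  a cycle minus one edge is such a path. The bridge form is the workable one: it passes to smaller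
  edge sets by monotonicity of \<open>reach\<close>. Edges of size 2 exclude loops, whose ends are
  trivially connected.\<close>

lemma acyclic_graph_iff_bridges:
  assumes "\<forall>e\<in>E. card e = 2"
  shows "acyclic_graph E \<longleftrightarrow> (\<forall>a b. {a, b} \<in> E \<longrightarrow> (a, b) \<notin> reach (E - {{a, b}}))"
proof
  assume ac: "acyclic_graph E"
  show "\<forall>a b. {a, b} \<in> E \<longrightarrow> (a, b) \<notin> reach (E - {{a, b}})"
  proof (intro allI impI notI)
    fix a b assume ab: "{a, b} \<in> E" and r: "(a, b) \<in> reach (E - {{a, b}})"
    obtain vs where vs: "0 < length vs" "distinct vs" "vs ! 0 = a" "vs ! (length vs - 1) = b"
      "\<forall>i. Suc i < length vs \<longrightarrow> {vs ! i, vs ! Suc i} \<in> E - {{a, b}}"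
      using reach_simple_path[OF r] by blast
    have "a \<noteq> b" using ab assms by force
    then have "length vs \<noteq> 1" using vs by auto
    moreover have "length vs \<noteq> 2" using vs(3,4) vs(5)[rule_format, of 0] by auto
    ultimately have "3 \<le> length vs" using vs(1) by linarith
    moreover have "{vs ! i, vs ! (Suc i mod length vs)} \<in> E" if "i < length vs" for i
    proof (cases "Suc i < length vs")
      case True then show ?thesis using vs by simp
    next
      case False
      then have "i = length vs - 1" using that by simp
      then show ?thesis using vs ab by (simp add: insert_commute)
    qed
    ultimately show False using ac vs(2) unfolding acyclic_graph_def by blast
  qed
next
  assume br: "\<forall>a b. {a, b} \<in> E \<longrightarrow> (a, b) \<notin> reach (E - {{a, b}})"
  show "acyclic_graph E"
    unfolding acyclic_graph_def
  proof (intro notI, elim exE conjE)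
    fix vs assume vs: "3 \<le> length vs" "distinct vs"
      "\<forall>i<length vs. {vs ! i, vs ! (Suc i mod length vs)} \<in> E"
    \<comment> \<open>The deleted edge is the one that closes the list, from the last vertex to the
      first; the list itself is then a path avoiding it.\<close>
    define a where "a = vs ! (length vs - 1)"
    define b where "b = vs ! 0"
    have ab: "{a, b} \<in> E" using vs(3)[rule_format, of "length vs - 1"] vs(1)
      by (cases vs) (auto simp: a_def b_def)
    have "vs \<noteq> []" using vs(1) by auto
    have "(b, vs ! i) \<in> reach (E - {{a, b}})" if "i < length vs" for i
      using that
    proof (induct i)
      case (Suc i)
      have "{vs ! i, vs ! Suc i} \<in> E" using vs(3)[rule_format, of i] Suc.prems by simp
      moreover have "{vs ! i, vs ! Suc i} \<noteq> {a, b}"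
      proof
        assume "{vs ! i, vs ! Suc i} = {a, b}"
        then consider "vs ! i = vs ! (length vs - 1)" | "vs ! i = vs ! 0" "vs ! Suc i = vs ! (length vs - 1)"
          unfolding a_def b_def doubleton_eq_iff by blast
        then show False
        proof cases
          case 1
          then have "i = length vs - 1" using Suc.prems vs(1,2) by (subst (asm) nth_eq_iff_index_eq) auto
          then show False using Suc.prems by simp
        next
          case 2
          then have "i = 0" "Suc i = length vs - 1" using Suc.prems vs(1,2)
            nth_eq_iff_index_eq[OF vs(2), of i 0]
            nth_eq_iff_index_eq[OF vs(2), of "Suc i" "length vs - 1"] by linarith+
          \<comment> \<open>A path edge equal to the closing edge would join positions 0 and
            \<open>length vs - 1\<close>, which are neighbours only in a list of length 2.\<close>
          then show False using vs(1) by simp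
        qed
      qed
      ultimately have "(vs ! i, vs ! Suc i) \<in> reach (E - {{a, b}})" by (intro reach_edge) simp
      moreover have "(b, vs ! i) \<in> reach (E - {{a, b}})" using Suc by simp
      ultimately show ?case by (rule reach_trans[rotated])
    qed (simp add: b_def)
    then have "(a, b) \<in> reach (E - {{a, b}})"
      using vs(1) reach_sym[of b a] by (simp add: a_def)
    with br ab show False by blast
  qed
qed

lemma is_tree_iff_bridges:
  "is_tree V E \<longleftrightarrow> V \<noteq> {} \<and> (\<forall>e\<in>E. e \<subseteq> V \<and> card e = 2) \<and> (\<forall>u\<in>V. \<forall>v\<in>V. (u, v) \<in> reach E) \<and>
     (\<forall>a b. {a, b} \<in> E \<longrightarrow> (a, b) \<notin> reach (E - {{a, b}}))"
proof (cases "\<forall>e\<in>E. e \<subseteq> V \<and> card e = 2")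
  case True
  then have "acyclic_graph E \<longleftrightarrow> (\<forall>a b. {a, b} \<in> E \<longrightarrow> (a, b) \<notin> reach (E - {{a, b}}))"
    by (intro acyclic_graph_iff_bridges) simp
  then show ?thesis
    unfolding is_tree_def connected_graph_def reach_def[of E, symmetric] by (simp only:)
qed (auto simp: is_tree_def)

section \<open>Joining two trees by an edge, and cutting a tree at an edge\<close>

lemma is_tree_join:
  assumes t1: "is_tree V1 E1" and t2: "is_tree V2 E2" and disj: "V1 \<inter> V2 = {}"
    and a: "a \<in> V1" and b: "b \<in> V2"
  shows "is_tree (V1 \<union> V2) (insert {a, b} (E1 \<union> E2))"
proof -
  let ?E = "insert {a, b} (E1 \<union> E2)"
  note t1' = t1[unfolded is_tree_iff_bridges] and t2' = t2[unfolded is_tree_iff_bridges]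
  have ab: "a \<noteq> b" using a b disj by auto
  have e1: "e \<subseteq> V1" "card e = 2" if "e \<in> E1" for e using that t1' by blast+
  have e2: "e \<subseteq> V2" "card e = 2" if "e \<in> E2" for e using that t2' by blast+
  have fromv: "(a, v) \<in> reach ?E" if "v \<in> V1 \<union> V2" for v
  proof (cases "v \<in> V1")
    case True
    then have "(a, v) \<in> reach E1" using t1' a by blast
    then show ?thesis by (rule reach_mono[rotated]) auto
  next
    case False
    then have "(b, v) \<in> reach E2" using t2' b that by blast
    then have "(b, v) \<in> reach ?E" by (rule reach_mono[rotated]) auto
    moreover have "(a, b) \<in> reach ?E" by (rule reach_edge) simp
    ultimately show ?thesis by (rule reach_trans[rotated])
  qed
  have ab_notin: "{a, b} \<notin> E1 \<union> E2"
    using e1(1)[of "{a, b}"] e2(1)[of "{a, b}"] a b disj by auto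
  have sep: "\<forall>e\<in>E1 \<union> E2. e \<subseteq> V1 \<or> e \<inter> V1 = {}"
  proof
    fix e assume "e \<in> E1 \<union> E2"
    then show "e \<subseteq> V1 \<or> e \<inter> V1 = {}" using e1(1)[of e] e2(1)[of e] disj by auto
  qed
  have cross: "(a, b) \<notin> reach (E1 \<union> E2)"
  proof
    assume "(a, b) \<in> reach (E1 \<union> E2)"
    then have "b \<in> V1"
      using reach_within[OF _ sep a] by simp
    then show False using b disj by auto
  qed
  have proj: "(c, d) \<in> reach F"
    if F: "(c, d) \<in> reach (insert {a', b'} (F \<union> F'))" and "a' \<in> W" "b' \<in> W'" "W \<inter> W' = {}"
      "\<forall>e\<in>F. e \<subseteq> W" "\<forall>e\<in>F'. e \<subseteq> W'" "c \<in> W" "d \<in> W" for c d a' b' F F' and W W' :: "'a set"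
  proof -
    \<comment> \<open>Retraction onto \<open>W\<close> that collapses everything else to
      \<open>a'\<close>. The joining edge and all edges of \<open>F'\<close> go to the point
      \<open>a'\<close>, so a walk in the joined graph projects to a walk that uses edges of
      \<open>F\<close> only.\<close>
    define \<pi> where "\<pi> v = (if v \<in> W then v else a')" for v
    have "(c, \<pi> d) \<in> reach F" using F
    proof (induct rule: reach_induct)
      case base
      then show ?case using that by (simp add: \<pi>_def)
    next
      case (step y z)
      consider "{y, z} = {a', b'}" | "{y, z} \<in> F" | "{y, z} \<in> F'" using step by blast
      then have "(\<pi> y, \<pi> z) \<in> reach F"
      proof cases
        case 1
        then have "\<pi> y = a'" "\<pi> z = a'" using that unfolding \<pi>_def doubleton_eq_iff by auto
        then show ?thesis by simp
      next
        case 2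
        then have "\<pi> y = y" "\<pi> z = z" using that unfolding \<pi>_def by auto
        then show ?thesis using 2 reach_edge by metis
      next
        case 3
        then have "{y, z} \<subseteq> W'" using that(6) by metis
        then have "\<pi> y = a'" "\<pi> z = a'" using that(4) unfolding \<pi>_def by auto
        then show ?thesis by simp
      qed
      with step(3) show ?case by (rule reach_trans)
    qed
    then show ?thesis using that by (simp add: \<pi>_def)
  qed
  have br: "(c, d) \<notin> reach (?E - {{c, d}})" if cd: "{c, d} \<in> ?E" for c d
  proof
    assume r: "(c, d) \<in> reach (?E - {{c, d}})"
    consider "{c, d} = {a, b}" | "{c, d} \<in> E1" | "{c, d} \<in> E2" using cd by blast
    then show False
    proof cases
      case 1
      then have "?E - {{c, d}} = E1 \<union> E2" using ab_notin by auto
      then have "(c, d) \<in> reach (E1 \<union> E2)" using r by argo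
      then show False using 1 cross reach_sym unfolding doubleton_eq_iff by metis
    next
      case 2
      have "?E - {{c, d}} \<subseteq> insert {a, b} ((E1 - {{c, d}}) \<union> E2)" by auto
      from reach_mono[OF this r] have "(c, d) \<in> reach (E1 - {{c, d}})"
        by (rule proj[where W = V1 and W' = V2]) (use a b disj e1(1) e2(1) e1(1)[OF 2] in auto)
      then show False using t1' 2 by blast
    next
      case 3
      have "?E - {{c, d}} \<subseteq> insert {b, a} ((E2 - {{c, d}}) \<union> E1)" by auto
      from reach_mono[OF this r] have "(c, d) \<in> reach (E2 - {{c, d}})"
        by (rule proj[where W = V2 and W' = V1]) (use a b disj e1(1) e2(1) e2(1)[OF 3] in auto)
      then show False using t2' 3 by blast
    qed
  qed
  show ?thesis unfolding is_tree_iff_bridges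
  proof (intro conjI)
    have "card {a, b} = 2" using ab by simp
    then show "\<forall>e\<in>?E. e \<subseteq> V1 \<union> V2 \<and> card e = 2" using e1 e2 a b by blast
    show "\<forall>u\<in>V1 \<union> V2. \<forall>v\<in>V1 \<union> V2. (u, v) \<in> reach ?E"
      using fromv reach_sym reach_trans by metis
    show "\<forall>c d. {c, d} \<in> ?E \<longrightarrow> (c, d) \<notin> reach (?E - {{c, d}})" using br by blast
  qed (use a in auto)
qed

text \<open>Inverse operation to \<open>is_tree_join\<close>: \<open>W\<close> is the component of
  \<open>a\<close> once the edge is deleted, and the bridge property puts \<open>b\<close> outside
  it.\<close>

lemma is_tree_split:
  fixes V :: "'v set"
  assumes t: "is_tree V E" and ab: "{a, b} \<in> E"
  defines "W \<equiv> {x. (a, x) \<in> reach (E - {{a, b}})}"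
  shows "W \<subseteq> V" "a \<in> W" "b \<in> V - W"
    "is_tree W {e\<in>E - {{a, b}}. e \<subseteq> W}" "is_tree (V - W) {e\<in>E - {{a, b}}. e \<subseteq> V - W}"
    "E - {{a, b}} = {e\<in>E - {{a, b}}. e \<subseteq> W} \<union> {e\<in>E - {{a, b}}. e \<subseteq> V - W}"
proof -
  let ?E = "E - {{a, b}}"
  note t' = t[unfolded is_tree_iff_bridges]
  have bridge: "\<And>x y. {x, y} \<in> E \<Longrightarrow> (x, y) \<notin> reach (E - {{x, y}})"
    and card2: "\<And>e. e \<in> E \<Longrightarrow> card e = 2"
    using t' by simp_all
  show aW: "a \<in> W" by (simp add: W_def)
  show WV: "W \<subseteq> V"
  proof
    fix x assume "x \<in> W"
    then have "(a, x) \<in> reach ?E" by (simp add: W_def)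
    moreover have "a \<in> V" using t' ab by blast
    moreover have "\<forall>e\<in>E. e \<subseteq> V" using t' by blast
    ultimately show "x \<in> V" using reach_within[of a x ?E V] by blast
  qed
  show bW: "b \<in> V - W" using t' ab unfolding W_def by blast
  have edges: "e \<subseteq> W \<or> e \<subseteq> V - W" if e: "e \<in> ?E" for e
  proof -
    obtain c d where cd: "e = {c, d}" using t' e by (meson DiffD1 card_2_iff)
    have "c \<in> W \<longleftrightarrow> d \<in> W"
      unfolding W_def mem_Collect_eq
      using e cd reach_edge[of c d ?E] reach_trans[of a c ?E d] reach_trans[of a d ?E c]
        reach_sym[of c d ?E] by metis
    moreover have "e \<subseteq> V" using t' e by blast
    ultimately show ?thesis using cd by auto
  qed
  then show "?E = {e\<in>?E. e \<subseteq> W} \<union> {e\<in>?E. e \<subseteq> V - W}" by auto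
  \<comment> \<open>Along a walk from \<open>a\<close> in \<open>E\<close>, every use of the deleted
    edge ends at \<open>a\<close> or \<open>b\<close>, where the count of reached points starts
    afresh.\<close>
  have cov: "(a, x) \<in> reach ?E \<or> (b, x) \<in> reach ?E" if "x \<in> V" for x
  proof -
    have "a \<in> V" using t' ab by blast
    then have "(a, x) \<in> reach E" using t' that by blast
    then show ?thesis
    proof (induct rule: reach_induct)
      case (step y z)
      show ?case
      proof (cases "{y, z} = {a, b}")
        case True
        then have "z = a \<or> z = b" by auto
        then show ?thesis by auto
      next
        case False
        then have "(y, z) \<in> reach ?E" using step by (intro reach_edge) auto
        then show ?thesis using step(3) reach_trans[of _ y ?E z] by blast
      qed
    qed simp
  qed
  have bcov: "(b, x) \<in> reach ?E" if "x \<in> V - W" for x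
    using cov[of x] that by (auto simp: W_def)
  \<comment> \<open>Used for both halves: a set that no remaining edge leaves and that is connected
    to one of its points \<open>c\<close> inherits connectedness, and bridges stay bridges in a
    smaller edge set.\<close>
  have aux: "is_tree U {e\<in>?E. e \<subseteq> U}"
    if "U \<subseteq> V" "c \<in> U" "\<forall>e\<in>?E. e \<subseteq> U \<or> e \<inter> U = {}" "\<forall>x\<in>U. (c, x) \<in> reach ?E" for U c
    unfolding is_tree_iff_bridges
  proof (intro conjI ballI allI impI)
    fix u v assume "u \<in> U" "v \<in> U"
    then have "(c, u) \<in> reach {e\<in>?E. e \<subseteq> U}" "(c, v) \<in> reach {e\<in>?E. e \<subseteq> U}"
      using reach_within[OF that(4)[rule_format] that(3,2)] by simp_all
    then show "(u, v) \<in> reach {e\<in>?E. e \<subseteq> U}" by (rule reach_trans[OF reach_sym])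
  next
    fix x y assume xy: "{x, y} \<in> {e\<in>?E. e \<subseteq> U}"
    show "(x, y) \<notin> reach ({e\<in>?E. e \<subseteq> U} - {{x, y}})"
    proof
      assume "(x, y) \<in> reach ({e\<in>?E. e \<subseteq> U} - {{x, y}})"
      then have "(x, y) \<in> reach (E - {{x, y}})" by (rule reach_mono[rotated]) auto
      then show False using xy bridge by simp
    qed
  next
    fix e assume "e \<in> {e\<in>?E. e \<subseteq> U}"
    then show "e \<subseteq> U" "card e = 2" using card2 by simp_all
  qed (use that(2) in blast)
  show "is_tree W {e\<in>?E. e \<subseteq> W}"
  proof (rule aux[of _ a])
    show "\<forall>e\<in>?E. e \<subseteq> W \<or> e \<inter> W = {}" using edges by blast
  qed (use WV aW in \<open>auto simp: W_def\<close>)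
  show "is_tree (V - W) {e\<in>?E. e \<subseteq> V - W}"
  proof (rule aux[of _ b])
    show "\<forall>e\<in>?E. e \<subseteq> V - W \<or> e \<inter> (V - W) = {}" using edges by blast
  qed (use bW bcov in auto)
qed

lemma is_tree_singleton: "is_tree {v} E \<longleftrightarrow> E = {}"
proof -
  have "\<not> (e \<subseteq> {v} \<and> card e = 2)" for e
    using card_mono[of "{v}" e] by auto
  then show ?thesis unfolding is_tree_iff_bridges by auto
qed

lemma is_tree_finite_edges: "is_tree V E \<Longrightarrow> finite V \<Longrightarrow> finite E"
  unfolding is_tree_def by (meson Pow_iff finite_Pow_iff finite_subset subsetI)

lemma is_tree_edge_exists:
  assumes "is_tree V E" "v \<in> V" "V \<noteq> {v}"
  shows "\<exists>w. {v, w} \<in> E"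
proof -
  obtain u where u: "u \<in> V" "u \<noteq> v" using assms by blast
  then have "(v, u) \<in> {(a, b). {a, b} \<in> E}\<^sup>*"
    using assms unfolding is_tree_def connected_graph_def by blast
  then show ?thesis using u(2) by (auto elim: converse_rtranclE)
qed

text \<open>Cutting at an edge distributes all vertices and all but one edge over two smaller trees,
  so the excess 1 of vertices over edges is preserved by induction.\<close>

lemma card_tree_edges:
  assumes "finite V" "is_tree V E"
  shows "Suc (card E) = card V"
  using assms
proof (induct "card V" arbitrary: V E rule: less_induct)
  case less
  obtain v where v: "v \<in> V" using less.prems by (auto simp: is_tree_def)
  show ?case
  proof (cases "V = {v}")
    case True
    then show ?thesis using less.prems by (simp add: is_tree_singleton)
  next
    case False
    obtain w where e: "{v, w} \<in> E" using is_tree_edge_exists[OF less.prems(2) v False] by blast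
    define W where "W = {x. (v, x) \<in> reach (E - {{v, w}})}"
    note s = is_tree_split[OF less.prems(2) e, folded W_def]
    let ?E1 = "{e\<in>E - {{v, w}}. e \<subseteq> W}" and ?E2 = "{e\<in>E - {{v, w}}. e \<subseteq> V - W}"
    have fin: "finite W" "finite (V - W)" "finite E" using s(1) less.prems
      finite_subset is_tree_finite_edges by blast+
    have lt: "card W < card V" "card (V - W) < card V"
      using s(1-3) less.prems(1) by (auto intro!: psubset_card_mono)
    have "Suc (card ?E1) = card W" "Suc (card ?E2) = card (V - W)"
      by (rule less.hyps[OF lt(1) fin(1) s(4)], rule less.hyps[OF lt(2) fin(2) s(5)])
    moreover have "card (E - {{v, w}}) = card ?E1 + card ?E2"
    proof -
      have "?E1 \<inter> ?E2 = {}"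
      proof -
        have "e \<noteq> {}" if "e \<in> E" for e using less.prems(2) that by (auto simp: is_tree_def)
        then show ?thesis by blast
      qed
      moreover have "finite ?E1" "finite ?E2" using fin(3) by auto
      ultimately have "card (?E1 \<union> ?E2) = card ?E1 + card ?E2" by (simp only: card_Un_disjoint)
      with arg_cong[OF s(6), of card] show ?thesis by linarith
    qed
    moreover have "card (E - {{v, w}}) = card E - 1" "card E \<noteq> 0" using e fin by auto
    moreover have "card (V - W) = card V - card W" "card W \<le> card V"
      using s(1) fin(1) less.prems(1) by (simp_all add: card_Diff_subset card_mono)
    ultimately show ?thesis by linarith
  qed
qed

lemma finite_trees:
  assumes "finite V"
  shows "finite (Collect (is_tree V))"
proof (rule finite_subset)
  show "Collect (is_tree V) \<subseteq> Pow (Pow V)"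
  proof
    fix E assume "E \<in> Collect (is_tree V)"
    then have "\<forall>e\<in>E. e \<subseteq> V" by (simp add: is_tree_def)
    then show "E \<in> Pow (Pow V)" by blast
  qed
qed (use assms in simp)

text \<open>A tree with a chosen oriented edge is the same as a vertex set \<open>W\<close>, a tree
  on each side, and an endpoint on each side. The orientation says which side is \<open>W\<close>.
  The degenerate choices of \<open>W\<close> contribute nothing, since no tree lives on the empty
  set.\<close>

lemma sum_oriented_tree_edges:
  fixes f :: "'v set set \<Rightarrow> 'v \<Rightarrow> 'v \<Rightarrow> real"
  assumes V: "finite V"
  shows "(\<Sum>(E, a, b)\<in>{(E, a, b). is_tree V E \<and> {a, b} \<in> E}. f E a b) =
    (\<Sum>W\<in>{W. W \<subseteq> V}. \<Sum>E1\<in>Collect (is_tree W). \<Sum>E2\<in>Collect (is_tree (V - W)).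
       \<Sum>a\<in>W. \<Sum>b\<in>V - W. f (insert {a, b} (E1 \<union> E2)) a b)"
    (is "_ = ?rhs")
proof -
  let ?S = "{(E, a, b). is_tree V E \<and> {a, b} \<in> E}"
  let ?W = "\<lambda>E a b. {x. (a, x) \<in> reach (E - {{a, b}})}"
  let ?R = "(SIGMA W:{W. W \<subseteq> V}. SIGMA E1:Collect (is_tree W). SIGMA E2:Collect (is_tree (V - W)).
      SIGMA a:W. V - W)"
  have fin_tree: "finite (Collect (is_tree W))" if "W \<subseteq> V" for W
    using that V finite_subset by (intro finite_trees) auto
  have "?rhs = (\<Sum>W\<in>{W. W \<subseteq> V}. \<Sum>(E1, E2, a, b)\<in>Collect (is_tree W) \<times> Collect (is_tree (V - W)) \<times>
      W \<times> (V - W). f (insert {a, b} (E1 \<union> E2)) a b)"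
    by (simp only: sum.cartesian_product)
  also have "\<dots> = (\<Sum>(W, E1, E2, a, b)\<in>?R. f (insert {a, b} (E1 \<union> E2)) a b)"
  proof (rule sum.Sigma)
    show "\<forall>W\<in>{W. W \<subseteq> V}. finite (Collect (is_tree W) \<times> Collect (is_tree (V - W)) \<times> W \<times> (V - W))"
      using fin_tree V by (auto intro!: finite_cartesian_product intro: finite_subset)
  qed (use V in simp)
  also have "\<dots> = (\<Sum>(E, a, b)\<in>?S. f E a b)"
  proof (rule sum.reindex_bij_witness[where
        i = "\<lambda>(E, a, b). (?W E a b, {e\<in>E - {{a, b}}. e \<subseteq> ?W E a b},
                {e\<in>E - {{a, b}}. e \<subseteq> V - ?W E a b}, a, b)" and
        j = "\<lambda>(W, E1, E2, a, b). (insert {a, b} (E1 \<union> E2), a, b)"], goal_cases)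
    case (1 x)
    then obtain W E1 E2 a b where x: "x = (W, E1, E2, a, b)" "W \<subseteq> V" "is_tree W E1"
      "is_tree (V - W) E2" "a \<in> W" "b \<in> V - W" by auto
    have "\<forall>e\<in>E1. e \<subseteq> W \<and> card e = 2" using x(3) by (simp add: is_tree_def)
    then have e1: "e \<subseteq> W \<and> e \<noteq> {}" if "e \<in> E1" for e using that by fastforce
    have "\<forall>e\<in>E2. e \<subseteq> V - W \<and> card e = 2" using x(4) by (simp add: is_tree_def)
    then have e2: "e \<subseteq> V - W \<and> e \<noteq> {}" if "e \<in> E2" for e using that by fastforce
    have D: "insert {a, b} (E1 \<union> E2) - {{a, b}} = E1 \<union> E2"
      using e1[of "{a, b}"] e2[of "{a, b}"] x(5,6) by auto
    have sep: "\<forall>e\<in>E1 \<union> E2. e \<subseteq> W \<or> e \<inter> W = {}"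
    proof
      fix e assume "e \<in> E1 \<union> E2"
      then show "e \<subseteq> W \<or> e \<inter> W = {}" using e1[of e] e2[of e] by auto
    qed
    have W: "?W (insert {a, b} (E1 \<union> E2)) a b = W"
      unfolding D
    proof (intro equalityI subsetI)
      fix y assume "y \<in> {x. (a, x) \<in> reach (E1 \<union> E2)}"
      then show "y \<in> W" using reach_within[OF _ sep x(5)] by simp
    next
      fix y assume "y \<in> W"
      then have "(a, y) \<in> reach E1" using x(3,5) by (simp add: is_tree_iff_bridges)
      then show "y \<in> {x. (a, x) \<in> reach (E1 \<union> E2)}" using reach_mono[of E1 "E1 \<union> E2"] by auto
    qed
    have "{e\<in>E1 \<union> E2. e \<subseteq> W} = E1"
    proof (intro equalityI subsetI)
      fix e assume "e \<in> {e\<in>E1 \<union> E2. e \<subseteq> W}"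
      then show "e \<in> E1" using e2[of e] by auto
    qed (use e1 in auto)
    moreover have "{e\<in>E1 \<union> E2. e \<subseteq> V - W} = E2"
    proof (intro equalityI subsetI)
      fix e assume "e \<in> {e\<in>E1 \<union> E2. e \<subseteq> V - W}"
      then show "e \<in> E2" using e1[of e] by auto
    qed (use e2 in auto)
    ultimately show ?case unfolding x(1) split_conv D W[unfolded D] by simp
  next
    case (2 x)
    then obtain W E1 E2 a b where x: "x = (W, E1, E2, a, b)" "W \<subseteq> V" "is_tree W E1"
      "is_tree (V - W) E2" "a \<in> W" "b \<in> V - W" by auto
    have "is_tree (W \<union> (V - W)) (insert {a, b} (E1 \<union> E2))"
      by (rule is_tree_join) (use x in auto)
    moreover have "W \<union> (V - W) = V" using x by auto
    ultimately show ?case using x by auto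
  next
    case (3 y)
    then obtain E a b where y: "y = (E, a, b)" "is_tree V E" "{a, b} \<in> E" by auto
    note s = is_tree_split[OF y(2,3)]
    show ?case unfolding y(1) split_conv using s(6) y(3) by auto
  next
    case (4 y)
    then obtain E a b where y: "y = (E, a, b)" "is_tree V E" "{a, b} \<in> E" by auto
    note s = is_tree_split[OF y(2,3)]
    show ?case unfolding y(1) using s(1-5) by simp
  next
    case (5 x)
    then show ?case by auto
  qed
  finally show ?thesis by simp
qed

subsection \<open>Expected factorial moments on a tree and the cutting recursion\<close>

text \<open>Version of \<open>inflammable_cluster\<close> that depends on the set of inflammable
  edges alone, so that the recursion for the moments can forget the states of the other
  edges.\<close>

definition cluster :: "'v set set \<Rightarrow> 'v set \<Rightarrow> 'v set set" where
  "cluster I e = {(f, g). f \<in> I \<and> g \<in> I \<and> f \<inter> g \<noteq> {}}\<^sup>* `` {e}"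

lemma cluster_self [simp]: "e \<in> cluster I e"
  by (simp add: cluster_def)

lemma cluster_step: "f \<in> cluster I e \<Longrightarrow> f \<in> I \<Longrightarrow> g \<in> I \<Longrightarrow> f \<inter> g \<noteq> {} \<Longrightarrow> g \<in> cluster I e"
  unfolding cluster_def by (auto intro: rtrancl_into_rtrancl)

lemma cluster_induct [consumes 1, case_names base step]:
  assumes "f \<in> cluster I e" "P e"
    "\<And>f g. f \<in> cluster I e \<Longrightarrow> f \<in> I \<Longrightarrow> g \<in> I \<Longrightarrow> f \<inter> g \<noteq> {} \<Longrightarrow> P f \<Longrightarrow> P g"
  shows "P f"
proof -
  have "(e, f) \<in> {(f, g). f \<in> I \<and> g \<in> I \<and> f \<inter> g \<noteq> {}}\<^sup>*" using assms(1) by (simp add: cluster_def)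
  then show ?thesis
  proof (induct rule: rtrancl_induct)
    case (step y z)
    then show ?case using assms(3)[of y z] by (simp add: cluster_def)
  qed (rule assms(2))
qed

lemma cluster_subset: "e \<in> I \<Longrightarrow> cluster I e \<subseteq> I"
proof
  fix f assume "e \<in> I" "f \<in> cluster I e"
  from this(2,1) show "f \<in> I" by (induct rule: cluster_induct)
qed

lemma cluster_Un:
  assumes "\<forall>e\<in>I1. e \<subseteq> V1" "\<forall>e\<in>I2. e \<subseteq> V2" "V1 \<inter> V2 = {}" "e \<in> I1"
  shows "cluster (I1 \<union> I2) e = cluster I1 e"
proof (intro equalityI subsetI)
  fix f assume "f \<in> cluster (I1 \<union> I2) e"
  then have "f \<in> I1 \<and> f \<in> cluster I1 e"
  proof (induct rule: cluster_induct)
    case (step f g)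
    then have f: "f \<in> I1" "f \<in> cluster I1 e" by auto
    have "g \<in> I1"
    proof (rule ccontr)
      assume "g \<notin> I1"
      then have "g \<in> I2" using step by auto
      then have "g \<subseteq> V2" "f \<subseteq> V1" using assms(1,2) f(1) by simp_all
      then show False using step(4) assms(3) by auto
    qed
    then show ?case using f cluster_step[OF f(2,1)] step(4) by simp
  qed (use assms(4) in simp)
  then show "f \<in> cluster I1 e" ..
next
  fix f assume "f \<in> cluster I1 e"
  then show "f \<in> cluster (I1 \<union> I2) e"
    by (induct rule: cluster_induct) (auto intro: cluster_step)
qed

text \<open>
  \<open>psi r k V I\<close> is the expectation of \<open>F choose k\<close>, \<open>F\<close> being the final number of fireproof
  vertices, from a configuration with inflammable edges \<open>I\<close> in which \<open>V\<close> is the set of vertices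
  without a burnt edge. The recursion conditions on the first event.
\<close>

function psi :: "real \<Rightarrow> nat \<Rightarrow> 'v set \<Rightarrow> 'v set set \<Rightarrow> real" where
  "psi r k V I = (if finite I \<and> I \<noteq> {} then
     (\<Sum>e\<in>I. psi r k V (I - {e}) + r * psi r k (V - \<Union>(cluster I e)) (I - cluster I e)) /
       ((1 + r) * real (card I))
   else real (card V choose k))"
  by auto
termination
proof (relation "Wellfounded.measure (\<lambda>(r, k, V, I). card I)", goal_cases)
  case (3 r k V I e)
  then have "I - cluster I e \<subset> I" using cluster_self[of e I] by blast
  then show ?case using 3 by (auto intro: psubset_card_mono)
qed (auto simp del: card_Diff_insert intro!: card_Diff1_less)

declare psi.simps [simp del]

lemma psi_empty [simp]: "psi r k V {} = real (card V choose k)"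
  by (simp add: psi.simps)

lemma psi_rec:
  assumes "finite I" "r \<ge> 0"
  shows "(1 + r) * real (card I) * psi r k V I =
    (\<Sum>e\<in>I. psi r k V (I - {e}) + r * psi r k (V - \<Union>(cluster I e)) (I - cluster I e))"
proof (cases "I = {}")
  case False
  then have "(1 + r) * real (card I) \<noteq> 0" using assms by auto
  then show ?thesis using False assms by (subst psi.simps) (simp del: mult_eq_0_iff)
qed simp

text \<open>The recursion determines its solution from the values without edges. A candidate
  \<open>f\<close> has to satisfy it only below \<open>U\<close> and \<open>I\<close>, which leaves
  room for formulas that are meaningful only there.\<close>

lemma psi_unique:
  assumes "finite I" "r \<ge> 0" "V \<subseteq> U" "\<And>V. V \<subseteq> U \<Longrightarrow> f V {} = real (card V choose k)"
    "\<And>V J. V \<subseteq> U \<Longrightarrow> J \<subseteq> I \<Longrightarrow> (1 + r) * real (card J) * f V J =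
      (\<Sum>e\<in>J. f V (J - {e}) + r * f (V - \<Union>(cluster J e)) (J - cluster J e))"
  shows "psi r k V I = f V I"
proof -
  have "psi r k V J = f V J" if "J \<subseteq> I" "V \<subseteq> U" for V J
    using that
  proof (induct "card J" arbitrary: V J rule: less_induct)
    case less
    have fJ: "finite J" using less.prems(1) assms(1) by (rule finite_subset)
    show ?case
    proof (cases "J = {}")
      case False
      let ?R = "\<lambda>g e. g V (J - {e}) + r * g (V - \<Union>(cluster J e)) (J - cluster J e)"
      have "(1 + r) * real (card J) * psi r k V J = (\<Sum>e\<in>J. ?R (psi r k) e)"
        by (rule psi_rec[OF fJ assms(2)])
      also have "\<dots> = (\<Sum>e\<in>J. ?R f e)"
      proof (rule sum.cong[OF refl])
        fix e assume e: "e \<in> J"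
        have "J - cluster J e \<subset> J" using e cluster_self[of e J] by blast
        then have "card (J - cluster J e) < card J" using fJ by (intro psubset_card_mono)
        moreover have "card (J - {e}) < card J" using e fJ by (intro card_Diff1_less)
        ultimately have "psi r k V (J - {e}) = f V (J - {e})"
          "psi r k (V - \<Union>(cluster J e)) (J - cluster J e) = f (V - \<Union>(cluster J e)) (J - cluster J e)"
          using less.prems by (auto intro!: less.hyps)
        then show "?R (psi r k) e = ?R f e" by simp
      qed
      also have "\<dots> = (1 + r) * real (card J) * f V J" using assms(5) less.prems by simp
      finally show ?thesis using False fJ assms(2) by auto
    qed (simp add: assms(4) less.prems)
  qed
  then show ?thesis using assms(3) by simp
qed

lemma psi_0: "finite I \<Longrightarrow> r \<ge> 0 \<Longrightarrow> psi r 0 V I = 1"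
  by (rule psi_unique[of _ _ _ UNIV]) auto

text \<open>Without fires no vertex is lost. This trivial case later supplies the total mass of the
  weights.\<close>

lemma psi_rate_0: "finite I \<Longrightarrow> psi 0 k V I = real (card V choose k)"
  by (rule psi_unique[of _ _ _ UNIV]) auto

text \<open>Independence of the dynamics on two disjoint parts. The right side obeys the recursion
  of \<open>psi\<close>: an event in one part leaves the other factor alone, and the event rates of
  the parts add up. Without edges it is Vandermonde's identity.\<close>

lemma psi_Un:
  assumes I: "finite I1" "finite I2" and r: "r \<ge> 0" and V: "finite V1" "finite V2" "V1 \<inter> V2 = {}"
    and e1: "\<forall>e\<in>I1. e \<noteq> {} \<and> e \<subseteq> V1" and e2: "\<forall>e\<in>I2. e \<noteq> {} \<and> e \<subseteq> V2"
  shows "psi r k (V1 \<union> V2) (I1 \<union> I2) = (\<Sum>j\<le>k. psi r j V1 I1 * psi r (k - j) V2 I2)"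
proof -
  \<comment> \<open>Intersections with \<open>V1\<close>, \<open>V2\<close>, \<open>I1\<close>,
    \<open>I2\<close> extend the product formula to every configuration reached by the recursion, as
    \<open>psi_unique\<close> demands.\<close>
  define f where "f V I = (\<Sum>j\<le>k. psi r j (V \<inter> V1) (I \<inter> I1) * psi r (k - j) (V \<inter> V2) (I \<inter> I2))" for V I
  have "e \<notin> I2" if "e \<in> I1" for e
    using e1[rule_format, OF that] e2[rule_format, of e] V(3) by blast
  then have dI: "I1 \<inter> I2 = {}" by auto
  have "psi r k (V1 \<union> V2) (I1 \<union> I2) = f (V1 \<union> V2) (I1 \<union> I2)"
  proof (rule psi_unique[of _ _ _ "V1 \<union> V2"])
    fix V assume sub: "V \<subseteq> V1 \<union> V2"
    have "card V = card (V \<inter> V1) + card (V \<inter> V2)"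
      using V sub card_Un_disjoint[of "V \<inter> V1" "V \<inter> V2"] by (simp add: Int_Un_distrib[symmetric] Int_absorb2 disjoint_iff)
    then show "f V {} = real (card V choose k)"
      by (simp add: f_def vandermonde[symmetric])
  next
    fix V J assume sub: "V \<subseteq> V1 \<union> V2" "J \<subseteq> I1 \<union> I2"
    let ?F = "\<lambda>k V I e. psi r k V (I - {e}) + r * psi r k (V - \<Union>(cluster I e)) (I - cluster I e)"
    let ?J1 = "J \<inter> I1" and ?J2 = "J \<inter> I2" and ?U1 = "V \<inter> V1" and ?U2 = "V \<inter> V2"
    have J: "J = ?J1 \<union> ?J2" "?J1 \<inter> ?J2 = {}" "finite ?J1" "finite ?J2" using sub dI I by auto
    have v1: "\<forall>e\<in>?J1. e \<subseteq> V1" and v2: "\<forall>e\<in>?J2. e \<subseteq> V2" using e1 e2 by auto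
    let ?G = "\<lambda>e. f V (J - {e}) + r * f (V - \<Union>(cluster J e)) (J - cluster J e)"
    have s1: "?G e = (\<Sum>j\<le>k. ?F j ?U1 ?J1 e * psi r (k - j) ?U2 ?J2)" if e: "e \<in> ?J1" for e
    proof -
      have c: "cluster J e = cluster ?J1 e" using cluster_Un[OF v1 v2 V(3) e] J(1) by simp
      have cs: "cluster ?J1 e \<subseteq> ?J1" by (rule cluster_subset[OF e])
      then have "\<Union>(cluster ?J1 e) \<subseteq> V1" using v1 by auto
      then have "(V - \<Union>(cluster ?J1 e)) \<inter> V1 = ?U1 - \<Union>(cluster ?J1 e)" "(V - \<Union>(cluster ?J1 e)) \<inter> V2 = ?U2"
        using V(3) by auto
      moreover have "(J - {e}) \<inter> I1 = ?J1 - {e}" "(J - {e}) \<inter> I2 = ?J2"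
        "(J - cluster ?J1 e) \<inter> I1 = ?J1 - cluster ?J1 e" "(J - cluster ?J1 e) \<inter> I2 = ?J2" using e cs dI by auto
      ultimately show ?thesis
        unfolding f_def c by (simp add: sum_distrib_left distrib_right sum.distrib mult.assoc)
    qed
    have s2: "?G e = (\<Sum>j\<le>k. psi r j ?U1 ?J1 * ?F (k - j) ?U2 ?J2 e)" if e: "e \<in> ?J2" for e
    proof -
      have "V2 \<inter> V1 = {}" "?J2 \<union> ?J1 = J" using V(3) J(1) by auto
      then have c: "cluster J e = cluster ?J2 e" using cluster_Un[OF v2 v1 _ e] by simp
      have cs: "cluster ?J2 e \<subseteq> ?J2" by (rule cluster_subset[OF e])
      then have "\<Union>(cluster ?J2 e) \<subseteq> V2" using v2 by auto
      then have "(V - \<Union>(cluster ?J2 e)) \<inter> V2 = ?U2 - \<Union>(cluster ?J2 e)" "(V - \<Union>(cluster ?J2 e)) \<inter> V1 = ?U1"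
        using V(3) by auto
      moreover have "(J - {e}) \<inter> I2 = ?J2 - {e}" "(J - {e}) \<inter> I1 = ?J1"
        "(J - cluster ?J2 e) \<inter> I2 = ?J2 - cluster ?J2 e" "(J - cluster ?J2 e) \<inter> I1 = ?J1" using e cs dI by auto
      ultimately show ?thesis
        unfolding f_def c by (simp add: sum_distrib_left distrib_left sum.distrib mult_ac)
    qed
    have "(\<Sum>e\<in>J. ?G e) = (\<Sum>e\<in>?J1. ?G e) + (\<Sum>e\<in>?J2. ?G e)"
      by (subst (1) J(1), rule sum.union_disjoint) (use J in auto)
    also have "\<dots> = (\<Sum>e\<in>?J1. \<Sum>j\<le>k. ?F j ?U1 ?J1 e * psi r (k - j) ?U2 ?J2) +
        (\<Sum>e\<in>?J2. \<Sum>j\<le>k. psi r j ?U1 ?J1 * ?F (k - j) ?U2 ?J2 e)"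
      using s1 s2 by (intro arg_cong2[where f = "(+)"] sum.cong refl)
    also have "\<dots> = (\<Sum>j\<le>k. (\<Sum>e\<in>?J1. ?F j ?U1 ?J1 e) * psi r (k - j) ?U2 ?J2) +
        (\<Sum>j\<le>k. psi r j ?U1 ?J1 * (\<Sum>e\<in>?J2. ?F (k - j) ?U2 ?J2 e))"
      unfolding sum_distrib_left sum_distrib_right
      by (intro arg_cong2[where f = "(+)"]; rule sum.swap)
    also have "\<dots> = (\<Sum>j\<le>k. ((1 + r) * real (card ?J1) * psi r j ?U1 ?J1) * psi r (k - j) ?U2 ?J2) +
        (\<Sum>j\<le>k. psi r j ?U1 ?J1 * ((1 + r) * real (card ?J2) * psi r (k - j) ?U2 ?J2))"
      by (simp only: psi_rec[OF J(3) r] psi_rec[OF J(4) r])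
    also have "\<dots> = (1 + r) * (real (card ?J1) + real (card ?J2)) * f V J"
      by (simp add: f_def sum_distrib_left sum.distrib[symmetric] algebra_simps)
    also have "real (card ?J1) + real (card ?J2) = real (card J)"
      using card_Un_disjoint[OF J(3,4,2)] J(1) by simp
    finally show "(1 + r) * real (card J) * f V J = (\<Sum>e\<in>J. ?G e)" ..
  qed (use I r in auto)
  moreover have "(I1 \<union> I2) \<inter> I1 = I1" "(I1 \<union> I2) \<inter> I2 = I2" "(V1 \<union> V2) \<inter> V1 = V1" "(V1 \<union> V2) \<inter> V2 = V2"
    by auto
  ultimately show ?thesis by (simp add: f_def)
qed

lemma cluster_tree:
  assumes "is_tree V E" "e \<in> E"
  shows "cluster E e = E"
proof (rule antisym[OF cluster_subset[OF assms(2)]], rule subsetI)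
  fix f assume f: "f \<in> E"
  have E: "\<forall>e\<in>E. e \<subseteq> V \<and> card e = 2" "\<forall>u\<in>V. \<forall>v\<in>V. (u, v) \<in> reach E"
    using assms(1) by (simp_all add: is_tree_iff_bridges)
  have ne: "e \<noteq> {}" "f \<noteq> {}" and ef: "e \<subseteq> V" "f \<subseteq> V" using E(1) assms(2) f by force+
  then obtain a x where ax: "a \<in> e" "x \<in> f" by blast
  then have "a \<in> V" "x \<in> V" using ef by auto
  then have "(a, x) \<in> reach E" using E(2) by simp
  then have "\<forall>g\<in>E. x \<in> g \<longrightarrow> g \<in> cluster E e"
  proof (induct rule: reach_induct)
    case base
    show ?case using cluster_step[of e E e] assms(2) ax(1) by auto
  next
    case (step y z)
    then have yz: "{y, z} \<in> cluster E e" by simp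
    show ?case using cluster_step[OF yz step(2)] by auto
  qed
  then show "f \<in> cluster E e" using f ax by simp
qed

lemma Union_tree_edges:
  assumes "is_tree V E" "E \<noteq> {}"
  shows "\<Union>E = V"
proof (intro equalityI subsetI)
  fix v assume v: "v \<in> V"
  obtain e where e: "e \<in> E" using assms(2) by blast
  then have "e \<subseteq> V" "card e = 2" using assms(1) by (simp_all add: is_tree_def)
  then have "V \<noteq> {v}" using card_mono[of "{v}" e] by auto
  then show "v \<in> \<Union>E" using is_tree_edge_exists[OF assms(1) v] by blast
qed (use assms in \<open>auto simp: is_tree_def\<close>)

section \<open>Summation over all trees on a vertex set\<close>

lemma sum_oriented_edges:
  fixes g :: "'v set \<Rightarrow> real"
  assumes "finite E" "\<forall>e\<in>E. card e = 2"
  shows "(\<Sum>(a, b)\<in>{(a, b). {a, b} \<in> E}. g {a, b}) = 2 * (\<Sum>e\<in>E. g e)"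
proof -
  let ?S = "{(a, b). {a, b} \<in> E}"
  have fe: "finite e" if "e \<in> E" for e using that assms(2) card.infinite by fastforce
  have "?S \<subseteq> \<Union>E \<times> \<Union>E" by auto
  then have fS: "finite ?S" using fe assms(1) by (auto intro: finite_subset)
  have "(\<Sum>(a, b)\<in>?S. g {a, b}) = (\<Sum>e\<in>E. \<Sum>p\<in>{p\<in>?S. (case p of (a, b) \<Rightarrow> {a, b}) = e}. case p of (a, b) \<Rightarrow> g {a, b})"
    by (rule sum.group[symmetric]) (use assms fS in auto)
  also have "\<dots> = (\<Sum>e\<in>E. 2 * g e)"
  proof (rule sum.cong[OF refl])
    fix e assume e: "e \<in> E"
    then obtain x y where xy: "e = {x, y}" "x \<noteq> y" using assms(2) by (metis card_2_iff)
    have "{p\<in>?S. (case p of (a, b) \<Rightarrow> {a, b}) = e} = {(x, y), (y, x)}"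
      using e xy by (auto simp: doubleton_eq_iff insert_commute)
    then show "(\<Sum>p\<in>{p\<in>?S. (case p of (a, b) \<Rightarrow> {a, b}) = e}. case p of (a, b) \<Rightarrow> g {a, b}) = 2 * g e"
      using xy by (simp add: insert_commute)
  qed
  finally show ?thesis by (simp add: sum_distrib_left)
qed

text \<open>A sum, not an average: in this form the recursion contains no ratios of tree counts, and
  \<open>k = 0\<close> gives the tree count itself.\<close>

definition tree_sum :: "real \<Rightarrow> nat \<Rightarrow> 'v set \<Rightarrow> real" where
  "tree_sum r k V = (\<Sum>E\<in>Collect (is_tree V). psi r k V E)"

text \<open>The first event strikes each edge at the same rate. A fireproof edge cuts the tree, and
  \<open>psi_Un\<close> splits the moment; a fire destroys everything. The factor 2 counts
  orientations of the edge, and the two cardinalities count its possible endpoints.\<close>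

lemma tree_sum_rec:
  assumes V: "finite V" and r: "r \<ge> 0"
  shows "2 * (1 + r) * (real (card V) - 1) * tree_sum r k V =
    (\<Sum>W\<in>{W. W \<subseteq> V}. real (card W) * real (card (V - W)) *
       (\<Sum>j\<le>k. tree_sum r j W * tree_sum r (k - j) (V - W))) +
    2 * r * (real (card V) - 1) * of_bool (k = 0) * real (card (Collect (is_tree V)))"
proof -
  have *: "2 * (1 + r) * (real (card V) - 1) * psi r k V E =
     (\<Sum>(a, b)\<in>{(a, b). {a, b} \<in> E}. psi r k V (E - {{a, b}})) + 2 * r * (real (card V) - 1) * of_bool (k = 0)"
    if E: "is_tree V E" for E
  proof -
    have fE: "finite E" using is_tree_finite_edges[OF E V] .
    have c2: "\<forall>e\<in>E. card e = 2" using E by (simp add: is_tree_def)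
    have n: "real (card V) - 1 = real (card E)" using card_tree_edges[OF V E] by linarith
    have "(1 + r) * real (card E) * psi r k V E =
      (\<Sum>e\<in>E. psi r k V (E - {e}) + r * psi r k (V - \<Union>(cluster E e)) (E - cluster E e))"
      by (rule psi_rec[OF fE r])
    also have "\<dots> = (\<Sum>e\<in>E. psi r k V (E - {e}) + r * of_bool (k = 0))"
    proof (rule sum.cong[OF refl])
      fix e assume e: "e \<in> E"
      \<comment> \<open>The cluster of any edge is the whole tree, so after a fire no vertex is left
        and the value is \<open>0 choose k\<close>.\<close>
      then have "\<Union>E = V" using Union_tree_edges[OF E] by auto
      then show "psi r k V (E - {e}) + r * psi r k (V - \<Union>(cluster E e)) (E - cluster E e) =
          psi r k V (E - {e}) + r * of_bool (k = 0)"
        unfolding cluster_tree[OF E e] by (cases k) auto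
    qed
    also have "\<dots> = (\<Sum>e\<in>E. psi r k V (E - {e})) + real (card E) * r * of_bool (k = 0)"
      by (simp add: sum.distrib)
    finally show ?thesis
      unfolding n using sum_oriented_edges[OF fE c2, of "\<lambda>e. psi r k V (E - {e})"]
      by (simp add: algebra_simps)
  qed
  have "2 * (1 + r) * (real (card V) - 1) * tree_sum r k V =
    (\<Sum>E\<in>Collect (is_tree V). 2 * (1 + r) * (real (card V) - 1) * psi r k V E)"
    by (simp add: tree_sum_def sum_distrib_left)
  also have "\<dots> = (\<Sum>E\<in>Collect (is_tree V). (\<Sum>(a, b)\<in>{(a, b). {a, b} \<in> E}. psi r k V (E - {{a, b}})) +
      2 * r * (real (card V) - 1) * of_bool (k = 0))"
    by (rule sum.cong[OF refl]) (use * in auto)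
  also have "\<dots> = (\<Sum>E\<in>Collect (is_tree V). \<Sum>(a, b)\<in>{(a, b). {a, b} \<in> E}. psi r k V (E - {{a, b}})) +
      2 * r * (real (card V) - 1) * of_bool (k = 0) * real (card (Collect (is_tree V)))"
    by (simp add: sum.distrib)
  also have "(\<Sum>E\<in>Collect (is_tree V). \<Sum>(a, b)\<in>{(a, b). {a, b} \<in> E}. psi r k V (E - {{a, b}})) =
      (\<Sum>(E, a, b)\<in>{(E, a, b). is_tree V E \<and> {a, b} \<in> E}. psi r k V (E - {{a, b}}))"
  proof -
    have "finite {(a, b). {a, b} \<in> E}" if "is_tree V E" for E
      by (rule finite_subset[of _ "V \<times> V"]) (use that V in \<open>auto simp: is_tree_def\<close>)
    then have "(\<Sum>E\<in>Collect (is_tree V). \<Sum>(a, b)\<in>{(a, b). {a, b} \<in> E}. psi r k V (E - {{a, b}})) =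
      (\<Sum>(E, a, b)\<in>(SIGMA E:Collect (is_tree V). {(a, b). {a, b} \<in> E}). psi r k V (E - {{a, b}}))"
      by (intro sum.Sigma) (auto simp: finite_trees[OF V])
    also have "(SIGMA E:Collect (is_tree V). {(a, b). {a, b} \<in> E}) = {(E, a, b). is_tree V E \<and> {a, b} \<in> E}"
      by auto
    finally show ?thesis .
  qed
  also have "\<dots> = (\<Sum>W\<in>{W. W \<subseteq> V}. \<Sum>E1\<in>Collect (is_tree W). \<Sum>E2\<in>Collect (is_tree (V - W)).
       \<Sum>a\<in>W. \<Sum>b\<in>V - W. psi r k V (insert {a, b} (E1 \<union> E2) - {{a, b}}))"
    by (rule sum_oriented_tree_edges[OF V])
  also have "\<dots> = (\<Sum>W\<in>{W. W \<subseteq> V}. \<Sum>E1\<in>Collect (is_tree W). \<Sum>E2\<in>Collect (is_tree (V - W)).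
       real (card W) * real (card (V - W)) * (\<Sum>j\<le>k. psi r j W E1 * psi r (k - j) (V - W) E2))"
  proof (intro sum.cong refl)
    fix W E1 E2 assume "W \<in> {W. W \<subseteq> V}" "E1 \<in> Collect (is_tree W)" "E2 \<in> Collect (is_tree (V - W))"
    then have W: "W \<subseteq> V" "is_tree W E1" "is_tree (V - W) E2" by auto
    have fW: "finite W" "finite (V - W)" using W(1) V finite_subset by auto
    have "\<forall>e\<in>E1. e \<subseteq> W \<and> card e = 2" using W(2) by (simp add: is_tree_def)
    then have e1: "\<forall>e\<in>E1. e \<noteq> {} \<and> e \<subseteq> W" by fastforce
    have "\<forall>e\<in>E2. e \<subseteq> V - W \<and> card e = 2" using W(3) by (simp add: is_tree_def)
    then have e2: "\<forall>e\<in>E2. e \<noteq> {} \<and> e \<subseteq> V - W" by fastforce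
    have "insert {a, b} (E1 \<union> E2) - {{a, b}} = E1 \<union> E2" if "a \<in> W" "b \<in> V - W" for a b
      using e1[rule_format, of "{a, b}"] e2[rule_format, of "{a, b}"] that by auto
    then have "(\<Sum>a\<in>W. \<Sum>b\<in>V - W. psi r k V (insert {a, b} (E1 \<union> E2) - {{a, b}})) =
      (\<Sum>a\<in>W. \<Sum>b\<in>V - W. psi r k V (E1 \<union> E2))" by (intro sum.cong refl) simp
    also have "\<dots> = real (card W) * real (card (V - W)) * psi r k (W \<union> (V - W)) (E1 \<union> E2)"
      using W(1) by (simp add: Un_absorb1)
    also have "psi r k (W \<union> (V - W)) (E1 \<union> E2) = (\<Sum>j\<le>k. psi r j W E1 * psi r (k - j) (V - W) E2)"
      using fW e1 e2 r is_tree_finite_edges[OF W(2) fW(1)] is_tree_finite_edges[OF W(3) fW(2)]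
      by (intro psi_Un) auto
    finally show "(\<Sum>a\<in>W. \<Sum>b\<in>V - W. psi r k V (insert {a, b} (E1 \<union> E2) - {{a, b}})) =
       real (card W) * real (card (V - W)) * (\<Sum>j\<le>k. psi r j W E1 * psi r (k - j) (V - W) E2)" .
  qed
  also have "\<dots> = (\<Sum>W\<in>{W. W \<subseteq> V}. real (card W) * real (card (V - W)) *
       (\<Sum>j\<le>k. tree_sum r j W * tree_sum r (k - j) (V - W)))"
  proof (rule sum.cong[OF refl])
    fix W
    have "(\<Sum>E1\<in>Collect (is_tree W). \<Sum>E2\<in>Collect (is_tree (V - W)). \<Sum>j\<le>k. psi r j W E1 * psi r (k - j) (V - W) E2)
      = (\<Sum>E1\<in>Collect (is_tree W). \<Sum>j\<le>k. \<Sum>E2\<in>Collect (is_tree (V - W)). psi r j W E1 * psi r (k - j) (V - W) E2)"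
      by (intro sum.cong refl sum.swap)
    also have "\<dots> = (\<Sum>j\<le>k. \<Sum>E1\<in>Collect (is_tree W). \<Sum>E2\<in>Collect (is_tree (V - W)). psi r j W E1 * psi r (k - j) (V - W) E2)"
      by (rule sum.swap)
    also have "\<dots> = (\<Sum>j\<le>k. tree_sum r j W * tree_sum r (k - j) (V - W))"
      by (simp add: tree_sum_def sum_product)
    finally show "(\<Sum>E1\<in>Collect (is_tree W). \<Sum>E2\<in>Collect (is_tree (V - W)).
       real (card W) * real (card (V - W)) * (\<Sum>j\<le>k. psi r j W E1 * psi r (k - j) (V - W) E2)) =
       real (card W) * real (card (V - W)) * (\<Sum>j\<le>k. tree_sum r j W * tree_sum r (k - j) (V - W))"
      by (simp only: sum_distrib_left[symmetric])
  qed
  finally show ?thesis .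
qed

lemma tree_sum_0: "finite V \<Longrightarrow> r \<ge> 0 \<Longrightarrow> tree_sum r 0 V = real (card (Collect (is_tree V)))"
  using psi_0 is_tree_finite_edges unfolding tree_sum_def by (simp add: psi_0 is_tree_finite_edges)

lemma tree_sum_rate_0: "finite V \<Longrightarrow>
    tree_sum 0 k V = real (card V choose k) * real (card (Collect (is_tree V)))"
  unfolding tree_sum_def by (simp add: psi_rate_0 is_tree_finite_edges)

text \<open>For \<open>k = 0\<close> the fire term is a multiple of the left side and cancels its
  part with \<open>r\<close>; for \<open>k > 0\<close> it vanishes. This is the origin of the two
  factors.\<close>

lemma tree_sum_rec':
  assumes "finite V" "r \<ge> 0"
  shows "2 * (if k = 0 then 1 else 1 + r) * (real (card V) - 1) * tree_sum r k V =
    (\<Sum>W\<in>{W. W \<subseteq> V}. real (card W) * real (card (V - W)) *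
       (\<Sum>j\<le>k. tree_sum r j W * tree_sum r (k - j) (V - W)))"
  using tree_sum_rec[OF assms, of k] tree_sum_0[OF assms] by (cases "k = 0") (auto simp: algebra_simps)

lemma sum_subsets_by_card:
  fixes g :: "nat \<Rightarrow> real"
  assumes "finite V"
  shows "(\<Sum>W\<in>{W. W \<subseteq> V}. g (card W)) = (\<Sum>m\<le>card V. real (card V choose m) * g m)"
proof -
  have "(\<Sum>W\<in>{W. W \<subseteq> V}. g (card W)) = (\<Sum>m\<in>{..card V}. \<Sum>W\<in>{W\<in>{W. W \<subseteq> V}. card W = m}. g (card W))"
    by (rule sum.group[symmetric]) (use assms card_mono in auto)
  also have "\<dots> = (\<Sum>m\<le>card V. real (card V choose m) * g m)"
    using n_subsets[OF assms] by (intro sum.cong refl) simp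
  finally show ?thesis .
qed

definition tree_num :: "real \<Rightarrow> nat \<Rightarrow> nat \<Rightarrow> real" where
  "tree_num r k n = tree_sum r k {1..n}"

lemma tree_sum_empty [simp]: "tree_sum r k {} = 0"
  unfolding tree_sum_def by (rule sum.neutral) (auto simp: is_tree_def)

lemma tree_sum_singleton [simp]: "tree_sum r k {v} = real (1 choose k)"
proof -
  have "Collect (is_tree {v}) = {{}}" by (auto simp: is_tree_singleton)
  then show ?thesis by (simp add: tree_sum_def)
qed

text \<open>Invariance under relabelling, obtained from the recursion: it reduces a set with at
  least two elements to proper subsets, of which only the sizes enter.\<close>

lemma tree_sum_card:
  fixes V :: "nat set"
  assumes "r \<ge> 0" "finite V"
  shows "tree_sum r k V = tree_num r k (card V)"
  using assms(2)
proof (induct "card V" arbitrary: V k rule: less_induct)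
  case less
  show ?case
  proof (cases "card V \<le> 1")
    case True
    then consider "V = {}" | v where "V = {v}"
      using less.prems by (metis One_nat_def card_0_eq card_1_singletonE le_Suc_eq le_zero_eq)
    then show ?thesis by cases (auto simp: tree_num_def)
  next
    case False
    define g where "g m = real m * real (card V - m) * (\<Sum>j\<le>k. tree_num r j m * tree_num r (k - j) (card V - m))" for m
    have *: "2 * (if k = 0 then 1 else 1 + r) * (real (card V) - 1) * tree_sum r k U = (\<Sum>m\<le>card V. real (card V choose m) * g m)"
      if U: "finite U" "card U = card V" for U :: "nat set"
    proof -
      have "2 * (if k = 0 then 1 else 1 + r) * (real (card U) - 1) * tree_sum r k U =
        (\<Sum>W\<in>{W. W \<subseteq> U}. real (card W) * real (card (U - W)) *
         (\<Sum>j\<le>k. tree_sum r j W * tree_sum r (k - j) (U - W)))"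
        by (rule tree_sum_rec'[OF U(1) assms(1)])
      also have "\<dots> = (\<Sum>W\<in>{W. W \<subseteq> U}. g (card W))"
      proof (rule sum.cong[OF refl])
        fix W assume "W \<in> {W. W \<subseteq> U}"
        then have W: "W \<subseteq> U" "finite W" using U finite_subset by auto
        have c: "card (U - W) = card V - card W" using W U by (simp add: card_Diff_subset)
        show "real (card W) * real (card (U - W)) * (\<Sum>j\<le>k. tree_sum r j W * tree_sum r (k - j) (U - W)) = g (card W)"
        \<comment> \<open>In the degenerate case one of the two cardinalities is 0. Otherwise both
          \<open>W\<close> and \<open>U - W\<close> are smaller than \<open>U\<close> and the
          induction hypothesis applies.\<close>
        proof (cases "W = {} \<or> W = U")
          case True
          then show ?thesis using U by (auto simp: g_def)
        next
          case False
          then have "W \<subset> U" "U - W \<subset> U" using W by auto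
          then have lt: "card W < card V" "card (U - W) < card V"
            using U psubset_card_mono by metis+
          have "tree_sum r j W = tree_num r j (card W)" "tree_sum r j (U - W) = tree_num r j (card V - card W)" for j
            using less.hyps[OF lt(1) W(2)] less.hyps[OF lt(2)] U(1) c by simp_all
          then show ?thesis by (simp add: g_def c)
        qed
      qed
      also have "\<dots> = (\<Sum>m\<le>card U. real (card U choose m) * g m)"
        by (rule sum_subsets_by_card[OF U(1)])
      finally show ?thesis using U by simp
    qed
    have "2 * (if k = 0 then 1 else 1 + r) * (real (card V) - 1) \<noteq> 0" using False assms(1) by auto
    moreover have "2 * (if k = 0 then 1 else 1 + r) * (real (card V) - 1) * tree_sum r k V =
        2 * (if k = 0 then 1 else 1 + r) * (real (card V) - 1) * tree_sum r k {1..card V}"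
      using *[of V] *[of "{1..card V}"] less.prems by simp
    ultimately have "tree_sum r k V = tree_sum r k {1..card V}" using mult_left_cancel by blast
    then show ?thesis by (simp add: tree_num_def)
  qed
qed

lemma tree_num_rec:
  assumes "r \<ge> 0"
  shows "2 * (if k = 0 then 1 else 1 + r) * (real n - 1) * tree_num r k n =
    (\<Sum>m\<le>n. real (n choose m) * (real m * real (n - m) *
       (\<Sum>j\<le>k. tree_num r j m * tree_num r (k - j) (n - m))))"
proof -
  let ?g = "\<lambda>m. real m * real (n - m) * (\<Sum>j\<le>k. tree_num r j m * tree_num r (k - j) (n - m))"
  have "2 * (if k = 0 then 1 else 1 + r) * (real n - 1) * tree_num r k n =
    (\<Sum>W\<in>{W. W \<subseteq> {1..n}}. real (card W) * real (card ({1..n} - W)) *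
       (\<Sum>j\<le>k. tree_sum r j W * tree_sum r (k - j) ({1..n} - W)))"
    using tree_sum_rec'[of "{1..n}" r k] assms by (simp add: tree_num_def)
  also have "\<dots> = (\<Sum>W\<in>{W. W \<subseteq> {1..n}}. ?g (card W))"
  proof (rule sum.cong[OF refl])
    fix W assume "W \<in> {W. W \<subseteq> {1..n}}"
    then have W: "W \<subseteq> {1..n}" "finite W" using finite_subset[of W "{1..n}"] by auto
    then have "card ({1..n} - W) = n - card W" by (simp add: card_Diff_subset)
    then show "real (card W) * real (card ({1..n} - W)) *
       (\<Sum>j\<le>k. tree_sum r j W * tree_sum r (k - j) ({1..n} - W)) = ?g (card W)"
      using tree_sum_card[OF assms W(2)] tree_sum_card[OF assms, of "{1..n} - W"] by simp
  qed
  also have "\<dots> = (\<Sum>m\<le>n. real (n choose m) * ?g m)"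
    using sum_subsets_by_card[of "{1..n}" ?g] by simp
  finally show ?thesis .
qed

lemma tree_num_1 [simp]: "tree_num r k 1 = real (1 choose k)" "tree_num r k (Suc 0) = real (1 choose k)"
  by (simp_all add: tree_num_def)

lemma tree_num_0 [simp]: "tree_num r k 0 = 0"
  by (simp add: tree_num_def)

subsection \<open>Generating functions\<close>

unbundle no vec_syntax
unbundle fps_syntax

text \<open>
  Up to the factor \<open>(1 + r) ^ (1 - m)\<close>, \<open>cut_weight r k m\<close> is the coefficient of \<open>T ^ m\<close> in the
  exponential generating function of the \<open>k\<close>-th factorial moments, \<open>T\<close> being the generating
  function of rooted labelled trees. The recursion is the differential equation below read off
  coefficientwise; with this normalization it depends on \<open>r\<close> only weakly.
\<close>

fun cut_weight :: "real \<Rightarrow> nat \<Rightarrow> nat \<Rightarrow> real" where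
  "cut_weight r k m = (if m = 0 then 0 else if m = 1 then of_bool (k = 1) else
     (1 - r / (real m - 1)) * cut_weight r k (m - 1) +
     (real m / (real m - 1)) / 2 *
       (\<Sum>j\<in>{1..<k}. \<Sum>i\<in>{1..<m}. cut_weight r j i * cut_weight r (k - j) (m - i)))"

declare cut_weight.simps [simp del]

lemma cut_weight_0 [simp]: "cut_weight r k 0 = 0"
  by (simp add: cut_weight.simps)

lemma cut_weight_1: "cut_weight r k 1 = of_bool (k = 1)" "cut_weight r k (Suc 0) = of_bool (k = 1)"
  by (simp_all add: cut_weight.simps)

lemma cut_weight_rec:
  "m \<ge> 2 \<Longrightarrow> cut_weight r k m = (1 - r / (real m - 1)) * cut_weight r k (m - 1) +
     (real m / (real m - 1)) / 2 *
       (\<Sum>j\<in>{1..<k}. \<Sum>i\<in>{1..<m}. cut_weight r j i * cut_weight r (k - j) (m - i))"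
  by (subst cut_weight.simps) simp

text \<open>Ratio of the \<open>n\<close>-th coefficients of \<open>T ^ m\<close> and
  \<open>T\<close>, as \<open>tree_power_nth\<close> shows; for \<open>n \<ge> 1\<close> it vanishes
  when \<open>m > n\<close>.\<close>

definition spine_weight :: "nat \<Rightarrow> nat \<Rightarrow> real" where
  "spine_weight n m = real m * (\<Prod>i\<in>{1..<m}. 1 - real i / real n)"

context
  fixes B :: "nat \<Rightarrow> nat \<Rightarrow> real" and r :: real
  assumes r: "r \<ge> 0"
    and rec: "\<And>k n. 2 * (if k = 0 then 1 else 1 + r) * (real n - 1) * B k n =
      (\<Sum>m\<le>n. real (n choose m) * (real m * real (n - m) * (\<Sum>j\<le>k. B j m * B (k - j) (n - m))))"
    and B0: "\<And>k. B k 0 = 0" and B1: "\<And>k. B k 1 = real (1 choose k)"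
begin

text \<open>\<open>B k n\<close> stands for \<open>tree_num r k n\<close>. The factor
  \<open>n\<close> marks a root, so that \<open>tree_gf 0\<close> is the series \<open>T\<close>; it
  also absorbs the factors \<open>m\<close> and \<open>n - m\<close> of the recursion, whose right
  side becomes a Cauchy product.\<close>

definition tree_gf :: "nat \<Rightarrow> real fps" where
  "tree_gf k = Abs_fps (\<lambda>n. real n * B k n / fact n)"

lemma tree_gf_ode:
  "fps_const (2 * (if k = 0 then 1 else 1 + r)) * (fps_X * fps_deriv (tree_gf k) - tree_gf k) =
    fps_X * fps_deriv (\<Sum>j\<le>k. tree_gf j * tree_gf (k - j))"
proof (rule fps_ext)
  fix n
  have "(\<Sum>j\<le>k. tree_gf j * tree_gf (k - j)) $ n = (\<Sum>j\<le>k. \<Sum>m\<le>n. tree_gf j $ m * tree_gf (k - j) $ (n - m))"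
    by (simp add: fps_sum_nth fps_mult_nth atLeast0AtMost)
  also have "\<dots> = (\<Sum>m\<le>n. \<Sum>j\<le>k. tree_gf j $ m * tree_gf (k - j) $ (n - m))"
    by (rule sum.swap)
  also have "\<dots> = (\<Sum>m\<le>n. real (n choose m) * (real m * real (n - m) * (\<Sum>j\<le>k. B j m * B (k - j) (n - m))) / fact n)"
  proof (rule sum.cong[OF refl])
    fix m assume "m \<in> {..n}"
    then have "real (n choose m) = fact n / (fact m * fact (n - m))" by (simp add: binomial_fact)
    then show "(\<Sum>j\<le>k. tree_gf j $ m * tree_gf (k - j) $ (n - m)) =
       real (n choose m) * (real m * real (n - m) * (\<Sum>j\<le>k. B j m * B (k - j) (n - m))) / fact n"
      by (simp add: tree_gf_def sum_distrib_left sum_divide_distrib mult_ac)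
  qed
  also have "\<dots> = 2 * (if k = 0 then 1 else 1 + r) * (real n - 1) * B k n / fact n"
    unfolding rec[of k n] by (simp add: sum_divide_distrib)
  finally have s: "(\<Sum>j\<le>k. tree_gf j * tree_gf (k - j)) $ n = 2 * (if k = 0 then 1 else 1 + r) * (real n - 1) * B k n / fact n" .
  have X: "(fps_X * fps_deriv f) $ n = real n * f $ n" for f :: "real fps" by (cases n) auto
  show "(fps_const (2 * (if k = 0 then 1 else 1 + r)) * (fps_X * fps_deriv (tree_gf k) - tree_gf k)) $ n =
     (fps_X * fps_deriv (\<Sum>j\<le>k. tree_gf j * tree_gf (k - j))) $ n"
    unfolding X s fps_mult_left_const_nth fps_sub_nth
    by (simp add: tree_gf_def algebra_simps diff_divide_distrib)
qed

lemma tree_gf_nth_0 [simp]: "tree_gf k $ 0 = 0" by (simp add: tree_gf_def)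

lemma tree_gf_nth_1: "tree_gf k $ Suc 0 = real (1 choose k)" using B1[of k] by (simp add: tree_gf_def)

text \<open>The case \<open>k = 0\<close> of the recursion. It is the logarithmic derivative of
  \<open>T = X * exp T\<close>, and it is the form in which that functional equation enters.\<close>

lemma tree_ode: "fps_X * fps_deriv (tree_gf 0) * (1 - tree_gf 0) = tree_gf 0"
proof -
  have two: "fps_const (2::real) = 2" by (simp add: numeral_fps_const)
  have eq: "2 * (fps_X * fps_deriv (tree_gf 0) - tree_gf 0) = 2 * (fps_X * fps_deriv (tree_gf 0) * tree_gf 0)"
    using tree_gf_ode[of 0] by (simp add: two algebra_simps)
  have "(2::real fps) \<noteq> 0" by (simp add: numeral_fps_const)
  from iffD1[OF mult_left_cancel[OF this] eq]
  have e: "fps_X * fps_deriv (tree_gf 0) - tree_gf 0 = fps_X * fps_deriv (tree_gf 0) * tree_gf 0" .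
  have "fps_X * fps_deriv (tree_gf 0) * (1 - tree_gf 0) = fps_X * fps_deriv (tree_gf 0) - fps_X * fps_deriv (tree_gf 0) * tree_gf 0"
    by (simp only: right_diff_distrib mult_1_right)
  also have "\<dots> = fps_X * fps_deriv (tree_gf 0) - (fps_X * fps_deriv (tree_gf 0) - tree_gf 0)" by (simp only: e)
  finally show ?thesis by simp
qed

definition cut_gf :: "nat \<Rightarrow> real fps" where
  "cut_gf k = Abs_fps (\<lambda>m. (1 / (1 + r)) ^ (m - 1) * cut_weight r k m)"

lemma cut_gf_nth_0 [simp]: "cut_gf k $ 0 = 0" by (simp add: cut_gf_def)

text \<open>The equation \<open>tree_gf_ode\<close> for \<open>k \<ge> 1\<close> rewritten in the
  variable \<open>T\<close>, for which \<open>fps_X\<close> stands here: by \<open>tree_ode\<close>,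
  \<open>X * d/dX\<close> becomes \<open>T / (1 - T) * d/dT\<close>, and the denominator is
  cleared.\<close>

lemma cut_gf_ode:
  "fps_X * fps_deriv (cut_gf k) - cut_gf k - fps_const (1 / (1 + r)) * (fps_X * (fps_X * fps_deriv (cut_gf k))) +
     (1 - fps_const (1 / (1 + r))) * (fps_X * cut_gf k) =
   fps_const (1 / (1 + r)) * (fps_const (1 / 2) * (fps_X * fps_deriv (\<Sum>j\<in>{1..<k}. cut_gf j * cut_gf (k - j))))"
proof (rule fps_ext)
  fix n
  let ?p = "1 / (1 + r)"
  let ?Q = "\<Sum>j\<in>{1..<k}. cut_gf j * cut_gf (k - j)"
  have X: "(fps_X * fps_deriv f) $ n = real n * f $ n" for f :: "real fps" and n by (cases n) auto
  have X2: "(fps_X * (fps_X * fps_deriv f)) $ n = (if n = 0 then 0 else real (n - 1) * f $ (n - 1))"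
    for f :: "real fps" and n
    unfolding fps_X_mult_nth[of "fps_X * fps_deriv f" n] X ..
  have c: "1 - fps_const ?p = fps_const (1 - ?p)" by (simp add: fps_const_1_eq_1 flip: fps_const_sub)
  have l: "(fps_X * fps_deriv (cut_gf k) - cut_gf k - fps_const ?p * (fps_X * (fps_X * fps_deriv (cut_gf k))) +
     (1 - fps_const ?p) * (fps_X * cut_gf k)) $ n = real n * cut_gf k $ n - cut_gf k $ n -
     (if n = 0 then 0 else ?p * (real (n - 1) * cut_gf k $ (n - 1))) + (if n = 0 then 0 else (1 - ?p) * cut_gf k $ (n - 1))"
    unfolding c fps_add_nth fps_sub_nth fps_mult_left_const_nth X2 X fps_X_mult_nth[of "cut_gf k"] by simp
  show "(fps_X * fps_deriv (cut_gf k) - cut_gf k - fps_const ?p * (fps_X * (fps_X * fps_deriv (cut_gf k))) +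
     (1 - fps_const ?p) * (fps_X * cut_gf k)) $ n = (fps_const ?p * (fps_const (1 / 2) * (fps_X * fps_deriv ?Q))) $ n"
    unfolding l fps_mult_left_const_nth X
  proof -
    \<comment> \<open>Each factor of a product carries its own exponent lowered by 1, so a product
      has one power of \<open>1 / (1 + r)\<close> less than the \<open>n\<close>-th coefficient of
      \<open>cut_gf\<close>; the constant in front of the right side restores it.\<close>
    have Q: "?Q $ n = ?p ^ (n - 2) * (\<Sum>j\<in>{1..<k}. \<Sum>i\<in>{1..<n}. cut_weight r j i * cut_weight r (k - j) (n - i))"
    proof -
      have "?Q $ n = (\<Sum>j\<in>{1..<k}. \<Sum>i\<in>{0..n}. cut_gf j $ i * cut_gf (k - j) $ (n - i))"
        by (simp add: fps_sum_nth fps_mult_nth)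
      also have "\<dots> = (\<Sum>j\<in>{1..<k}. \<Sum>i\<in>{1..<n}. cut_gf j $ i * cut_gf (k - j) $ (n - i))"
      proof (rule sum.cong[OF refl])
        fix j
        show "(\<Sum>i\<in>{0..n}. cut_gf j $ i * cut_gf (k - j) $ (n - i)) = (\<Sum>i\<in>{1..<n}. cut_gf j $ i * cut_gf (k - j) $ (n - i))"
        proof (rule sum.mono_neutral_right)
          show "\<forall>i\<in>{0..n} - {1..<n}. cut_gf j $ i * cut_gf (k - j) $ (n - i) = 0"
          proof
            fix i assume "i \<in> {0..n} - {1..<n}"
            then have "i = 0 \<or> i = n" by auto
            then show "cut_gf j $ i * cut_gf (k - j) $ (n - i) = 0" by auto
          qed
        qed auto
      qed
      also have "\<dots> = (\<Sum>j\<in>{1..<k}. \<Sum>i\<in>{1..<n}. ?p ^ (n - 2) * (cut_weight r j i * cut_weight r (k - j) (n - i)))"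
      proof (intro sum.cong refl)
        fix j i assume "i \<in> {1..<n}"
        then have "n - 2 = (i - 1) + (n - i - 1)" by auto
        then have "?p ^ (n - 2) = ?p ^ (i - 1) * ?p ^ (n - i - 1)" by (simp only: power_add)
        then show "cut_gf j $ i * cut_gf (k - j) $ (n - i) = ?p ^ (n - 2) * (cut_weight r j i * cut_weight r (k - j) (n - i))"
          by (simp add: cut_gf_def)
      qed
      finally show ?thesis by (simp add: sum_distrib_left)
    qed
    consider "n = 0" | "n = 1" | "n \<ge> 2" by linarith
    then show "real n * cut_gf k $ n - cut_gf k $ n - (if n = 0 then 0 else ?p * (real (n - 1) * cut_gf k $ (n - 1))) +
         (if n = 0 then 0 else (1 - ?p) * cut_gf k $ (n - 1)) = ?p * (1 / 2 * (real n * ?Q $ n))"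
    proof cases
      case 2
      then show ?thesis unfolding Q by simp
    next
      case 3
      define S where "S = (\<Sum>j\<in>{1..<k}. \<Sum>i\<in>{1..<n}. cut_weight r j i * cut_weight r (k - j) (n - i))"
      define a where "a = cut_weight r k (n - 1)"
      define P where "P = ?p ^ (n - 2)"
      have pn: "?p ^ (n - 1) = ?p * P" using 3 unfolding P_def by (metis Suc_1 Suc_diff_le diff_Suc_Suc power_Suc)
      define N where "N = real n - 1"
      have N: "N > 0" "real n = N + 1" "real (n - 1) = N" using 3 by (simp_all add: N_def of_nat_diff)
      have "cut_weight r k n = (1 - r / N) * a + (N + 1) / N / 2 * S"
        using cut_weight_rec[OF 3] unfolding a_def S_def N_def by simp
      then have Hn: "cut_gf k $ n = ?p * P * ((1 - r / N) * a + (N + 1) / N / 2 * S)" using pn by (simp add: cut_gf_def)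
      have Hn1: "cut_gf k $ (n - 1) = P * a" by (simp add: cut_gf_def P_def a_def numeral_2_eq_2)
      have q: "1 - ?p = ?p * r" using r by (simp add: field_simps)
      have A: "N * ((1 - r / N) * a + (N + 1) / N / 2 * S) = (N - r) * a + (N + 1) / 2 * S" using N by (simp add: field_simps)
      have "real n * cut_gf k $ n - cut_gf k $ n = N * cut_gf k $ n"
        unfolding N(2) by (simp add: algebra_simps)
      also have "\<dots> = ?p * P * (N * ((1 - r / N) * a + (N + 1) / N / 2 * S))"
        unfolding Hn by (simp only: mult_ac)
      also have "\<dots> = ?p * P * ((N - r) * a + (N + 1) / 2 * S)" by (simp only: A)
      finally have F: "real n * cut_gf k $ n - cut_gf k $ n = ?p * P * ((N - r) * a + (N + 1) / 2 * S)" .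
      have "A - p * (N * (P * a)) + p * r * (P * a) = p * (1 / 2 * ((N + 1) * (P * S)))"
        if "A = p * P * ((N - r) * a + (N + 1) / 2 * S)" for A p :: real
        unfolding that by (simp add: algebra_simps)
      from this[OF F] show ?thesis using 3 unfolding Hn1 q Q N S_def[symmetric] P_def[symmetric]
        by simp
    qed simp
  qed
qed

text \<open>As \<open>T\<close> has no constant term, the difference \<open>d\<close> of two
  solutions satisfies \<open>(1 + r) * (n - 1) * d $ n\<close> = a combination of lower
  coefficients. The left factor vanishes only at \<open>n = 1\<close>, which is why that coefficient
  must be prescribed.\<close>

lemma ode_unique:
  fixes z w Q :: "real fps"
  assumes "fps_const (1 + r) * (fps_X * fps_deriv z - z) = fps_X * fps_deriv (tree_gf 0 * z) + Q"
    "fps_const (1 + r) * (fps_X * fps_deriv w - w) = fps_X * fps_deriv (tree_gf 0 * w) + Q"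
    "z $ 1 = w $ 1"
  shows "z = w"
proof -
  define d where "d = z - w"
  have d: "fps_const (1 + r) * (fps_X * fps_deriv d - d) = fps_X * fps_deriv (tree_gf 0 * d)"
    using assms(1,2) unfolding d_def by (simp add: algebra_simps)
  have X: "(fps_X * fps_deriv f) $ n = real n * f $ n" for f :: "real fps" and n by (cases n) auto
  have c: "(1 + r) * (real n - 1) * d $ n = real n * (\<Sum>i=0..n. tree_gf 0 $ i * d $ (n - i))" for n
  proof -
    have "(1 + r) * (real n * d $ n - d $ n) = real n * (tree_gf 0 * d) $ n"
      using arg_cong[OF d, of "\<lambda>f. f $ n"] unfolding fps_mult_left_const_nth fps_sub_nth X .
    moreover have "(1 + r) * (real n - 1) * d $ n = (1 + r) * (real n * d $ n - d $ n)"
      by (simp add: algebra_simps)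
    ultimately show ?thesis by (simp only: fps_mult_nth)
  qed
  have "d $ n = 0" for n
  proof (induct n rule: less_induct)
    case (less n)
    show ?case
    proof (cases "n = 1")
      case True
      then show ?thesis using assms(3) by (simp add: d_def)
    next
      case False
      have "(\<Sum>i=0..n. tree_gf 0 $ i * d $ (n - i)) = 0"
      proof (rule sum.neutral, rule ballI)
        fix i assume "i \<in> {0..n}"
        then show "tree_gf 0 $ i * d $ (n - i) = 0" using less by (cases "i = 0") auto
      qed
      then have "(1 + r) * (real n - 1) * d $ n = 0" using c[of n] by simp
      moreover have "(1 + r) * (real n - 1) \<noteq> 0" using False r by auto
      ultimately show ?thesis by simp
    qed
  qed
  then have "d = 0" by (intro fps_ext) simp
  then show ?thesis by (simp add: d_def)
qed

text \<open>The change of variable as plain ring algebra, with \<open>D\<close> for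
  \<open>X * T'\<close>, \<open>P\<close> for \<open>1 / (1 + r)\<close>, \<open>R\<close> for
  \<open>1 + r\<close>, and \<open>h1\<close>, \<open>g\<close> for derivatives composed with
  \<open>T\<close>. The identity is shown after multiplication by \<open>1 - T\<close>, which can be
  cancelled in a domain.\<close>

lemma ode_compose_algebra:
  fixes D T h h1 g P R C :: "'a::idom"
  assumes "D * (1 - T) = T" "P * R = 1" "T \<noteq> 1"
    "T * h1 - h - P * (T * (T * h1)) + (1 - P) * (T * h) = P * (C * (T * g))"
  shows "R * (D * h1 - h) = D * h + T * (D * h1) + C * (D * g)"
proof -
  have "R * P * (C * (T * g)) = R * (T * h1 - h - P * (T * (T * h1)) + (1 - P) * (T * h))"
    using assms(4) by (simp only: mult.assoc)
  also have "\<dots> = R * (T * h1) - R * h + R * (T * h) - (P * R) * (T * (T * h1)) - (P * R) * (T * h)"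
    by (simp add: algebra_simps)
  finally have 1: "C * (T * g) = R * (T * h1) - R * h + R * (T * h) - T * (T * h1) - T * h"
    using assms(2) by (simp add: mult.commute)
  have "(1 - T) * (R * (D * h1 - h)) = R * ((D * (1 - T)) * h1) - R * h + R * (T * h)"
    by (simp add: algebra_simps)
  also have "\<dots> = R * (T * h1) - R * h + R * (T * h)" by (simp only: assms(1))
  also have "\<dots> = T * h + T * (T * h1) + C * (T * g)" using 1 by (simp add: algebra_simps)
  also have "\<dots> = (D * (1 - T)) * h + T * ((D * (1 - T)) * h1) + C * ((D * (1 - T)) * g)"
    by (simp only: assms(1))
  also have "\<dots> = (1 - T) * (D * h + T * (D * h1) + C * (D * g))"
    by (simp add: algebra_simps)
  finally show ?thesis using assms(3) by simp
qed

text \<open>Induction on \<open>k\<close>: the terms \<open>j = 0\<close> and \<open>j = k\<close>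
  of the convolution form the linear part of the equation, and the others involve smaller indices
  only. Both sides then solve the same linear equation with the same coefficient at 1.\<close>

lemma tree_gf_eq_compose:
  assumes "k \<ge> 1"
  shows "tree_gf k = cut_gf k oo tree_gf 0"
  using assms
proof (induct k rule: less_induct)
  case (less k)
  let ?T = "tree_gf 0"
  let ?QH = "\<Sum>j\<in>{1..<k}. cut_gf j * cut_gf (k - j)"
  let ?Q = "\<Sum>j\<in>{1..<k}. tree_gf j * tree_gf (k - j)"
  have T0: "?T $ 0 = 0" by simp
  have QQ: "?QH oo ?T = ?Q"
    unfolding fps_compose_sum_distrib
  proof (rule sum.cong[OF refl])
    fix j assume j: "j \<in> {1..<k}"
    then have 1: "tree_gf j = cut_gf j oo ?T" by (intro less.hyps) auto
    have 2: "tree_gf (k - j) = cut_gf (k - j) oo ?T" using j by (intro less.hyps) auto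
    show "(cut_gf j * cut_gf (k - j)) oo ?T = tree_gf j * tree_gf (k - j)"
      by (simp only: 1 2 fps_compose_mult_distrib[OF T0])
  qed
  have half: "fps_const (1 / 2 :: real) * 2 = 1"
    by (simp add: numeral_fps_const fps_const_1_eq_1)
  have two: "fps_const (2 * (1 + r)) = 2 * fps_const (1 + r)"
    by (simp add: numeral_fps_const)
  have split: "(\<Sum>j\<le>k. tree_gf j * tree_gf (k - j)) = 2 * (?T * tree_gf k) + ?Q"
  proof -
    have "{..k} = insert 0 (insert k {1..<k})" using less.prems by auto
    then show ?thesis using less.prems by simp
  qed
  have "fps_const (2 * (1 + r)) * (fps_X * fps_deriv (tree_gf k) - tree_gf k) = fps_X * fps_deriv (2 * (?T * tree_gf k) + ?Q)"
    using tree_gf_ode[of k] less.prems unfolding split by simp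
  then have "fps_const (1 / 2) * (2 * (fps_const (1 + r) * (fps_X * fps_deriv (tree_gf k) - tree_gf k))) =
      fps_const (1 / 2) * (2 * (fps_X * fps_deriv (?T * tree_gf k)) + fps_X * fps_deriv ?Q)"
    unfolding two by (simp add: algebra_simps)
  then have "(fps_const (1 / 2) * 2) * (fps_const (1 + r) * (fps_X * fps_deriv (tree_gf k) - tree_gf k)) =
      (fps_const (1 / 2) * 2) * (fps_X * fps_deriv (?T * tree_gf k)) + fps_const (1 / 2) * (fps_X * fps_deriv ?Q)"
    by (simp only: distrib_left mult.assoc)
  then have 1: "fps_const (1 + r) * (fps_X * fps_deriv (tree_gf k) - tree_gf k) =
      fps_X * fps_deriv (?T * tree_gf k) + fps_const (1 / 2) * (fps_X * fps_deriv ?Q)"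
    by (simp only: half mult_1)
  define h where "h = cut_gf k oo ?T"
  define h1 where "h1 = fps_deriv (cut_gf k) oo ?T"
  define g where "g = fps_deriv ?QH oo ?T"
  have dh: "fps_deriv h = h1 * fps_deriv ?T" unfolding h_def h1_def by (rule fps_compose_deriv[OF T0])
  have dQ: "fps_deriv ?Q = g * fps_deriv ?T"
    unfolding g_def QQ[symmetric] by (rule fps_compose_deriv[OF T0])
  have "?T * h1 - h - fps_const (1 / (1 + r)) * (?T * (?T * h1)) + (1 - fps_const (1 / (1 + r))) * (?T * h) =
     fps_const (1 / (1 + r)) * (fps_const (1 / 2) * (?T * g))"
    using arg_cong[OF cut_gf_ode[of k], of "\<lambda>f. f oo ?T"]
    unfolding h_def h1_def g_def
    by (simp add: fps_compose_add_distrib fps_compose_sub_distrib fps_compose_mult_distrib[OF T0])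
  moreover have "fps_const (1 / (1 + r)) * fps_const (1 + r) = 1"
    using r by (simp add: fps_const_1_eq_1)
  moreover have "?T \<noteq> 1" using T0 by (metis fps_one_nth zero_neq_one)
  ultimately have "fps_const (1 + r) * (fps_X * fps_deriv ?T * h1 - h) =
      fps_X * fps_deriv ?T * h + ?T * (fps_X * fps_deriv ?T * h1) + fps_const (1 / 2) * (fps_X * fps_deriv ?T * g)"
    by (intro ode_compose_algebra[OF tree_ode])
  then have 2: "fps_const (1 + r) * (fps_X * fps_deriv h - h) =
      fps_X * fps_deriv (?T * h) + fps_const (1 / 2) * (fps_X * fps_deriv ?Q)"
    unfolding dQ fps_deriv_mult dh by (simp add: algebra_simps)
  have "h $ 1 = tree_gf k $ 1"
    using less.prems unfolding h_def
    by (simp add: fps_compose_nth cut_gf_def cut_weight_1 tree_gf_nth_1 binomial_eq_0)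
  then show ?case unfolding h_def[symmetric] using ode_unique[OF 1 2] by simp
qed

text \<open>Takes the place of Lagrange inversion. By \<open>tree_ode\<close>,
  \<open>X * (T ^ m)' * (1 - T) = m * T ^ m\<close>, while \<open>(m + 1) * T * (T ^ m)'\<close>
  equals \<open>m * (T ^ (m + 1))'\<close>; eliminating the product with \<open>T\<close> and
  comparing coefficients links consecutive powers.\<close>

lemma tree_power_nth_rec:
  "real (m + 1) * (real n - real m) * (tree_gf 0 ^ m) $ n = real m * real n * (tree_gf 0 ^ (m + 1)) $ n"
proof -
  let ?T = "tree_gf 0"
  have X: "(fps_X * fps_deriv f) $ n = real n * f $ n" for f :: "real fps" and n by (cases n) auto
  have "fps_X * fps_deriv (?T ^ m) * (1 - ?T) = fps_const (real m) * ?T ^ m"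
  proof (cases m)
    case (Suc l)
    have "fps_X * fps_deriv (?T ^ m) * (1 - ?T) = fps_const (real m) * ?T ^ l * (fps_X * fps_deriv ?T * (1 - ?T))"
      unfolding fps_deriv_power Suc by (simp add: mult_ac)
    then show ?thesis unfolding tree_ode Suc by (simp add: mult_ac)
  qed simp
  moreover have "fps_const (real (m + 1)) * (fps_X * fps_deriv (?T ^ m) * ?T) =
      fps_const (real m) * (fps_X * fps_deriv (?T ^ (m + 1)))"
    unfolding fps_deriv_power by (cases m) (simp_all add: mult_ac)
  moreover have "fps_const (real (m + 1)) * (fps_X * fps_deriv (?T ^ m)) =
     fps_const (real (m + 1)) * (fps_X * fps_deriv (?T ^ m) * ?T) +
     fps_const (real (m + 1)) * (fps_X * fps_deriv (?T ^ m) * (1 - ?T))"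
    by (simp add: right_diff_distrib)
  ultimately have "fps_const (real (m + 1)) * (fps_X * fps_deriv (?T ^ m)) =
     fps_const (real m) * (fps_X * fps_deriv (?T ^ (m + 1))) + fps_const (real (m + 1)) * (fps_const (real m) * ?T ^ m)"
    by (simp only:)
  from arg_cong[OF this, of "\<lambda>f. f $ n"]
  have "real (m + 1) * (real n * (?T ^ m) $ n) = real m * (real n * (?T ^ (m + 1)) $ n) + real (m + 1) * (real m * (?T ^ m) $ n)"
    unfolding fps_add_nth fps_mult_left_const_nth X .
  then show ?thesis by (simp add: algebra_simps)
qed

lemma tree_power_nth:
  assumes "n \<ge> 1" "m \<ge> 1"
  shows "(tree_gf 0 ^ m) $ n = spine_weight n m * tree_gf 0 $ n"
  using assms(2)
proof (induct m rule: dec_induct)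
  case base
  show ?case by (simp add: spine_weight_def)
next
  case (step m)
  have "real m * real n * (tree_gf 0 ^ Suc m) $ n = real (Suc m) * (real n - real m) * (spine_weight n m * tree_gf 0 $ n)"
    using tree_power_nth_rec[of m n] step by simp
  also have "\<dots> = real m * real n * (spine_weight n (Suc m) * tree_gf 0 $ n)"
    using assms(1) step by (simp add: spine_weight_def field_simps)
  finally show ?case using step assms by simp
qed

lemma tree_moment_formula:
  assumes "n \<ge> 1" "k \<ge> 1"
  shows "B k n = B 0 n * (\<Sum>m=1..n. (1 / (1 + r)) ^ (m - 1) * cut_weight r k m * spine_weight n m)"
proof -
  have "tree_gf k $ n = (\<Sum>m=0..n. cut_gf k $ m * (tree_gf 0 ^ m) $ n)"
    unfolding tree_gf_eq_compose[OF assms(2)] by (simp add: fps_compose_nth)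
  also have "\<dots> = (\<Sum>m=1..n. cut_gf k $ m * (tree_gf 0 ^ m) $ n)"
    by (rule sum.mono_neutral_right) (auto simp: not_le)
  also have "\<dots> = (\<Sum>m=1..n. cut_gf k $ m * (spine_weight n m * tree_gf 0 $ n))"
    using tree_power_nth[OF assms(1)] by (intro sum.cong refl) simp
  also have "\<dots> = tree_gf 0 $ n * (\<Sum>m=1..n. (1 / (1 + r)) ^ (m - 1) * cut_weight r k m * spine_weight n m)"
    by (simp add: cut_gf_def sum_distrib_left mult_ac)
  finally show ?thesis using assms(1) by (simp add: tree_gf_def field_simps)
qed

end

subsection \<open>Bounds for the weights\<close>

unbundle no fps_syntax
unbundle vec_syntax

text \<open>For \<open>r \<le> 1\<close> the factor \<open>1 - r / (m - 1)\<close> lies between 0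
  and 1 for all \<open>m \<ge> 2\<close>, and the other coefficients of the recursion are
  nonnegative and free of \<open>r\<close>; so the comparison passes through the recursion term by
  term.\<close>

lemma cut_weight_bounds:
  assumes "0 \<le> r" "r \<le> 1"
  shows "0 \<le> cut_weight r k m \<and> cut_weight r k m \<le> cut_weight 0 k m"
proof (induct "k + m" arbitrary: k m rule: less_induct)
  case less
  consider "m = 0" | "m = 1" | "m \<ge> 2" by linarith
  then show ?case
  proof cases
    case 3
    have 1: "0 \<le> cut_weight r k (m - 1)" "cut_weight r k (m - 1) \<le> cut_weight 0 k (m - 1)"
      using less[of k "m - 1"] 3 by auto
    have 2: "0 \<le> cut_weight r j i * cut_weight r (k - j) (m - i)"
      "cut_weight r j i * cut_weight r (k - j) (m - i) \<le> cut_weight 0 j i * cut_weight 0 (k - j) (m - i)"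
      if "j \<in> {1..<k}" "i \<in> {1..<m}" for j i
    proof -
      have "0 \<le> cut_weight r j i \<and> cut_weight r j i \<le> cut_weight 0 j i"
        "0 \<le> cut_weight r (k - j) (m - i) \<and> cut_weight r (k - j) (m - i) \<le> cut_weight 0 (k - j) (m - i)"
        using that by (auto intro!: less)
      then show "0 \<le> cut_weight r j i * cut_weight r (k - j) (m - i)"
        "cut_weight r j i * cut_weight r (k - j) (m - i) \<le> cut_weight 0 j i * cut_weight 0 (k - j) (m - i)"
        by (auto intro!: mult_mono)
    qed
    have 3: "real m - 1 \<ge> 1" using 3 by simp
    have 4: "0 \<le> 1 - r / (real m - 1)" "1 - r / (real m - 1) \<le> 1"
      using 3 assms by (auto simp: field_simps)
    have m: "m \<ge> 2" using 3 by simp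
    show ?thesis
      unfolding cut_weight_rec[OF m, of r] cut_weight_rec[OF m, of 0]
    proof (intro conjI add_mono add_nonneg_nonneg)
      have "(1 - r / (real m - 1)) * cut_weight r k (m - 1) \<le> 1 * cut_weight 0 k (m - 1)"
        using 4 1 by (intro mult_mono) auto
      then show "(1 - r / (real m - 1)) * cut_weight r k (m - 1) \<le> (1 - 0 / (real m - 1)) * cut_weight 0 k (m - 1)"
        by simp
      show "real m / (real m - 1) / 2 * (\<Sum>j = 1..<k. \<Sum>i = 1..<m. cut_weight r j i * cut_weight r (k - j) (m - i))
        \<le> real m / (real m - 1) / 2 * (\<Sum>j = 1..<k. \<Sum>i = 1..<m. cut_weight 0 j i * cut_weight 0 (k - j) (m - i))"
        using 2 3 by (intro mult_left_mono sum_mono) auto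
      show "0 \<le> real m / (real m - 1) / 2 * (\<Sum>j = 1..<k. \<Sum>i = 1..<m. cut_weight r j i * cut_weight r (k - j) (m - i))"
      proof -
        have "0 \<le> (\<Sum>j = 1..<k. \<Sum>i = 1..<m. cut_weight r j i * cut_weight r (k - j) (m - i))"
          by (intro sum_nonneg 2(1))
        then show ?thesis using 3 by simp
      qed
    qed (use 1 4 in auto)
  qed (auto simp: cut_weight_1)
qed

text \<open>The total loss when the factor \<open>1 - r / (m - 1)\<close> of the linear term is
  applied for all \<open>m\<close> from 2 to \<open>n\<close>.\<close>

definition cut_decay :: "real \<Rightarrow> nat \<Rightarrow> real" where
  "cut_decay r n = (\<Prod>i\<in>{1..<n}. 1 - r / real i)"

lemma cut_decay_range:
  assumes "0 \<le> r" "r \<le> 1"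
  shows "0 \<le> cut_decay r n" "cut_decay r n \<le> 1"
  unfolding cut_decay_def using assms
  by (auto intro!: prod_nonneg prod_le_1 simp: field_simps)

lemma cut_decay_antimono:
  assumes "0 \<le> r" "r \<le> 1" "m \<le> n"
  shows "cut_decay r n \<le> cut_decay r m"
  using assms(3)
proof (induct n rule: dec_induct)
  case (step n)
  have "cut_decay r (Suc n) \<le> cut_decay r n"
  proof (cases "n = 0")
    case False
    have "{1..<Suc n} = insert n {1..<n}" using False by auto
    then have "cut_decay r (Suc n) = (1 - r / real n) * cut_decay r n" by (simp add: cut_decay_def)
    also have "\<dots> \<le> 1 * cut_decay r n"
      using assms cut_decay_range[OF assms(1,2), of n] by (intro mult_right_mono) auto
    finally show ?thesis by simp
  qed (simp add: cut_decay_def)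
  then show ?case using step by simp
qed simp

text \<open>The linear term costs exactly the factor by which \<open>cut_decay r m\<close> differs
  from \<open>cut_decay r (m - 1)\<close>. In a product term the parts bring
  \<open>cut_decay r i * cut_decay r (m - i)\<close>, which is at least
  \<open>cut_decay r m * cut_decay r n\<close>: one extra factor per splitting, and
  \<open>Suc k\<close> can be split \<open>k\<close> times.\<close>

lemma cut_weight_lower_aux:
  assumes r: "0 \<le> r" "r \<le> 1" and m: "m \<le> n"
  shows "cut_decay r m * cut_decay r n ^ k * cut_weight 0 (Suc k) m \<le> cut_weight r (Suc k) m"
  using m
proof (induct "k + m" arbitrary: k m rule: less_induct)
  case less
  note nn = cut_weight_bounds[OF r, THEN conjunct1] cut_weight_bounds[of 0, simplified]
  note d = cut_decay_range[OF r]
  consider "m = 0" | "m = 1" | "m \<ge> 2" by linarith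
  then show ?case
  proof cases
    case 2
    then show ?thesis by (cases k) (auto simp: cut_weight_1 cut_decay_def)
  next
    case 3
    let ?L = "cut_decay r n"
    have m1: "real m - 1 \<ge> 1" using 3 by simp
    have dm: "cut_decay r m = (1 - r / (real m - 1)) * cut_decay r (m - 1)"
    proof -
      have "{1..<m} = insert (m - 1) {1..<m - 1}" using 3 by auto
      then show ?thesis using 3 by (simp add: cut_decay_def of_nat_diff)
    qed
    have 1: "cut_decay r (m - 1) * ?L ^ k * cut_weight 0 (Suc k) (m - 1) \<le> cut_weight r (Suc k) (m - 1)"
      using less.prems 3 by (intro less.hyps) auto
    have A: "cut_decay r m * ?L ^ k * cut_weight 0 (Suc k) (m - 1) \<le>
        (1 - r / (real m - 1)) * cut_weight r (Suc k) (m - 1)"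
    proof -
      have "0 \<le> 1 - r / (real m - 1)" using r m1 by (simp add: field_simps)
      from mult_left_mono[OF 1 this] show ?thesis unfolding dm by (simp add: mult_ac)
    qed
    have B: "cut_decay r m * ?L ^ k * (cut_weight 0 j i * cut_weight 0 (Suc k - j) (m - i)) \<le>
        cut_weight r j i * cut_weight r (Suc k - j) (m - i)"
      if ji: "j \<in> {1..<Suc k}" "i \<in> {1..<m}" for j i
    proof -
      obtain j' where j': "j = Suc j'" using ji by (cases j) auto
      define l where "l = k - j"
      have k: "Suc k - j = Suc l" "k = Suc (j' + l)" using ji j' by (auto simp: l_def)
      have "cut_decay r i * ?L ^ j' * cut_weight 0 (Suc j') i \<le> cut_weight r (Suc j') i"
        by (rule less.hyps) (use ji less.prems k in auto)
      moreover have "cut_decay r (m - i) * ?L ^ l * cut_weight 0 (Suc l) (m - i) \<le> cut_weight r (Suc l) (m - i)"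
        by (rule less.hyps) (use ji less.prems k in auto)
      ultimately have *: "(cut_decay r i * ?L ^ j' * cut_weight 0 (Suc j') i) *
         (cut_decay r (m - i) * ?L ^ l * cut_weight 0 (Suc l) (m - i)) \<le>
          cut_weight r (Suc j') i * cut_weight r (Suc l) (m - i)"
        using d nn by (intro mult_mono mult_nonneg_nonneg) auto
      have "cut_decay r m * ?L \<le> cut_decay r i * cut_decay r (m - i)"
        using ji less.prems d by (intro mult_mono cut_decay_antimono r) auto
      then have "(cut_decay r m * ?L) * (?L ^ (j' + l) * (cut_weight 0 (Suc j') i * cut_weight 0 (Suc l) (m - i))) \<le>
        (cut_decay r i * cut_decay r (m - i)) * (?L ^ (j' + l) * (cut_weight 0 (Suc j') i * cut_weight 0 (Suc l) (m - i)))"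
        using d nn by (intro mult_right_mono mult_nonneg_nonneg) auto
      also have "\<dots> = (cut_decay r i * ?L ^ j' * cut_weight 0 (Suc j') i) *
         (cut_decay r (m - i) * ?L ^ l * cut_weight 0 (Suc l) (m - i))"
        by (simp add: power_add mult_ac)
      also note *
      finally show ?thesis unfolding k(1) j' unfolding k(2) by (simp add: mult_ac)
    qed
    let ?c = "real m / (real m - 1) / 2"
    have "cut_decay r m * ?L ^ k * cut_weight 0 (Suc k) m =
       cut_decay r m * ?L ^ k * cut_weight 0 (Suc k) (m - 1) +
       ?c * (\<Sum>j\<in>{1..<Suc k}. \<Sum>i\<in>{1..<m}. cut_decay r m * ?L ^ k * (cut_weight 0 j i * cut_weight 0 (Suc k - j) (m - i)))"
      unfolding cut_weight_rec[OF 3, of 0] sum_distrib_left[symmetric] by (simp add: algebra_simps)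
    also have "\<dots> \<le> (1 - r / (real m - 1)) * cut_weight r (Suc k) (m - 1) +
       ?c * (\<Sum>j\<in>{1..<Suc k}. \<Sum>i\<in>{1..<m}. cut_weight r j i * cut_weight r (Suc k - j) (m - i))"
      using A B m1 by (intro add_mono mult_left_mono sum_mono) auto
    finally show ?thesis unfolding cut_weight_rec[OF 3, of r] .
  qed simp
qed

lemma cut_weight_lower:
  assumes "0 \<le> r" "r \<le> 1" "m \<le> n"
  shows "cut_decay r n ^ Suc k * cut_weight 0 (Suc k) m \<le> cut_weight r (Suc k) m"
proof -
  have "cut_decay r n ^ Suc k * cut_weight 0 (Suc k) m \<le> cut_decay r m * cut_decay r n ^ k * cut_weight 0 (Suc k) m"
    using cut_decay_range[OF assms(1,2)] cut_decay_antimono[OF assms] cut_weight_bounds[of 0, simplified]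
    by (intro mult_right_mono) (auto intro!: mult_right_mono)
  also note cut_weight_lower_aux[OF assms]
  finally show ?thesis .
qed

section \<open>Polynomial lower bound for the weights at rate 0\<close>

lemma sum_choose_convolution:
  "(\<Sum>i\<le>N. (i choose a) * ((N - i) choose b)) = Suc N choose Suc (a + b)"
proof (induct N arbitrary: b)
  case 0
  then show ?case by (cases "a + b") auto
next
  case (Suc N)
  show ?case
  proof (cases b)
    case 0
    then show ?thesis using sum_choose_upper[of a "Suc N"] by simp
  next
    case (Suc b')
    have "(\<Sum>i\<le>Suc N. (i choose a) * ((Suc N - i) choose b)) =
       (\<Sum>i\<le>N. (i choose a) * ((N - i) choose b') + (i choose a) * ((N - i) choose b))"
      unfolding Suc by (simp add: Suc_diff_le distrib_left)
    also have "\<dots> = (Suc N choose Suc (a + b')) + (Suc N choose Suc (a + b))"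
      by (simp only: sum.distrib Suc.hyps)
    also have "\<dots> = Suc (Suc N) choose Suc (a + b)" unfolding Suc by simp
    finally show ?thesis .
  qed
qed

text \<open>
  The coefficients of \<open>1 - sqrt (1 - 2 * w)\<close>, that is, rescaled Catalan numbers; in this form
  their convolution identity is an instance of Vandermonde's.
\<close>

definition catalan_coeff :: "nat \<Rightarrow> real" where
  "catalan_coeff k = - ((- 2) ^ k) * ((1 / 2) gchoose k)"

lemma catalan_coeff_1 [simp]: "catalan_coeff (Suc 0) = 1"
  by (simp add: catalan_coeff_def)

lemma catalan_coeff_Suc: "catalan_coeff (Suc k) * real (Suc k) = catalan_coeff k * (2 * real k - 1)"
proof -
  have "(1 / 2 :: real) * ((1 / 2) gchoose k) = real k * ((1 / 2) gchoose k) + real (Suc k) * ((1 / 2) gchoose Suc k)"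
    by (rule gbinomial_mult_1)
  then have "real (Suc k) * ((1 / 2 :: real) gchoose Suc k) = (1 / 2 - real k) * ((1 / 2) gchoose k)"
    by (simp add: algebra_simps)
  moreover have "catalan_coeff (Suc k) * real (Suc k) = 2 * (- 2) ^ k * (real (Suc k) * ((1 / 2 :: real) gchoose Suc k))"
    by (simp add: catalan_coeff_def mult_ac)
  ultimately have "catalan_coeff (Suc k) * real (Suc k) = 2 * (- 2) ^ k * ((1 / 2 - real k) * ((1 / 2) gchoose k))"
    by (simp only:)
  then show ?thesis by (simp add: catalan_coeff_def algebra_simps)
qed

text \<open>The constant that remains after passing to the limit: it is precisely the one that gives
  \<open>spine_density q\<close> total mass 1, so nothing is lost by bounding the weights from
  below.\<close>

lemma catalan_coeff_closed: "catalan_coeff (Suc q) * fact (Suc q) / fact (2 * q) = 1 / (2 ^ q * fact q)"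
proof (induct q)
  case (Suc q)
  have "catalan_coeff (Suc (Suc q)) * fact (Suc (Suc q)) / fact (2 * Suc q) =
    (catalan_coeff (Suc (Suc q)) * real (Suc (Suc q))) * fact (Suc q) / fact (2 * Suc q)"
    by (simp only: fact_Suc of_nat_mult mult_ac of_nat_fact)
  also have "\<dots> = catalan_coeff (Suc q) * (2 * real q + 1) * fact (Suc q) / fact (2 * Suc q)"
    unfolding catalan_coeff_Suc by (simp add: algebra_simps)
  also have "\<dots> = catalan_coeff (Suc q) * (2 * real q + 1) * fact (Suc q) / ((2 * real q + 2) * (2 * real q + 1) * fact (2 * q))"
  proof -
    have "fact (2 * Suc q) = (2 * real q + 2) * (2 * real q + 1) * fact (2 * q)"
      by (simp add: algebra_simps)
    then show ?thesis by (simp only:)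
  qed
  also have "catalan_coeff (Suc q) * (2 * real q + 1) * fact (Suc q) / ((2 * real q + 2) * (2 * real q + 1) * fact (2 * q)) =
     catalan_coeff (Suc q) * fact (Suc q) / fact (2 * q) / (2 * real q + 2)"
  proof -
    have "2 * real q + 1 \<noteq> 0" by (metis add_nonneg_eq_0_iff mult_nonneg_nonneg of_nat_0_le_iff zero_le_numeral zero_le_one zero_neq_one)
    then show ?thesis by (simp add: divide_simps mult_ac)
  qed
  also have "\<dots> = 1 / (2 ^ Suc q * fact (Suc q))"
    unfolding Suc by (simp add: field_simps)
  finally show ?case .
qed simp

lemma catalan_coeff_pos: "catalan_coeff (Suc q) > 0"
proof -
  have "catalan_coeff (Suc q) * fact (Suc q) / fact (2 * q) > 0"
    unfolding catalan_coeff_closed by simp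
  then show ?thesis by (simp add: zero_less_mult_iff zero_less_divide_iff del: fact_Suc)
qed

lemma catalan_coeff_convolution:
  assumes "k \<ge> 2"
  shows "(\<Sum>j\<in>{1..<k}. catalan_coeff j * catalan_coeff (k - j)) = 2 * catalan_coeff k"
proof -
  let ?g = "\<lambda>j. (1 / 2 :: real) gchoose j"
  have "(\<Sum>j\<in>{0..k}. ?g j * ?g (k - j)) = (1 / 2 + 1 / 2) gchoose k"
    by (rule gbinomial_Vandermonde)
  also have "\<dots> = real (1 choose k)" using binomial_gbinomial[of 1 k, where 'a = real] by simp
  also have "\<dots> = 0" using assms by (simp add: binomial_eq_0)
  also have "{0..k} = insert 0 (insert k {1..<k})" using assms by auto
  finally have s: "(\<Sum>j\<in>{1..<k}. ?g j * ?g (k - j)) = - 2 * ?g k" using assms by simp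
  have "(\<Sum>j\<in>{1..<k}. catalan_coeff j * catalan_coeff (k - j)) = (\<Sum>j\<in>{1..<k}. (- 2) ^ k * (?g j * ?g (k - j)))"
  proof (rule sum.cong[OF refl])
    fix j assume "j \<in> {1..<k}"
    then have "(- 2 :: real) ^ k = (- 2) ^ j * (- 2) ^ (k - j)" by (simp flip: power_add)
    then show "catalan_coeff j * catalan_coeff (k - j) = (- 2) ^ k * (?g j * ?g (k - j))"
      by (simp add: catalan_coeff_def)
  qed
  also have "\<dots> = (- 2) ^ k * (- 2 * ?g k)" by (simp only: s flip: sum_distrib_left)
  finally show ?thesis by (simp add: catalan_coeff_def)
qed

text \<open>Replacing \<open>m / (m - 1)\<close> by 1, the increment of the weight in
  \<open>m\<close> is at least half a convolution over \<open>j\<close> and \<open>i\<close>. By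
  induction the sum over \<open>i\<close> turns the binomials for \<open>2 * j'\<close> and
  \<open>2 * l\<close> into one for \<open>2 * q - 1\<close>, the sum over \<open>j\<close> is the
  Catalan convolution, and Pascal's rule sums the increments.\<close>

lemma cut_weight_ge_choose:
  assumes "m \<ge> 1"
  shows "catalan_coeff (Suc q) * real ((m - 1) choose (2 * q)) \<le> cut_weight 0 (Suc q) m"
  using assms
proof (induct "q + m" arbitrary: q m rule: less_induct)
  case less
  note nn = cut_weight_bounds[of 0, simplified]
  show ?case
  proof (cases "m = 1")
    case True
    then show ?thesis by (cases q) (auto simp: cut_weight_1)
  next
    case False
    then have m: "m \<ge> 2" using less.prems by simp
    let ?S = "\<Sum>j\<in>{1..<Suc q}. \<Sum>i\<in>{1..<m}. cut_weight 0 j i * cut_weight 0 (Suc q - j) (m - i)"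
    have S0: "0 \<le> ?S" by (intro sum_nonneg mult_nonneg_nonneg nn)
    have "(1 / 2) * ?S \<le> (real m / (real m - 1) / 2) * ?S"
      using m S0 by (intro mult_right_mono) (auto simp: field_simps)
    then have 1: "cut_weight 0 (Suc q) (m - 1) + ?S / 2 \<le> cut_weight 0 (Suc q) m"
      unfolding cut_weight_rec[OF m, of 0 "Suc q"] div_0 diff_zero mult_1_left by linarith
    have 2: "catalan_coeff (Suc q) * real ((m - 2) choose (2 * q)) \<le> cut_weight 0 (Suc q) (m - 1)"
      using less.hyps[of q "m - 1"] m by (simp add: numeral_2_eq_2)
    show ?thesis
    proof (cases q)
      case 0
      then show ?thesis using 1 2 S0 by simp
    next
      case (Suc q')
      have "(\<Sum>j\<in>{1..<Suc q}. catalan_coeff j * catalan_coeff (Suc q - j) * real ((m - 1) choose (2 * q - 1))) \<le> ?S"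
      proof (rule sum_mono)
        fix j assume j: "j \<in> {1..<Suc q}"
        then obtain j' where j': "j = Suc j'" by (cases j) auto
        define l where "l = q - j"
        have l: "Suc q - j = Suc l" "2 * q - 1 = Suc (2 * j' + 2 * l)" using j j' by (auto simp: l_def)
        have "(\<Sum>i\<in>{1..<m}. ((i - 1) choose (2 * j')) * ((m - i - 1) choose (2 * l))) =
           (\<Sum>i\<le>m - 2. (i choose (2 * j')) * ((m - 2 - i) choose (2 * l)))"
          by (rule sum.reindex_bij_witness[of _ Suc "\<lambda>i. i - 1"]) (use m in auto)
        also have "\<dots> = Suc (m - 2) choose Suc (2 * j' + 2 * l)"
          by (rule sum_choose_convolution)
        also have "Suc (m - 2) = m - 1" using m by simp
        finally have c: "(m - 1) choose (2 * q - 1) = (\<Sum>i\<in>{1..<m}. ((i - 1) choose (2 * j')) * ((m - i - 1) choose (2 * l)))"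
          using l by simp
        have "catalan_coeff j * catalan_coeff (Suc q - j) * real ((m - 1) choose (2 * q - 1)) =
           (\<Sum>i\<in>{1..<m}. (catalan_coeff j * real ((i - 1) choose (2 * j'))) * (catalan_coeff (Suc q - j) * real ((m - i - 1) choose (2 * l))))"
          unfolding c by (simp add: sum_distrib_left mult_ac)
        also have "\<dots> \<le> (\<Sum>i\<in>{1..<m}. cut_weight 0 j i * cut_weight 0 (Suc q - j) (m - i))"
        proof (intro sum_mono mult_mono)
          fix i assume i: "i \<in> {1..<m}"
          show "catalan_coeff j * real ((i - 1) choose (2 * j')) \<le> cut_weight 0 j i"
            unfolding j' using i j j' by (intro less.hyps) auto
          show "catalan_coeff (Suc q - j) * real ((m - i - 1) choose (2 * l)) \<le> cut_weight 0 (Suc q - j) (m - i)"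
            unfolding l using i j j' by (intro less.hyps) (auto simp: l_def)
          show "0 \<le> catalan_coeff (Suc q - j) * real ((m - i - 1) choose (2 * l))"
            unfolding l using catalan_coeff_pos[of l] by simp
        qed (rule nn)
        finally show "catalan_coeff j * catalan_coeff (Suc q - j) * real ((m - 1) choose (2 * q - 1)) \<le>
          (\<Sum>i\<in>{1..<m}. cut_weight 0 j i * cut_weight 0 (Suc q - j) (m - i))" .
      qed
      then have "(2 * catalan_coeff (Suc q)) * real ((m - 1) choose (2 * q - 1)) \<le> ?S"
        using catalan_coeff_convolution[of "Suc q"] Suc by (simp add: flip: sum_distrib_right)
      then have 3: "catalan_coeff (Suc q) * real ((m - 1) choose (2 * q - 1)) \<le> ?S / 2" by simp
      \<comment> \<open>Pascal's rule needs only \<open>(m - 2) choose (2 * q - 1)\<close>, while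
        the convolution delivers the larger \<open>(m - 1) choose (2 * q - 1)\<close>.\<close>
      have "((m - 1) choose (2 * q)) \<le> ((m - 2) choose (2 * q)) + ((m - 1) choose (2 * q - 1))"
      proof -
        have "Suc (m - 2) choose Suc (2 * q - 1) = ((m - 2) choose (2 * q - 1)) + ((m - 2) choose Suc (2 * q - 1))"
          by simp
        moreover have "(m - 2) choose (2 * q - 1) \<le> (m - 1) choose (2 * q - 1)"
          by (rule binomial_right_mono) simp
        moreover have "Suc (m - 2) = m - 1" "Suc (2 * q - 1) = 2 * q" using m Suc by auto
        ultimately show ?thesis by simp
      qed
      then have "catalan_coeff (Suc q) * real ((m - 1) choose (2 * q)) \<le>
        catalan_coeff (Suc q) * (real ((m - 2) choose (2 * q)) + real ((m - 1) choose (2 * q - 1)))"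
        using catalan_coeff_pos[of q] by (intro mult_left_mono) (auto simp flip: of_nat_add)
      also have "\<dots> \<le> cut_weight 0 (Suc q) (m - 1) + ?S / 2" using 2 3 by (simp add: distrib_left)
      finally show ?thesis using 1 by simp
    qed
  qed
qed

subsection \<open>Scaling limit of the weights\<close>

lemma choose_over_power_limit:
  "(\<lambda>m. real ((m - c) choose d) / real m ^ d) \<longlonglongrightarrow> 1 / fact d"
proof (induct d)
  case (Suc d)
  have "(\<lambda>m. real (m - c - d) / real m) \<longlonglongrightarrow> 1"
  proof (rule Lim_transform_eventually)
    show "(\<lambda>m. 1 - real (c + d) * inverse (real m)) \<longlonglongrightarrow> 1"
      using tendsto_diff[OF tendsto_const[of 1] tendsto_mult[OF tendsto_const lim_inverse_n, of "real (c + d)"]] by simp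
    show "\<forall>\<^sub>F m in sequentially. 1 - real (c + d) * inverse (real m) = real (m - c - d) / real m"
      using eventually_gt_at_top[of "c + d"]
      by eventually_elim (auto simp: field_simps of_nat_diff)
  qed
  then have "(\<lambda>m. real ((m - c) choose d) / real m ^ d * (real (m - c - d) / real m) / real (Suc d)) \<longlonglongrightarrow> 1 / fact d * 1 / real (Suc d)"
    by (intro tendsto_intros Suc) auto
  moreover have "real ((m - c) choose d) / real m ^ d * (real (m - c - d) / real m) / real (Suc d) =
      real ((m - c) choose Suc d) / real m ^ Suc d" for m
  proof -
    have "Suc d * ((m - c) choose Suc d) = (m - c - d) * ((m - c) choose d)"
      by (simp only: binomial_absorption binomial_absorb_comp)
    then have "real (Suc d) * real ((m - c) choose Suc d) = real (m - c - d) * real ((m - c) choose d)"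
      by (simp only: flip: of_nat_mult)
    then have e: "real ((m - c) choose d) * real (m - c - d) = real (Suc d) * real ((m - c) choose Suc d)"
      by (simp only: mult.commute)
    have "real ((m - c) choose d) / real m ^ d * (real (m - c - d) / real m) / real (Suc d) =
      (real ((m - c) choose d) * real (m - c - d)) / real m ^ Suc d / real (Suc d)"
      by (simp add: mult.commute)
    then show ?thesis unfolding e by (simp del: of_nat_Suc)
  qed
  ultimately show ?case by (simp add: mult_ac)
qed simp

text \<open>The index at position \<open>u\<close> on the scale \<open>sqrt n\<close>. Rounding up
  assigns to the index \<open>j \<ge> 1\<close> the cell from \<open>(j - 1) / sqrt n\<close>,
  excluded, to \<open>j / sqrt n\<close>, included.\<close>

definition grid :: "real \<Rightarrow> nat \<Rightarrow> nat" where
  "grid u n = nat \<lceil>u * sqrt (real n)\<rceil>"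

lemma grid_bounds:
  assumes "u > 0"
  shows "u * sqrt (real n) \<le> real (grid u n)" "real (grid u n) \<le> u * sqrt (real n) + 1"
  using assms by (auto simp: grid_def)

lemma inverse_sqrt_limit: "(\<lambda>n. 1 / sqrt (real n)) \<longlonglongrightarrow> 0"
proof -
  have "filterlim (\<lambda>n. sqrt (real n)) at_top sequentially"
    by (rule filterlim_compose[OF sqrt_at_top filterlim_real_sequentially])
  from tendsto_inverse_0_at_top[OF this] show ?thesis by (simp add: inverse_eq_divide)
qed

lemma grid_limit:
  assumes "u > 0"
  shows "(\<lambda>n. real (grid u n) / sqrt (real n)) \<longlonglongrightarrow> u"
proof (rule tendsto_sandwich)
  show "(\<lambda>n. u) \<longlonglongrightarrow> u" by simp
  show "(\<lambda>n. u + 1 / sqrt (real n)) \<longlonglongrightarrow> u"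
    using tendsto_add[OF tendsto_const[of u] inverse_sqrt_limit] by simp
  show "\<forall>\<^sub>F n in sequentially. u \<le> real (grid u n) / sqrt (real n)"
    using eventually_gt_at_top[of 0]
    by eventually_elim (use grid_bounds(1)[OF assms] in \<open>auto simp: field_simps\<close>)
  show "\<forall>\<^sub>F n in sequentially. real (grid u n) / sqrt (real n) \<le> u + 1 / sqrt (real n)"
    using eventually_gt_at_top[of 0]
    by eventually_elim (use grid_bounds(2)[OF assms] in \<open>auto simp: field_simps\<close>)
qed

lemma grid_pos: "u > 0 \<Longrightarrow> n > 0 \<Longrightarrow> grid u n \<ge> 1"
proof -
  assume "u > 0" "n > 0"
  then have "0 < u * sqrt (real n)" by simp
  then have "0 < real (grid u n)" using grid_bounds(1)[OF \<open>u > 0\<close>, of n] by linarith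
  then show ?thesis by simp
qed

lemma grid_at_top:
  assumes "u > 0"
  shows "filterlim (grid u) at_top sequentially"
proof -
  have "filterlim (\<lambda>n. sqrt (real n) * u) at_top sequentially"
    by (rule filterlim_at_top_mult_tendsto_pos[OF tendsto_const assms
          filterlim_compose[OF sqrt_at_top filterlim_real_sequentially]])
  then have "filterlim (\<lambda>n. real (grid u n)) at_top sequentially"
    by (rule filterlim_at_top_mono) (use grid_bounds(1)[OF assms] in \<open>auto simp: mult.commute\<close>)
  then show ?thesis by (simp only: filterlim_sequentially_iff_filterlim_real)
qed

lemma grid_over_n_limit:
  assumes "u > 0"
  shows "(\<lambda>n. real (grid u n) / real n) \<longlonglongrightarrow> 0"
proof -
  have "(\<lambda>n. real (grid u n) / sqrt (real n) * (1 / sqrt (real n))) \<longlonglongrightarrow> u * 0"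
    by (intro tendsto_mult grid_limit inverse_sqrt_limit assms)
  then show ?thesis by (simp add: real_sqrt_mult_self)
qed

text \<open>With \<open>m\<close> near \<open>u * sqrt n\<close>, the first-order exponents
  \<open>i / n\<close> sum to about \<open>m ^ 2 / (2 * n)\<close>, hence to
  \<open>u ^ 2 / 2\<close>. The logarithm is bounded above by its linear part and below with a
  quadratic correction, valid for arguments up to 1/2.\<close>

lemma spine_prod_limit:
  assumes u: "u > 0"
  shows "(\<lambda>n. \<Prod>i\<in>{1..<grid u n}. 1 - real i / real n) \<longlonglongrightarrow> exp (- (u\<^sup>2 / 2))"
proof -
  define s where "s n = (\<Sum>i\<in>{1..<grid u n}. real i / real n)" for n
  \<comment> \<open>Bound for the sum of the corrections \<open>2 * (i / n) ^ 2\<close>: the number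
    of terms times the largest possible term, \<open>m * 2 * (m / n) ^ 2\<close> with
    \<open>m = grid u n\<close>.\<close>
  define e where "e n = 2 * (real (grid u n) / sqrt (real n)) ^ 3 * (1 / sqrt (real n))" for n
  have gauss: "(\<Sum>i\<in>{1..<m}. real i) = real m * (real m - 1) / 2" for m
    by (induct m) (auto simp: field_simps sum.op_ivl_Suc)
  have s: "s n = ((real (grid u n) / sqrt (real n))\<^sup>2 - (real (grid u n) / sqrt (real n)) * (1 / sqrt (real n))) / 2" if "n > 0" for n
  proof -
    have "s n = real (grid u n) * (real (grid u n) - 1) / 2 / real n"
      unfolding s_def by (simp only: gauss flip: sum_divide_distrib)
    then show ?thesis using that by (simp add: power2_eq_square field_simps)
  qed
  have slim: "s \<longlonglongrightarrow> u\<^sup>2 / 2"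
  proof (rule Lim_transform_eventually)
    have "(\<lambda>n. ((real (grid u n) / sqrt (real n))\<^sup>2 - (real (grid u n) / sqrt (real n)) * (1 / sqrt (real n))) / 2) \<longlonglongrightarrow> (u\<^sup>2 - u * 0) / 2"
      by (intro tendsto_intros grid_limit[OF u] inverse_sqrt_limit) auto
    then show "(\<lambda>n. ((real (grid u n) / sqrt (real n))\<^sup>2 - (real (grid u n) / sqrt (real n)) * (1 / sqrt (real n))) / 2) \<longlonglongrightarrow> u\<^sup>2 / 2"
      by simp
    show "\<forall>\<^sub>F n in sequentially. ((real (grid u n) / sqrt (real n))\<^sup>2 - (real (grid u n) / sqrt (real n)) * (1 / sqrt (real n))) / 2 = s n"
      using eventually_gt_at_top[of 0] by eventually_elim (simp add: s)
  qed
  have elim: "e \<longlonglongrightarrow> 0"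
  proof -
    have "(\<lambda>n. 2 * (real (grid u n) / sqrt (real n)) ^ 3 * (1 / sqrt (real n))) \<longlonglongrightarrow> 2 * u ^ 3 * 0"
      by (intro tendsto_intros grid_limit[OF u] inverse_sqrt_limit)
    then show ?thesis by (simp add: e_def[abs_def])
  qed
  have ev: "\<forall>\<^sub>F n in sequentially. n > 0 \<and> real (grid u n) / real n < 1 / 2"
    by (intro eventually_conj eventually_gt_at_top order_tendstoD(2)[OF grid_over_n_limit[OF u]]) simp
  have small: "0 \<le> real i / real n" "real i / real n \<le> 1 / 2"
    if "n > 0 \<and> real (grid u n) / real n < 1 / 2" "i \<in> {1..<grid u n}" for i n
  proof -
    have "real i / real n \<le> real (grid u n) / real n" using that by (intro divide_right_mono) auto
    then show "real i / real n \<le> 1 / 2" using that(1) by linarith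
  qed simp
  show ?thesis
  proof (rule tendsto_sandwich)
    show "(\<lambda>n. exp (- s n - e n)) \<longlonglongrightarrow> exp (- (u\<^sup>2 / 2))"
      using tendsto_exp[OF tendsto_diff[OF tendsto_minus[OF slim] elim]] by simp
    show "(\<lambda>n. exp (- s n)) \<longlonglongrightarrow> exp (- (u\<^sup>2 / 2))"
      by (intro tendsto_exp tendsto_minus slim)
    show "\<forall>\<^sub>F n in sequentially. (\<Prod>i\<in>{1..<grid u n}. 1 - real i / real n) \<le> exp (- s n)"
      using ev
    proof eventually_elim
      case (elim n)
      have "(\<Prod>i\<in>{1..<grid u n}. 1 - real i / real n) \<le> (\<Prod>i\<in>{1..<grid u n}. exp (- (real i / real n)))"
      proof (rule prod_mono)
        fix i assume "i \<in> {1..<grid u n}"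
        with small[OF elim this] exp_ge_add_one_self[of "- (real i / real n)"]
        show "0 \<le> 1 - real i / real n \<and> 1 - real i / real n \<le> exp (- (real i / real n))"
          by (intro conjI) linarith+
      qed
      also have "\<dots> = exp (- s n)" by (simp add: exp_sum sum_negf s_def flip: exp_sum)
      finally show ?case .
    qed
    show "\<forall>\<^sub>F n in sequentially. exp (- s n - e n) \<le> (\<Prod>i\<in>{1..<grid u n}. 1 - real i / real n)"
      using ev
    proof eventually_elim
      case (elim n)
      have "(\<Sum>i\<in>{1..<grid u n}. 2 * (real i / real n)\<^sup>2) \<le> (\<Sum>i\<in>{1..<grid u n}. 2 * (real (grid u n) / real n)\<^sup>2)"
        by (intro sum_mono mult_left_mono power_mono divide_right_mono) auto
      also have "\<dots> = real (grid u n - 1) * (2 * (real (grid u n) / real n)\<^sup>2)" by simp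
      also have "\<dots> \<le> real (grid u n) * (2 * (real (grid u n) / real n)\<^sup>2)"
        by (intro mult_right_mono) auto
      also have "\<dots> = e n"
      proof -
        have "real n = sqrt (real n) * sqrt (real n)" by simp
        then show ?thesis unfolding e_def
          by (simp add: power2_eq_square power3_eq_cube mult_ac)
      qed
      finally have "exp (- s n - e n) \<le> exp (\<Sum>i\<in>{1..<grid u n}. - (real i / real n) - 2 * (real i / real n)\<^sup>2)"
        by (simp add: s_def sum_subtractf sum_negf)
      also have "\<dots> = (\<Prod>i\<in>{1..<grid u n}. exp (- (real i / real n) - 2 * (real i / real n)\<^sup>2))"
        by (simp add: exp_sum)
      also have "\<dots> \<le> (\<Prod>i\<in>{1..<grid u n}. 1 - real i / real n)"
      proof (rule prod_mono)
        fix i assume "i \<in> {1..<grid u n}"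
        note b = small[OF elim this]
        from ln_one_minus_pos_lower_bound[OF b] b
        have "exp (- (real i / real n) - 2 * (real i / real n)\<^sup>2) \<le> exp (ln (1 - real i / real n))" by simp
        then show "0 \<le> exp (- (real i / real n) - 2 * (real i / real n)\<^sup>2) \<and>
          exp (- (real i / real n) - 2 * (real i / real n)\<^sup>2) \<le> 1 - real i / real n" using b by simp
      qed
      finally show ?case .
    qed
  qed
qed

text \<open>Density of the chi law with \<open>2 * q + 2\<close> degrees of freedom, extended by 0
  so that integrals can run over the whole line.\<close>

definition spine_density :: "nat \<Rightarrow> real \<Rightarrow> real" where
  "spine_density q u = indicator {0<..} u * (u ^ (2 * q + 1) * exp (- (u\<^sup>2 / 2)) / (2 ^ q * fact q))"

lemma spine_density_measurable [measurable]: "spine_density q \<in> borel_measurable borel"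
  unfolding spine_density_def[abs_def] by measurable

lemma spine_density_nonneg: "0 \<le> spine_density q u"
  by (auto simp: spine_density_def indicator_def)

lemma has_integral_spine_density: "has_bochner_integral lborel (spine_density q) 1"
proof -
  have "has_bochner_integral lborel
     (\<lambda>u::real. indicator {0..} (0 + 1 / sqrt 2 * u) *\<^sub>R (exp (- (0 + 1 / sqrt 2 * u)\<^sup>2) * (0 + 1 / sqrt 2 * u) ^ (2 * q + 1)))
     ((fact q / 2) /\<^sub>R \<bar>1 / sqrt 2\<bar>)"
    using gaussian_moment_odd_pos[of q]
    by (subst lborel_has_bochner_integral_real_affine_iff[symmetric]) auto
  then have "has_bochner_integral lborel
     (\<lambda>u::real. (sqrt 2 / fact q) * (indicator {0..} (0 + 1 / sqrt 2 * u) *\<^sub>R (exp (- (0 + 1 / sqrt 2 * u)\<^sup>2) * (0 + 1 / sqrt 2 * u) ^ (2 * q + 1))))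
     ((sqrt 2 / fact q) * ((fact q / 2) /\<^sub>R \<bar>1 / sqrt 2\<bar>))"
    by (intro has_bochner_integral_mult_right) auto
  also have "(\<lambda>u::real. (sqrt 2 / fact q) * (indicator {0..} (0 + 1 / sqrt 2 * u) *\<^sub>R (exp (- (0 + 1 / sqrt 2 * u)\<^sup>2) * (0 + 1 / sqrt 2 * u) ^ (2 * q + 1)))) =
     spine_density q"
  proof
    fix u :: real
    have 1: "(1 / sqrt 2 * u)\<^sup>2 = u\<^sup>2 / 2" by (simp add: power_divide)
    have 2: "sqrt 2 * (1 / sqrt 2 * u) ^ (2 * q + 1) = u ^ (2 * q + 1) / 2 ^ q"
      by (simp add: power_mult power_divide)
    have "(sqrt 2 / fact q) * (exp (- (u\<^sup>2 / 2)) * (1 / sqrt 2 * u) ^ (2 * q + 1)) =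
       (sqrt 2 * (1 / sqrt 2 * u) ^ (2 * q + 1)) * exp (- (u\<^sup>2 / 2)) / fact q" by (simp add: mult_ac)
    also have "\<dots> = u ^ (2 * q + 1) * exp (- (u\<^sup>2 / 2)) / (2 ^ q * fact q)" unfolding 2 by (simp add: mult_ac)
    finally have 3: "(sqrt 2 / fact q) * (exp (- (u\<^sup>2 / 2)) * (1 / sqrt 2 * u) ^ (2 * q + 1)) =
       u ^ (2 * q + 1) * exp (- (u\<^sup>2 / 2)) / (2 ^ q * fact q)" .
    consider "u < 0" | "u = 0" | "u > 0" by linarith
    then show "(sqrt 2 / fact q) * (indicator {0..} (0 + 1 / sqrt 2 * u) *\<^sub>R (exp (- (0 + 1 / sqrt 2 * u)\<^sup>2) * (0 + 1 / sqrt 2 * u) ^ (2 * q + 1))) =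
     spine_density q u"
    proof cases
      case 3
      then have "indicator {0..} (1 / sqrt 2 * u) = (1::real)" "indicator {0<..} u = (1::real)" by auto
      then show ?thesis using \<open>(sqrt 2 / fact q) * (exp (- (u\<^sup>2 / 2)) * (1 / sqrt 2 * u) ^ (2 * q + 1)) =
       u ^ (2 * q + 1) * exp (- (u\<^sup>2 / 2)) / (2 ^ q * fact q)\<close>
        unfolding spine_density_def add_0 1 by simp
    qed (auto simp: spine_density_def indicator_def zero_le_divide_iff)
  qed
  also have "(sqrt 2 / fact q) * ((fact q / 2) /\<^sub>R \<bar>1 / sqrt 2\<bar>) = 1"
    by simp
  finally show ?thesis .
qed

text \<open>Counting powers of \<open>m = grid u n\<close>: the binomial gives
  \<open>m ^ (2 * q)\<close>, the spine weight one more \<open>m\<close>, and the denominator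
  \<open>n ^ (q + 1)\<close>. The quotient is of order \<open>1 / sqrt n\<close>, the width of a
  cell, and \<open>sqrt n\<close> turns it into a density.\<close>

lemma spine_density_lower_limit:
  assumes u: "u > 0"
  shows "(\<lambda>n. sqrt (real n) * (catalan_coeff (Suc q) * real ((grid u n - 1) choose (2 * q)) * spine_weight n (grid u n) / real (n choose Suc q)))
     \<longlonglongrightarrow> spine_density q u"
proof (rule Lim_transform_eventually)
  let ?g = "\<lambda>n. real (grid u n)"
  let ?P = "\<lambda>n. \<Prod>i\<in>{1..<grid u n}. 1 - real i / real n"
  have 1: "(\<lambda>n. real ((grid u n - 1) choose (2 * q)) / ?g n ^ (2 * q)) \<longlonglongrightarrow> 1 / fact (2 * q)"
    using filterlim_compose[OF choose_over_power_limit grid_at_top[OF u], of 1 "2 * q"] by (simp add: o_def)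
  have 2: "(\<lambda>n. real (n choose Suc q) / real n ^ Suc q) \<longlonglongrightarrow> 1 / fact (Suc q)"
    using choose_over_power_limit[of 0 "Suc q"] by simp
  have "(\<lambda>n. catalan_coeff (Suc q) * (real ((grid u n - 1) choose (2 * q)) / ?g n ^ (2 * q)) *
     (?g n / sqrt (real n)) ^ (2 * q + 1) * ?P n / (real (n choose Suc q) / real n ^ Suc q)) \<longlonglongrightarrow>
     catalan_coeff (Suc q) * (1 / fact (2 * q)) * u ^ (2 * q + 1) * exp (- (u\<^sup>2 / 2)) / (1 / fact (Suc q))"
    by (intro tendsto_intros 1 2 grid_limit[OF u] spine_prod_limit[OF u]) (auto simp del: fact_Suc)
  also have "catalan_coeff (Suc q) * (1 / fact (2 * q)) * u ^ (2 * q + 1) * exp (- (u\<^sup>2 / 2)) / (1 / fact (Suc q)) =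
    (catalan_coeff (Suc q) * fact (Suc q) / fact (2 * q)) * (u ^ (2 * q + 1) * exp (- (u\<^sup>2 / 2)))"
    by (simp del: fact_Suc)
  also have "\<dots> = spine_density q u" unfolding catalan_coeff_closed using u by (simp add: spine_density_def)
  finally show "(\<lambda>n. catalan_coeff (Suc q) * (real ((grid u n - 1) choose (2 * q)) / ?g n ^ (2 * q)) *
     (?g n / sqrt (real n)) ^ (2 * q + 1) * ?P n / (real (n choose Suc q) / real n ^ Suc q)) \<longlonglongrightarrow> spine_density q u" .
  show "\<forall>\<^sub>F n in sequentially. catalan_coeff (Suc q) * (real ((grid u n - 1) choose (2 * q)) / ?g n ^ (2 * q)) *
     (?g n / sqrt (real n)) ^ (2 * q + 1) * ?P n / (real (n choose Suc q) / real n ^ Suc q) =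
     sqrt (real n) * (catalan_coeff (Suc q) * real ((grid u n - 1) choose (2 * q)) * spine_weight n (grid u n) / real (n choose Suc q))"
    using eventually_gt_at_top[of 0]
  proof eventually_elim
    case (elim n)
    define R where "R = sqrt (real n)"
    have R: "R > 0" "real n = R ^ 2" using elim by (auto simp: R_def)
    have g: "?g n > 0" using grid_pos[OF u elim] by simp
    have "(?g n / R) ^ (2 * q + 1) * real n ^ Suc q = ?g n ^ (2 * q) * (?g n * R)"
    proof -
      have "real n ^ Suc q = R ^ (2 * q + 1) * R" unfolding R(2) by (simp add: power_mult power2_eq_square)
      then have "(?g n / R) ^ (2 * q + 1) * real n ^ Suc q = ((?g n / R) * R) ^ (2 * q + 1) * R"
        by (simp only: power_mult_distrib mult.assoc)
      then show ?thesis using R by simp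
    qed
    then have "catalan_coeff (Suc q) * (real ((grid u n - 1) choose (2 * q)) / ?g n ^ (2 * q)) *
       ((?g n / R) ^ (2 * q + 1) * real n ^ Suc q) * ?P n / real (n choose Suc q) =
       catalan_coeff (Suc q) * (real ((grid u n - 1) choose (2 * q)) / ?g n ^ (2 * q)) *
       (?g n ^ (2 * q) * (?g n * R)) * ?P n / real (n choose Suc q)"
      by (simp only:)
    also have "\<dots> = R * (catalan_coeff (Suc q) * real ((grid u n - 1) choose (2 * q)) * spine_weight n (grid u n) / real (n choose Suc q))"
      using g by (simp add: spine_weight_def mult_ac)
    finally show ?case unfolding R_def by (simp add: mult_ac)
  qed
qed

text \<open>Step function with value \<open>a j\<close> on the \<open>j\<close>-th cell, of width
  \<open>1 / sqrt n\<close>. It turns sums over indices into integrals, to which dominated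
  convergence applies.\<close>

definition grid_step :: "nat \<Rightarrow> (nat \<Rightarrow> real) \<Rightarrow> real \<Rightarrow> real" where
  "grid_step n a u = (\<Sum>j\<in>{1..n}. a j * indicator {(real j - 1) / sqrt (real n)<..real j / sqrt (real n)} u)"

lemma grid_step_eq:
  assumes "n > 0"
  shows "grid_step n a u = (if u > 0 \<and> grid u n \<le> n then a (grid u n) else 0)"
proof -
  have s: "sqrt (real n) > 0" using assms by simp
  have iff: "u \<in> {(real j - 1) / sqrt (real n)<..real j / sqrt (real n)} \<longleftrightarrow> u > 0 \<and> j = grid u n" if "j \<ge> 1" for j
  proof
    assume "u \<in> {(real j - 1) / sqrt (real n)<..real j / sqrt (real n)}"
    then have a: "real j - 1 < u * sqrt (real n)" "u * sqrt (real n) \<le> real j"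
      using s by (auto simp: field_simps)
    then have "0 < u * sqrt (real n)" using that by (simp add: less_le_trans)
    then have "u > 0" using s by (simp add: zero_less_mult_iff)
    moreover have "\<lceil>u * sqrt (real n)\<rceil> = int j" using a by (simp add: ceiling_eq_iff)
    ultimately show "u > 0 \<and> j = grid u n" by (simp add: grid_def)
  next
    assume a: "u > 0 \<and> j = grid u n"
    then have "u * sqrt (real n) > 0" using s by simp
    then have "real j = of_int \<lceil>u * sqrt (real n)\<rceil>" using a by (simp add: grid_def)
    then have "real j - 1 < u * sqrt (real n)" "u * sqrt (real n) \<le> real j" by linarith+
    then show "u \<in> {(real j - 1) / sqrt (real n)<..real j / sqrt (real n)}"
      using s by (auto simp: field_simps)
  qed
  have "grid_step n a u = (\<Sum>j\<in>{1..n}. if u > 0 \<and> j = grid u n then a j else 0)"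
    unfolding grid_step_def
  proof (rule sum.cong[OF refl])
    fix j assume "j \<in> {1..n}"
    then show "a j * indicator {(real j - 1) / sqrt (real n)<..real j / sqrt (real n)} u =
      (if u > 0 \<and> j = grid u n then a j else 0)"
      using iff[of j] by (simp add: indicator_def del: greaterThanAtMost_iff)
  qed
  also have "\<dots> = (if u > 0 \<and> grid u n \<le> n then a (grid u n) else 0)"
    using grid_pos[of u n] assms by (cases "u > 0") (auto simp: sum.delta' sum.delta)
  finally show ?thesis .
qed

lemma grid_step_measurable [measurable]: "grid_step n a \<in> borel_measurable borel"
  unfolding grid_step_def[abs_def] by measurable

lemma has_integral_grid_step:
  assumes "n > 0"
  shows "has_bochner_integral lborel (grid_step n a) ((\<Sum>j\<in>{1..n}. a j) / sqrt (real n))"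
proof -
  have "has_bochner_integral lborel (grid_step n a) (\<Sum>j\<in>{1..n}. a j * (1 / sqrt (real n)))"
    unfolding grid_step_def[abs_def]
  proof (intro has_bochner_integral_sum has_bochner_integral_mult_right)
    fix j
    have le: "(real j - 1) / sqrt (real n) \<le> real j / sqrt (real n)" by (intro divide_right_mono) auto
    have "has_bochner_integral lborel (indicator {(real j - 1) / sqrt (real n)<..real j / sqrt (real n)} :: real \<Rightarrow> real)
      (measure lborel {(real j - 1) / sqrt (real n)<..real j / sqrt (real n)})"
      using le by (intro has_bochner_integral_real_indicator) auto
    moreover have "measure lborel {(real j - 1) / sqrt (real n)<..real j / sqrt (real n)} = 1 / sqrt (real n)"
      using le by (simp flip: diff_divide_distrib)
    ultimately show "has_bochner_integral lborel (indicator {(real j - 1) / sqrt (real n)<..real j / sqrt (real n)} :: real \<Rightarrow> real) (1 / sqrt (real n))"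
      by simp
  qed
  then show ?thesis by (simp add: sum_divide_distrib)
qed

section \<open>Convergence of the weights to the limiting density\<close>

lemma spine_weight_nonneg: "m \<le> n \<Longrightarrow> 0 \<le> spine_weight n m"
  unfolding spine_weight_def by (intro mult_nonneg_nonneg prod_nonneg) auto

definition spine_prob :: "nat \<Rightarrow> nat \<Rightarrow> nat \<Rightarrow> real" where
  "spine_prob q n m = cut_weight 0 (Suc q) m * spine_weight n m / real (n choose Suc q)"

context
  fixes q :: nat
  assumes total: "\<And>n. n \<ge> 1 \<Longrightarrow> (\<Sum>m=1..n. cut_weight 0 (Suc q) m * spine_weight n m) = real (n choose Suc q)"
begin

lemma spine_prob_nonneg: "m \<le> n \<Longrightarrow> 0 \<le> spine_prob q n m"
  unfolding spine_prob_def using cut_weight_bounds[of 0 "Suc q" m] spine_weight_nonneg by simp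

lemma spine_prob_sum: "n \<ge> Suc q \<Longrightarrow> (\<Sum>m=1..n. spine_prob q n m) = 1"
  unfolding spine_prob_def using total[of n] by (simp flip: sum_divide_distrib)

text \<open>
  As in Scheffe's lemma, the pointwise lower bound of the weights by the limiting density is
  enough, because both have total mass 1: it is applied to \<open>h\<close> and to \<open>1 - h\<close>.
\<close>

lemma spine_prob_limit:
  fixes p :: "nat \<Rightarrow> real" and h :: "real \<Rightarrow> real"
  assumes p: "\<And>n. 0 \<le> p n" "\<And>n. p n \<le> 1"
    and h: "\<And>u. u > 0 \<Longrightarrow> (\<lambda>n. p n ^ (grid u n - 1)) \<longlonglongrightarrow> h u"
    and hm [measurable]: "h \<in> borel_measurable borel"
  shows "(\<lambda>n. \<Sum>m=1..n. p n ^ (m - 1) * spine_prob q n m) \<longlonglongrightarrow> (LBINT u. spine_density q u * h u)"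
proof -
  let ?g = "spine_density q"
  define A where "A n = grid_step n (\<lambda>m. sqrt (real n) * spine_prob q n m)" for n
  define F where "F n = grid_step n (\<lambda>m. p n ^ (m - 1))" for n
  \<comment> \<open>Truncation at \<open>?g\<close> provides an integrable majorant. It only loses
    mass, so \<open>a n\<close> is a lower bound for \<open>S n\<close>, and \<open>b n\<close> one
    for \<open>1 - S n\<close>.\<close>
  define a where "a n = (LBINT u. F n u * min (A n u) (?g u))" for n
  define b where "b n = (LBINT u. (1 - F n u) * min (A n u) (?g u))" for n
  define S where "S n = (\<Sum>m=1..n. p n ^ (m - 1) * spine_prob q n m)" for n
  have [measurable]: "A n \<in> borel_measurable borel" "F n \<in> borel_measurable borel" for n
    by (auto simp: A_def F_def)
  have gint: "integrable lborel ?g" "(LBINT u. ?g u) = 1"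
    using has_integral_spine_density[of q] by (auto simp: has_bochner_integral_iff)
  have A0: "0 \<le> A n u" if "n > 0" for n u
    using that by (auto simp: A_def grid_step_eq spine_prob_nonneg)
  have F01: "0 \<le> F n u" "F n u \<le> 1" if "n > 0" for n u
    using that p by (auto simp: F_def grid_step_eq power_le_one)
  have Aint: "has_bochner_integral lborel (A n) 1" if "n \<ge> Suc q" for n
  proof -
    have "n > 0" using that by simp
    from has_integral_grid_step[OF this, of "\<lambda>m. sqrt (real n) * spine_prob q n m"]
    show ?thesis using that spine_prob_sum[OF that] by (simp add: A_def flip: sum_distrib_left)
  qed
  have FAint: "has_bochner_integral lborel (\<lambda>u. F n u * A n u) (S n)" if "n > 0" for n
  proof -
    have "(\<lambda>u. F n u * A n u) = grid_step n (\<lambda>m. sqrt (real n) * (p n ^ (m - 1) * spine_prob q n m))"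
      using that by (auto simp: F_def A_def grid_step_eq)
    then show ?thesis
      using has_integral_grid_step[OF that, of "\<lambda>m. sqrt (real n) * (p n ^ (m - 1) * spine_prob q n m)"] that
      by (simp add: S_def flip: sum_distrib_left)
  qed
  have bound: "norm (c * min (A n u) (?g u)) \<le> ?g u" if "n > 0" "0 \<le> c" "c \<le> 1" for n u c
  proof -
    have "0 \<le> min (A n u) (?g u)" using A0[OF that(1)] spine_density_nonneg by simp
    then have "c * min (A n u) (?g u) \<le> 1 * ?g u" using that by (intro mult_mono) auto
    then show ?thesis using that \<open>0 \<le> min (A n u) (?g u)\<close> by simp
  qed
  have integ': "integrable lborel (\<lambda>u. c u * min (A n u) (?g u))"
    if "n > 0" "c \<in> borel_measurable borel" "\<And>u. 0 \<le> c u \<and> c u \<le> 1" for n and c :: "real \<Rightarrow> real"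
  proof (rule Bochner_Integration.integrable_bound[OF gint(1)])
    show "AE u in lborel. norm (c u * min (A n u) (?g u)) \<le> norm (?g u)"
    proof (rule AE_I2)
      fix u
      show "norm (c u * min (A n u) (?g u)) \<le> norm (?g u)"
        using bound[OF that(1), of "c u" u] that(3)[of u] spine_density_nonneg[of q u] by simp
    qed
  qed (use that(2) in measurable)
  have integ: "integrable lborel (\<lambda>u. F n u * min (A n u) (?g u))"
     "integrable lborel (\<lambda>u. (1 - F n u) * min (A n u) (?g u))" if "n > 0" for n
    using F01[OF that] by (auto intro!: integ' that)
  have ab: "a n \<le> S n \<and> S n \<le> 1 - b n" if n: "n \<ge> Suc q" for n
  proof
    have n0: "n > 0" using n by simp
    have "a n \<le> (LBINT u. F n u * A n u)"
      unfolding a_def using FAint[OF n0] integ[OF n0] F01[OF n0]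
      by (intro integral_mono) (auto simp: has_bochner_integral_iff intro!: mult_left_mono)
    then show "a n \<le> S n" using FAint[OF n0] by (simp add: has_bochner_integral_iff)
    have i: "has_bochner_integral lborel (\<lambda>u. A n u - F n u * A n u) (1 - S n)"
      by (intro has_bochner_integral_diff Aint FAint n n0)
    have "b n \<le> (LBINT u. A n u - F n u * A n u)"
      unfolding b_def
    proof (rule integral_mono)
      fix u
      have "(1 - F n u) * min (A n u) (?g u) \<le> (1 - F n u) * A n u"
        using F01[OF n0, of u] by (intro mult_left_mono) auto
      then show "(1 - F n u) * min (A n u) (?g u) \<le> A n u - F n u * A n u" by (simp add: algebra_simps)
    qed (use i integ[OF n0] in \<open>auto simp: has_bochner_integral_iff\<close>)
    then show "S n \<le> 1 - b n" using i by (simp add: has_bochner_integral_iff)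
  qed
  have evle: "\<forall>\<^sub>F n in sequentially. n > 0 \<and> grid u n \<le> n" if u: "u > 0" for u
    using order_tendstoD(2)[OF grid_over_n_limit[OF u] zero_less_one] eventually_gt_at_top[of 0]
    by eventually_elim auto
  have Flim: "(\<lambda>n. F n u) \<longlonglongrightarrow> h u" if u: "u > 0" for u
    by (rule Lim_transform_eventually[OF h[OF u]])
      (use evle[OF u] in eventually_elim, use u in \<open>auto simp: F_def grid_step_eq\<close>)
  have Alim: "(\<lambda>n. min (A n u) (?g u)) \<longlonglongrightarrow> ?g u" if u: "u > 0" for u
  proof (rule tendsto_sandwich)
    let ?l = "\<lambda>n. sqrt (real n) * (catalan_coeff (Suc q) * real ((grid u n - 1) choose (2 * q)) * spine_weight n (grid u n) / real (n choose Suc q))"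
    show "(\<lambda>n. min (?l n) (?g u)) \<longlonglongrightarrow> ?g u"
      using tendsto_min[OF spine_density_lower_limit[OF u, of q] tendsto_const[of "?g u"]] by simp
    show "\<forall>\<^sub>F n in sequentially. min (?l n) (?g u) \<le> min (A n u) (?g u)"
      using evle[OF u]
    proof eventually_elim
      case (elim n)
      have "catalan_coeff (Suc q) * real ((grid u n - 1) choose (2 * q)) \<le> cut_weight 0 (Suc q) (grid u n)"
        using grid_pos[OF u, of n] elim by (intro cut_weight_ge_choose) auto
      then have "?l n \<le> A n u"
        using elim u spine_weight_nonneg[of "grid u n" n] unfolding A_def spine_prob_def
        by (auto simp: grid_step_eq intro!: mult_left_mono divide_right_mono mult_right_mono)
      then show ?case by auto
    qed
  qed auto
  have dct: "(\<lambda>n. LBINT u. c n u * min (A n u) (?g u)) \<longlonglongrightarrow> (LBINT u. ?g u * k u)"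
    if [measurable]: "\<And>n. c n \<in> borel_measurable borel" "k \<in> borel_measurable borel"
      and c: "\<And>n u. n > 0 \<Longrightarrow> 0 \<le> c n u \<and> c n u \<le> 1" "\<And>u. u > 0 \<Longrightarrow> (\<lambda>n. c n u) \<longlonglongrightarrow> k u"
    for c :: "nat \<Rightarrow> real \<Rightarrow> real" and k
  \<comment> \<open>The majorant is established only for positive \<open>n\<close>; the shift by 1
    removes the index 0.\<close>
  proof (rule LIMSEQ_offset[of _ 1], rule integral_dominated_convergence[where w = ?g])
    show "AE u in lborel. (\<lambda>n. c (n + 1) u * min (A (n + 1) u) (?g u)) \<longlonglongrightarrow> ?g u * k u"
    proof (rule AE_I2)
      fix u :: real
      show "(\<lambda>n. c (n + 1) u * min (A (n + 1) u) (?g u)) \<longlonglongrightarrow> ?g u * k u"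
      proof (cases "u > 0")
        case True
        from LIMSEQ_ignore_initial_segment[OF tendsto_mult[OF c(2)[OF True] Alim[OF True]], of 1]
        show ?thesis by (simp add: mult.commute)
      qed (simp add: A_def grid_step_eq spine_density_def)
    qed
    show "AE u in lborel. norm (c (n + 1) u * min (A (n + 1) u) (?g u)) \<le> ?g u" for n
      using bound[of "n + 1"] c(1)[of "n + 1"] by (intro AE_I2) simp
  qed (use gint in auto)
  have alim: "a \<longlonglongrightarrow> (LBINT u. ?g u * h u)"
    unfolding a_def using F01 Flim by (intro dct) auto
  have blim: "b \<longlonglongrightarrow> (LBINT u. ?g u * (1 - h u))"
    unfolding b_def using F01 Flim by (intro dct tendsto_diff tendsto_const) auto
  have h01: "0 \<le> h u \<and> h u \<le> 1" if u: "u > 0" for u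
    using LIMSEQ_le_const[OF h[OF u], of 0] LIMSEQ_le_const2[OF h[OF u], of 1] p
    by (auto simp: power_le_one)
  have ghint: "integrable lborel (\<lambda>u. ?g u * h u)"
  proof (rule Bochner_Integration.integrable_bound[OF gint(1)])
    show "AE u in lborel. norm (?g u * h u) \<le> norm (?g u)"
    proof (rule AE_I2)
      fix u :: real
      show "norm (?g u * h u) \<le> norm (?g u)"
      proof (cases "u > 0")
        case True
        then have "?g u * h u \<le> ?g u" "0 \<le> ?g u * h u"
          using h01[of u] spine_density_nonneg[of q u] by (auto intro: mult_left_le)
        then show ?thesis by simp
      qed (simp add: spine_density_def)
    qed
  qed auto
  have "(LBINT u. ?g u * (1 - h u)) = (LBINT u. ?g u - ?g u * h u)" by (simp add: algebra_simps)
  also have "\<dots> = 1 - (LBINT u. ?g u * h u)" using gint ghint by (subst Bochner_Integration.integral_diff) auto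
  finally have eq: "1 - (LBINT u. ?g u * (1 - h u)) = (LBINT u. ?g u * h u)" by simp
  have "S \<longlonglongrightarrow> (LBINT u. ?g u * h u)"
  proof (rule tendsto_sandwich[OF _ _ alim])
    show "(\<lambda>n. 1 - b n) \<longlonglongrightarrow> (LBINT u. ?g u * h u)"
      using tendsto_diff[OF tendsto_const[of 1] blim] unfolding eq .
    show "\<forall>\<^sub>F n in sequentially. a n \<le> S n" "\<forall>\<^sub>F n in sequentially. S n \<le> 1 - b n"
      using ab by (auto intro!: eventually_sequentiallyI[of "Suc q"])
  qed
  then show ?thesis by (simp add: S_def[abs_def])
qed

end

text \<open>The product is at least 1 minus the sum of its \<open>r / i\<close>, and a harmonic sum
  is at most \<open>1 + ln n\<close>. With \<open>r = n powr - \<alpha>\<close> the loss is of order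
  \<open>ln n / n powr \<alpha>\<close>, which vanishes for every positive
  \<open>\<alpha>\<close>.\<close>

lemma cut_decay_limit:
  assumes "\<alpha> > 0"
  shows "(\<lambda>n. cut_decay (real n powr - \<alpha>) n) \<longlonglongrightarrow> 1"
proof (rule tendsto_sandwich)
  have harm: "(\<Sum>i\<in>{1..<Suc n}. 1 / real i) \<le> 1 + ln (real n)" if "n \<ge> 1" for n
    using that
  proof (induct n rule: dec_induct)
    case (step n)
    have "ln (real n / real (Suc n)) \<le> real n / real (Suc n) - 1"
      using step by (intro ln_le_minus_one) auto
    also have "\<dots> = - (1 / real (Suc n))" by (simp add: field_simps)
    finally have "1 / real (Suc n) \<le> ln (real (Suc n)) - ln (real n)"
      using step by (simp add: ln_div)
    then show ?case using step by simp
  qed simp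
  have pw: "0 \<le> real n powr - \<alpha>" "real n powr - \<alpha> \<le> 1" for n
    using assms by (cases n; auto simp: powr_minus inverse_le_1_iff ge_one_powr_ge_zero)+
  show "(\<lambda>n. 1 - (real n powr - \<alpha> + ln (real n) / real n powr \<alpha>)) \<longlonglongrightarrow> 1"
  proof -
    have "(\<lambda>n. real n powr - \<alpha>) \<longlonglongrightarrow> 0"
      using assms by (intro tendsto_neg_powr filterlim_real_sequentially) auto
    from tendsto_diff[OF tendsto_const[of 1] tendsto_add[OF this lim_ln_over_power[OF assms]]]
    show ?thesis by simp
  qed
  show "\<forall>\<^sub>F n in sequentially. cut_decay (real n powr - \<alpha>) n \<le> 1"
    using cut_decay_range(2)[OF pw] by simp
  show "\<forall>\<^sub>F n in sequentially. 1 - (real n powr - \<alpha> + ln (real n) / real n powr \<alpha>) \<le> cut_decay (real n powr - \<alpha>) n"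
    using eventually_ge_at_top[of 1]
  proof eventually_elim
    case (elim n)
    have "1 - (\<Sum>i\<in>{1..<n}. real n powr - \<alpha> / real i) \<le> cut_decay (real n powr - \<alpha>) n"
      unfolding cut_decay_def
    proof (rule Weierstrass_prod_ineq)
      fix i assume "i \<in> {1..<n}"
      then show "real n powr - \<alpha> / real i \<in> {0..1}"
        using pw[of n] by (auto simp: divide_le_eq intro: order_trans)
    qed
    moreover have "(\<Sum>i\<in>{1..<n}. real n powr - \<alpha> / real i) \<le> real n powr - \<alpha> * (1 + ln (real n))"
    proof -
      have "(\<Sum>i\<in>{1..<n}. 1 / real i) \<le> (\<Sum>i\<in>{1..<Suc n}. 1 / real i)" by simp
      also note harm[OF elim]
      finally have "real n powr - \<alpha> * (\<Sum>i\<in>{1..<n}. 1 / real i) \<le> real n powr - \<alpha> * (1 + ln (real n))"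
        by (intro mult_left_mono pw)
      then show ?thesis by (simp add: sum_distrib_left)
    qed
    moreover have "real n powr - \<alpha> * (1 + ln (real n)) = real n powr - \<alpha> + ln (real n) / real n powr \<alpha>"
      by (simp add: powr_minus divide_inverse algebra_simps)
    ultimately show ?case by linarith
  qed
qed simp

definition survival :: "real \<Rightarrow> real \<Rightarrow> real" where
  "survival \<alpha> u = (if \<alpha> < 1 / 2 then 0 else if \<alpha> = 1 / 2 then exp (- u) else 1)"

lemma survival_limit:
  assumes \<alpha>: "\<alpha> > 0" and u: "u > 0"
  shows "(\<lambda>n. (1 / (1 + real n powr - \<alpha>)) ^ (grid u n - 1)) \<longlonglongrightarrow> survival \<alpha> u"
proof -
  let ?r = "\<lambda>n. real n powr - \<alpha>"
  \<comment> \<open>The logarithm of the power is \<open>- (x n * y n * c n)\<close>, with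
    \<open>x\<close> tending to \<open>u\<close> and \<open>y\<close> to 1. Only
    \<open>c n = n powr (1 / 2 - \<alpha>)\<close> distinguishes the three regimes.\<close>
  define x where "x n = (real (grid u n) - 1) / sqrt (real n)" for n
  define y where "y n = ln (1 + ?r n) / ?r n" for n
  define c where "c n = real n powr (1 / 2 - \<alpha>)" for n :: nat
  have r0: "?r \<longlonglongrightarrow> 0"
    using \<alpha> by (intro tendsto_neg_powr filterlim_real_sequentially) auto
  have "x \<longlonglongrightarrow> u"
    using tendsto_diff[OF grid_limit[OF u] inverse_sqrt_limit] unfolding x_def diff_divide_distrib by simp
  moreover have "y \<longlonglongrightarrow> 1"
  proof (rule tendsto_sandwich)
    show "(\<lambda>n. 1 - ?r n) \<longlonglongrightarrow> 1" using tendsto_diff[OF tendsto_const[of 1] r0] by simp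
    have pw: "0 < ?r n" "?r n \<le> 1" if "n \<ge> 1" for n
      using that \<alpha> by (auto simp: powr_minus inverse_le_1_iff ge_one_powr_ge_zero)
    show "\<forall>\<^sub>F n in sequentially. 1 - ?r n \<le> y n"
      using eventually_ge_at_top[of 1]
    proof eventually_elim
      case (elim n)
      have "(1 - ?r n) * ?r n \<le> ln (1 + ?r n)"
        using ln_one_plus_pos_lower_bound[of "?r n"] pw[OF elim] by (simp add: power2_eq_square algebra_simps)
      then show ?case using pw[OF elim] by (simp add: y_def le_divide_eq)
    qed
    show "\<forall>\<^sub>F n in sequentially. y n \<le> 1"
      using eventually_ge_at_top[of 1]
    proof eventually_elim
      case (elim n)
      show ?case using pw[OF elim] ln_add_one_self_le_self[of "?r n"] by (simp add: y_def divide_le_eq)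
    qed
  qed simp
  ultimately have xy: "(\<lambda>n. x n * y n) \<longlonglongrightarrow> u" using tendsto_mult[of x u _ y 1] by simp
  have eq: "\<forall>\<^sub>F n in sequentially. exp (- (x n * y n * c n)) = (1 / (1 + ?r n)) ^ (grid u n - 1)"
    using eventually_ge_at_top[of 1]
  proof eventually_elim
    case (elim n)
    have rp: "?r n > 0" using elim by simp
    have s: "sqrt (real n) > 0" using elim by simp
    have "c n = sqrt (real n) * ?r n"
      using powr_add[of "real n" "1 / 2" "- \<alpha>"] powr_half_sqrt[of "real n"] by (simp only: c_def) simp
    moreover have "X / S * (L / R) * (S * R) = X * L" if "S > 0" "R > 0" for X L S R :: real
      using that by simp
    ultimately have "x n * y n * c n = (real (grid u n) - 1) * ln (1 + ?r n)"
      unfolding x_def y_def using s rp by simp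
    moreover have "real (grid u n) - 1 = real (grid u n - 1)"
      using grid_pos[OF u, of n] elim by (simp add: of_nat_diff)
    ultimately have "x n * y n * c n = real (grid u n - 1) * ln (1 + ?r n)" by (simp only:)
    then have "exp (- (x n * y n * c n)) = inverse (exp (ln (1 + ?r n)) ^ (grid u n - 1))"
      by (simp only: exp_minus exp_of_nat_mult)
    also have "exp (ln (1 + ?r n)) = 1 + ?r n"
      by (rule exp_ln, rule add_pos_pos[OF zero_less_one rp])
    finally show ?case by (simp only: power_one_over inverse_eq_divide)
  qed
  have "(\<lambda>n. exp (- (x n * y n * c n))) \<longlonglongrightarrow> survival \<alpha> u"
  proof -
    consider "\<alpha> < 1 / 2" | "\<alpha> = 1 / 2" | "\<alpha> > 1 / 2" by linarith
    then show ?thesis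
    proof cases
      case 1
      have "filterlim c at_top sequentially"
      proof -
        have "(\<lambda>n. real n powr (\<alpha> - 1 / 2)) \<longlonglongrightarrow> 0"
          using 1 by (intro tendsto_neg_powr filterlim_real_sequentially) auto
        moreover have "\<forall>\<^sub>F n in sequentially. 0 < real n powr (\<alpha> - 1 / 2)"
          using eventually_gt_at_top[of 0] by eventually_elim simp
        ultimately have "filterlim (\<lambda>n. inverse (real n powr (\<alpha> - 1 / 2))) at_top sequentially"
          by (rule filterlim_inverse_at_top)
        then show ?thesis by (simp add: c_def[abs_def] flip: powr_minus)
      qed
      from filterlim_tendsto_pos_mult_at_top[OF xy u this]
      have "filterlim (\<lambda>n. - (x n * y n * c n)) at_bot sequentially"
        by (simp add: filterlim_uminus_at_bot)
      from filterlim_compose[OF exp_at_bot this] show ?thesis using 1 by (simp add: survival_def)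
    next
      case 2
      have "c \<longlonglongrightarrow> 1"
        by (rule Lim_transform_eventually[OF tendsto_const])
          (use eventually_ge_at_top[of 1] in eventually_elim, simp add: c_def 2)
      from tendsto_exp[OF tendsto_minus[OF tendsto_mult[OF xy this]]] show ?thesis using 2 by (simp add: survival_def)
    next
      case 3
      have "c \<longlonglongrightarrow> 0"
        unfolding c_def using 3 by (intro tendsto_neg_powr filterlim_real_sequentially) auto
      from tendsto_exp[OF tendsto_minus[OF tendsto_mult[OF xy this]]] show ?thesis using 3 by (simp add: survival_def)
    qed
  qed
  from Lim_transform_eventually[OF this eq] show ?thesis .
qed

text \<open>The true weights lie between \<open>cut_decay ^ Suc q\<close> times the weights at rate
  0 and the latter themselves. As the first factor tends to 1, the limit is the one found for the
  weights at rate 0.\<close>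

lemma factorial_moment_limit:
  assumes \<alpha>: "\<alpha> > 0"
    and total: "\<And>n. n \<ge> 1 \<Longrightarrow> (\<Sum>m=1..n. cut_weight 0 (Suc q) m * spine_weight n m) = real (n choose Suc q)"
  shows "(\<lambda>n. (\<Sum>m=1..n. (1 / (1 + real n powr - \<alpha>)) ^ (m - 1) * cut_weight (real n powr - \<alpha>) (Suc q) m * spine_weight n m)
      / real (n choose Suc q)) \<longlonglongrightarrow> (LBINT u. spine_density q u * survival \<alpha> u)"
proof -
  let ?r = "\<lambda>n. real n powr - \<alpha>"
  let ?S = "\<lambda>n. \<Sum>m=1..n. (1 / (1 + ?r n)) ^ (m - 1) * spine_prob q n m"
  let ?M = "\<lambda>n. (\<Sum>m=1..n. (1 / (1 + ?r n)) ^ (m - 1) * cut_weight (?r n) (Suc q) m * spine_weight n m) / real (n choose Suc q)"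
  let ?L = "LBINT u. spine_density q u * survival \<alpha> u"
  have pw: "0 \<le> ?r n" "?r n \<le> 1" for n
    using \<alpha> by (cases n; auto simp: powr_minus inverse_le_1_iff ge_one_powr_ge_zero)+
  have S: "?S \<longlonglongrightarrow> ?L"
  proof (rule spine_prob_limit[OF total])
    show "survival \<alpha> \<in> borel_measurable borel" unfolding survival_def[abs_def] by measurable
  qed (use pw survival_limit[OF \<alpha>] in \<open>auto simp: divide_le_eq add_pos_nonneg\<close>)
  show ?thesis
  proof (rule tendsto_sandwich[OF _ _ _ S])
    show "(\<lambda>n. cut_decay (?r n) n ^ Suc q * ?S n) \<longlonglongrightarrow> ?L"
      using tendsto_mult[OF tendsto_power[OF cut_decay_limit[OF \<alpha>], of "Suc q"] S] by simp
    show "\<forall>\<^sub>F n in sequentially. cut_decay (?r n) n ^ Suc q * ?S n \<le> ?M n"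
    proof (rule always_eventually, rule allI)
      fix n
      have "cut_decay (?r n) n ^ Suc q * ?S n =
        (\<Sum>m=1..n. (1 / (1 + ?r n)) ^ (m - 1) * (cut_decay (?r n) n ^ Suc q * cut_weight 0 (Suc q) m) * spine_weight n m) / real (n choose Suc q)"
        unfolding spine_prob_def by (simp add: sum_distrib_left sum_divide_distrib mult_ac)
      also have "\<dots> \<le> ?M n"
        by (intro divide_right_mono sum_mono mult_right_mono mult_left_mono cut_weight_lower pw spine_weight_nonneg)
          (use pw in auto)
      finally show "cut_decay (?r n) n ^ Suc q * ?S n \<le> ?M n" .
    qed
    show "\<forall>\<^sub>F n in sequentially. ?M n \<le> ?S n"
    proof (rule always_eventually, rule allI)
      fix n
      have "?M n \<le>
         (\<Sum>m=1..n. (1 / (1 + ?r n)) ^ (m - 1) * cut_weight 0 (Suc q) m * spine_weight n m) / real (n choose Suc q)"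
        by (intro divide_right_mono sum_mono mult_right_mono mult_left_mono cut_weight_bounds[THEN conjunct2] pw spine_weight_nonneg)
          (use pw in auto)
      also have "\<dots> = ?S n"
        unfolding spine_prob_def by (simp add: sum_divide_distrib mult_ac)
      finally show "?M n \<le> ?S n" .
    qed
  qed
qed

subsection \<open>Finite continuous-time Markov chains\<close>

lemma sum_generator:
  assumes "finite S" "x \<in> S"
  shows "(\<Sum>y\<in>S. generator S q x y * h y) = (\<Sum>y\<in>S. q x y * (h y - h x))"
proof -
  have "(\<Sum>y\<in>S. generator S q x y * h y) = generator S q x x * h x + (\<Sum>y\<in>S - {x}. generator S q x y * h y)"
    using assms by (simp add: sum.remove)
  also have "(\<Sum>y\<in>S - {x}. generator S q x y * h y) = (\<Sum>y\<in>S - {x}. q x y * h y)"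
    by (intro sum.cong) (auto simp: generator_def)
  also have "generator S q x x * h x + \<dots> = (\<Sum>y\<in>S - {x}. q x y * (h y - h x))"
    by (simp add: generator_def sum_distrib_right right_diff_distrib sum_subtractf)
  also have "\<dots> = (\<Sum>y\<in>S. q x y * (h y - h x))"
    using assms by (simp add: sum.remove[of S x])
  finally show ?thesis .
qed

lemma kernel_power_bound:
  assumes "finite S" "y \<in> S"
  shows "\<bar>kernel_power S G k x y\<bar> \<le> (\<Sum>z\<in>S. \<Sum>y\<in>S. \<bar>G z y\<bar>) ^ k"
  using assms(2)
proof (induct k arbitrary: y)
  case (Suc k)
  let ?c = "\<Sum>z\<in>S. \<Sum>y\<in>S. \<bar>G z y\<bar>"
  have c: "0 \<le> ?c" by (intro sum_nonneg) auto
  have "\<bar>kernel_power S G (Suc k) x y\<bar> \<le> (\<Sum>z\<in>S. \<bar>kernel_power S G k x z * G z y\<bar>)"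
    by (simp add: sum_abs)
  also have "\<dots> \<le> (\<Sum>z\<in>S. ?c ^ k * \<bar>G z y\<bar>)"
    using Suc by (intro sum_mono) (auto simp: abs_mult intro!: mult_right_mono)
  also have "\<dots> \<le> (\<Sum>z\<in>S. ?c ^ k * (\<Sum>y\<in>S. \<bar>G z y\<bar>))"
    using Suc.prems assms(1) c by (intro sum_mono mult_left_mono member_le_sum) auto
  also have "\<dots> = ?c ^ Suc k"
    unfolding sum_distrib_left[symmetric] power_Suc by (rule mult.commute)
  finally show ?case .
qed simp

lemma summable_kernel_power:
  assumes "finite S" "y \<in> S"
  shows "summable (\<lambda>k. t ^ k / fact k * kernel_power S G k x y)"
proof (rule summable_comparison_test')
  let ?c = "\<Sum>z\<in>S. \<Sum>y\<in>S. \<bar>G z y\<bar>"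
  show "summable (\<lambda>k. inverse (fact k) * (\<bar>t\<bar> * ?c) ^ k)" by (rule summable_exp)
  show "norm (t ^ k / fact k * kernel_power S G k x y) \<le> inverse (fact k) * (\<bar>t\<bar> * ?c) ^ k" if "k \<ge> 0" for k
  proof -
    have "norm (t ^ k / fact k * kernel_power S G k x y) = \<bar>t\<bar> ^ k / fact k * \<bar>kernel_power S G k x y\<bar>"
      by (simp add: abs_mult power_abs)
    also have "\<dots> \<le> \<bar>t\<bar> ^ k / fact k * ?c ^ k"
      by (intro mult_left_mono kernel_power_bound assms) auto
    finally show ?thesis by (simp add: power_mult_distrib field_simps)
  qed
qed

lemma transition_function_sum:
  assumes "finite S"
  shows "(\<Sum>y\<in>S. transition_function S q t x y * h y) =
    (\<Sum>k. t ^ k / fact k * (\<Sum>y\<in>S. kernel_power S (generator S q) k x y * h y))"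
    and "summable (\<lambda>k. t ^ k / fact k * (\<Sum>y\<in>S. kernel_power S (generator S q) k x y * h y))"
proof -
  let ?K = "kernel_power S (generator S q)"
  have s: "summable (\<lambda>k. t ^ k / fact k * ?K k x y * h y)" if "y \<in> S" for y
    by (intro summable_mult2 summable_kernel_power assms that)
  have e: "t ^ k / fact k * (\<Sum>y\<in>S. ?K k x y * h y) = (\<Sum>y\<in>S. t ^ k / fact k * ?K k x y * h y)" for k
    by (simp add: sum_distrib_left mult_ac)
  show "summable (\<lambda>k. t ^ k / fact k * (\<Sum>y\<in>S. ?K k x y * h y))"
    unfolding e by (intro summable_sum s)
  have "(\<Sum>y\<in>S. transition_function S q t x y * h y) = (\<Sum>y\<in>S. \<Sum>k. t ^ k / fact k * ?K k x y * h y)"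
    unfolding transition_function_def
    by (intro sum.cong refl suminf_mult2 summable_kernel_power assms)
  also have "\<dots> = (\<Sum>k. \<Sum>y\<in>S. t ^ k / fact k * ?K k x y * h y)"
    by (intro suminf_sum[symmetric] s)
  finally show "(\<Sum>y\<in>S. transition_function S q t x y * h y) = (\<Sum>k. t ^ k / fact k * (\<Sum>y\<in>S. ?K k x y * h y))"
    unfolding e .
qed

lemma kernel_power_Suc_sum:
  "(\<Sum>y\<in>S. kernel_power S G (Suc k) x y * h y) = (\<Sum>z\<in>S. kernel_power S G k x z * (\<Sum>y\<in>S. G z y * h y))"
proof -
  have "(\<Sum>y\<in>S. kernel_power S G (Suc k) x y * h y) = (\<Sum>y\<in>S. \<Sum>z\<in>S. kernel_power S G k x z * G z y * h y)"
    by (simp add: sum_distrib_right)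
  also have "\<dots> = (\<Sum>z\<in>S. \<Sum>y\<in>S. kernel_power S G k x z * G z y * h y)" by (rule sum.swap)
  finally show ?thesis by (simp add: sum_distrib_left mult.assoc)
qed

text \<open>In the exponential series applied to \<open>h\<close>, every term of order at least 1
  contains the generator applied to \<open>h\<close> and vanishes. The constant \<open>h = 1\<close>
  gives total mass 1.\<close>

lemma transition_function_harmonic:
  assumes "finite S" "x \<in> S" "\<And>z. z \<in> S \<Longrightarrow> (\<Sum>y\<in>S. generator S q z y * h y) = 0"
  shows "(\<Sum>y\<in>S. transition_function S q t x y * h y) = h x"
proof -
  let ?f = "\<lambda>k. t ^ k / fact k * (\<Sum>y\<in>S. kernel_power S (generator S q) k x y * h y)"
  have "?f k = 0" if k: "k \<notin> {0}" for k
  proof -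
    obtain j where j: "k = Suc j" using k by (cases k) auto
    show ?thesis unfolding j kernel_power_Suc_sum using assms(3) by simp
  qed
  then have "(\<Sum>k. ?f k) = (\<Sum>k\<in>{0}. ?f k)" by (intro suminf_finite) auto
  also have "\<dots> = (\<Sum>y\<in>S. if y = x then h y else 0)"
    by (auto intro!: sum.cong)
  also have "\<dots> = h x" using assms(1,2) by simp
  finally show ?thesis by (simp only: transition_function_sum(1)[OF assms(1)])
qed

text \<open>Kolmogorov's forward equation tested against \<open>h\<close>, by termwise
  differentiation of an everywhere convergent power series in \<open>t\<close>.\<close>

lemma transition_function_has_derivative:
  assumes "finite S"
  shows "((\<lambda>t. \<Sum>y\<in>S. transition_function S q t x y * h y) has_field_derivative
     (\<Sum>z\<in>S. transition_function S q t x z * (\<Sum>y\<in>S. generator S q z y * h y))) (at t)"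
proof -
  let ?k = "\<lambda>h k. \<Sum>y\<in>S. kernel_power S (generator S q) k x y * h y"
  let ?Gh = "\<lambda>z. \<Sum>y\<in>S. generator S q z y * h y"
  define c where "c k = ?k h k / fact k" for k
  have u: "(\<Sum>y\<in>S. transition_function S q s x y * h y) = (\<Sum>k. c k * s ^ k)" for s
    unfolding transition_function_sum(1)[OF assms] c_def by (simp add: mult_ac)
  have sm: "summable (\<lambda>k. c k * s ^ k)" for s
    using transition_function_sum(2)[OF assms, of s q x h] by (simp add: c_def mult_ac)
  have d: "diffs c k = ?k ?Gh k / fact k" for k
  proof -
    have "diffs c k = real (Suc k) * (?k h (Suc k) / fact (Suc k))" by (simp add: diffs_def c_def)
    also have "\<dots> = ?k h (Suc k) / fact k"
    proof -
      have "real (Suc k) * (a / fact (Suc k)) = a / fact k" for a :: real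
        by (simp add: divide_simps)
      then show ?thesis .
    qed
    finally show ?thesis by (simp only: kernel_power_Suc_sum)
  qed
  have "((\<lambda>s. \<Sum>k. c k * s ^ k) has_field_derivative (\<Sum>k. diffs c k * t ^ k)) (at t)"
    by (rule termdiffs_strong_converges_everywhere[OF sm])
  moreover have "(\<Sum>k. diffs c k * t ^ k) = (\<Sum>z\<in>S. transition_function S q t x z * ?Gh z)"
    unfolding transition_function_sum(1)[OF assms] d by (simp add: mult_ac)
  ultimately show ?thesis unfolding u by simp
qed

lemma transition_function_absorbing:
  assumes "finite S" "x \<in> S" "y \<in> S" "\<And>z. z \<in> S \<Longrightarrow> generator S q x z = 0"
  shows "transition_function S q t x y = of_bool (x = y)"
proof -
  have K: "kernel_power S (generator S q) (Suc k) x z = 0" if "z \<in> S" for k z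
    using that
  proof (induct k arbitrary: z)
    case 0
    have "kernel_power S (generator S q) (Suc 0) x z = (\<Sum>w\<in>S. if w = x then generator S q w z else 0)"
      by (auto intro!: sum.cong)
    also have "\<dots> = generator S q x z" using assms(1,2) by simp
    finally show ?case using assms(4) 0 by simp
  next
    case (Suc k)
    show ?case unfolding kernel_power.simps(2)[of S _ "Suc k"] using Suc by (intro sum.neutral) auto
  qed
  have "transition_function S q t x y = (\<Sum>k\<in>{0}. t ^ k / fact k * kernel_power S (generator S q) k x y)"
    unfolding transition_function_def
  proof (rule suminf_finite)
    fix k :: nat assume "k \<notin> {0}"
    then obtain j where "k = Suc j" by (cases k) auto
    then show "t ^ k / fact k * kernel_power S (generator S q) k x y = 0"
      using K[OF assms(3), of j] by simp
  qed simp
  then show ?thesis by simp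
qed

section \<open>Path properties derived from the finite-dimensional distributions\<close>

context
  fixes M :: "'w measure" and S :: "'s set" and q :: "'s \<Rightarrow> 's \<Rightarrow> real" and x0 :: 's
    and X :: "real \<Rightarrow> 'w \<Rightarrow> 's"
  assumes mc: "markov_chain M S q x0 X" and S: "finite S" and x0: "x0 \<in> S"
begin

lemma chain_prob_space: "prob_space M"
  using mc by (simp add: markov_chain_def)

lemma chain_measurable: "t \<ge> 0 \<Longrightarrow> X t \<in> M \<rightarrow>\<^sub>M count_space UNIV"
  using mc by (simp add: markov_chain_def)

lemma chain_right_cont: "\<omega> \<in> space M \<Longrightarrow> t \<ge> 0 \<Longrightarrow> \<forall>\<^sub>F u in at_right t. X u \<omega> = X t \<omega>"
  using mc by (simp add: markov_chain_def)

lemma chain_fdd: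
  assumes "t 0 = 0" "\<And>i. i < k \<Longrightarrow> t i \<le> t (Suc i)" "\<And>i. i \<le> k \<Longrightarrow> x i \<in> S"
  shows "measure M {\<omega> \<in> space M. \<forall>i\<le>k. X (t i) \<omega> = x i} =
          of_bool (x 0 = x0) * (\<Prod>i<k. transition_function S q (t (Suc i) - t i) (x i) (x (Suc i)))"
proof -
  have "\<forall>(k :: nat) (t :: nat \<Rightarrow> real) x. t 0 = 0 \<longrightarrow> (\<forall>i<k. t i \<le> t (Suc i)) \<longrightarrow> (\<forall>i\<le>k. x i \<in> S) \<longrightarrow>
        measure M {\<omega> \<in> space M. \<forall>i\<le>k. X (t i) \<omega> = x i} =
          of_bool (x 0 = x0) * (\<Prod>i<k. transition_function S q (t (Suc i) - t i) (x i) (x (Suc i)))"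
    using mc unfolding markov_chain_def by (elim conjE)
  then show ?thesis using assms by simp
qed

lemma chain_pred [measurable]: "t \<ge> 0 \<Longrightarrow> Measurable.pred M (\<lambda>\<omega>. P (X t \<omega>))"
  by (rule measurable_compose[OF chain_measurable]) auto

lemma chain_start: "AE \<omega> in M. X 0 \<omega> = x0"
proof -
  interpret prob_space M by (rule chain_prob_space)
  have "prob {\<omega> \<in> space M. X 0 \<omega> = x0} = 1"
    using chain_fdd[of "\<lambda>_. 0" 0 "\<lambda>_. x0"] x0 by simp
  then show ?thesis by (subst (asm) prob_Collect_eq_1) auto
qed

text \<open>The finite-dimensional formula always prescribes the state at time 0. Adding
  \<open>X 0 = x0\<close> changes the event only by a null set.\<close>

lemma chain_prob:
  assumes "t \<ge> 0" "y \<in> S"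
  shows "measure M {\<omega> \<in> space M. X t \<omega> = y} = transition_function S q t x0 y"
proof -
  interpret prob_space M by (rule chain_prob_space)
  have "prob {\<omega> \<in> space M. X t \<omega> = y} = prob {\<omega> \<in> space M. \<forall>i\<le>Suc 0. X (if i = 0 then 0 else t) \<omega> = (if i = 0 then x0 else y)}"
  proof (rule finite_measure_eq_AE)
    show "AE \<omega> in M. \<omega> \<in> {\<omega> \<in> space M. X t \<omega> = y} \<longleftrightarrow>
      \<omega> \<in> {\<omega> \<in> space M. \<forall>i\<le>Suc 0. X (if i = 0 then 0 else t) \<omega> = (if i = 0 then x0 else y)}"
      using chain_start by eventually_elim (auto simp: le_Suc_eq)
    have "{\<omega> \<in> space M. \<forall>i\<le>Suc 0. X (if i = 0 then 0 else t) \<omega> = (if i = 0 then x0 else y)} =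
      {\<omega> \<in> space M. X 0 \<omega> = x0 \<and> X t \<omega> = y}" by (auto simp: le_Suc_eq)
    also have "\<dots> \<in> sets M" using assms by (intro predE pred_intros_logic chain_pred) simp_all
    finally show "{\<omega> \<in> space M. \<forall>i\<le>Suc 0. X (if i = 0 then 0 else t) \<omega> = (if i = 0 then x0 else y)} \<in> sets M" .
  qed (use assms in \<open>simp add: predE\<close>)
  also have "\<dots> = transition_function S q t x0 y"
    using chain_fdd[of "\<lambda>i. if i = 0 then 0 else t" "Suc 0" "\<lambda>i. if i = 0 then x0 else y"] assms x0 by simp
  finally show ?thesis .
qed

lemma transition_function_nonneg: "t \<ge> 0 \<Longrightarrow> y \<in> S \<Longrightarrow> 0 \<le> transition_function S q t x0 y"
  using chain_prob[of t y] measure_nonneg by metis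

lemma transition_function_total: "(\<Sum>y\<in>S. transition_function S q t x0 y) = 1"
  using transition_function_harmonic[OF S x0, of q "\<lambda>_. 1" t] sum_generator[OF S, of _ q "\<lambda>_. 1"] by simp

lemma chain_in_S:
  assumes "t \<ge> 0"
  shows "AE \<omega> in M. X t \<omega> \<in> S"
proof -
  interpret prob_space M by (rule chain_prob_space)
  have "{\<omega> \<in> space M. X t \<omega> \<in> S} = (\<Union>y\<in>S. {\<omega> \<in> space M. X t \<omega> = y})" by auto
  then have "prob {\<omega> \<in> space M. X t \<omega> \<in> S} = (\<Sum>y\<in>S. prob {\<omega> \<in> space M. X t \<omega> = y})"
    using S assms by (simp add: predE disjoint_family_on_def, subst finite_measure_finite_Union)
      (auto simp: disjoint_family_on_def predE image_subset_iff)
  also have "\<dots> = 1" using chain_prob[OF assms] transition_function_total by simp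
  finally show ?thesis by (subst (asm) prob_Collect_eq_1) (use assms in auto)
qed

lemma chain_expectation:
  assumes "t \<ge> 0"
  shows "integrable M (\<lambda>\<omega>. h (X t \<omega>))"
    and "(\<integral>\<omega>. h (X t \<omega>) \<partial>M) = (\<Sum>y\<in>S. transition_function S q t x0 y * (h y :: real))"
proof -
  interpret prob_space M by (rule chain_prob_space)
  let ?A = "\<lambda>y. {\<omega> \<in> space M. X t \<omega> = y}"
  have A: "?A y \<in> sets M" for y using assms by (simp add: predE)
  have m: "(\<lambda>\<omega>. h (X t \<omega>)) \<in> borel_measurable M"
    by (rule measurable_compose[OF chain_measurable[OF assms]]) simp
  have AE: "AE \<omega> in M. h (X t \<omega>) = (\<Sum>y\<in>S. h y * indicator (?A y) \<omega>)"
    using chain_in_S[OF assms] AE_space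
  proof eventually_elim
    case (elim \<omega>)
    have "(\<Sum>y\<in>S. h y * indicator (?A y) \<omega>) = (\<Sum>y\<in>S. if y = X t \<omega> then h y else 0)"
      using elim by (intro sum.cong) (auto simp: indicator_def)
    then show ?case using elim S by simp
  qed
  have i: "integrable M (\<lambda>\<omega>. \<Sum>y\<in>S. h y * indicator (?A y) \<omega>)"
    using A by (intro Bochner_Integration.integrable_sum integrable_mult_right integrable_real_indicator) (auto simp: emeasure_eq_measure)
  show "integrable M (\<lambda>\<omega>. h (X t \<omega>))"
    by (rule integrable_cong_AE_imp[OF i m]) (use AE in \<open>simp add: eq_commute\<close>)
  have "(\<integral>\<omega>. h (X t \<omega>) \<partial>M) = (\<integral>\<omega>. (\<Sum>y\<in>S. h y * indicator (?A y) \<omega>) \<partial>M)"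
    by (rule integral_cong_AE[OF m _ AE]) (use i in auto)
  also have "\<dots> = (\<Sum>y\<in>S. h y * prob (?A y))"
    using A by (subst Bochner_Integration.integral_sum) (auto intro!: integrable_mult_right integrable_real_indicator simp: emeasure_eq_measure)
  finally show "(\<integral>\<omega>. h (X t \<omega>) \<partial>M) = (\<Sum>y\<in>S. transition_function S q t x0 y * h y)"
    using chain_prob[OF assms] by (simp add: mult.commute)
qed

text \<open>From a state whose row of the generator is 0 the transition function is the identity, so
  each of the finitely many pairs of distinct states at the two times has probability 0.\<close>

lemma chain_absorbed:
  assumes "a \<ge> 0" "a \<le> b"
  shows "AE \<omega> in M. X a \<omega> \<in> S \<and> (\<forall>z\<in>S. generator S q (X a \<omega>) z = 0) \<longrightarrow> X b \<omega> = X a \<omega>"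
proof -
  interpret prob_space M by (rule chain_prob_space)
  have "AE \<omega> in M. \<forall>(x, y)\<in>{(x, y) \<in> S \<times> S. x \<noteq> y \<and> (\<forall>z\<in>S. generator S q x z = 0)}. \<not> (X a \<omega> = x \<and> X b \<omega> = y)"
  proof (rule AE_finite_allI)
    show "finite {(x, y) \<in> S \<times> S. x \<noteq> y \<and> (\<forall>z\<in>S. generator S q x z = 0)}"
      by (rule finite_subset[of _ "S \<times> S"]) (use S in auto)
    fix p assume "p \<in> {(x, y) \<in> S \<times> S. x \<noteq> y \<and> (\<forall>z\<in>S. generator S q x z = 0)}"
    then obtain x y where p: "p = (x, y)" "x \<in> S" "y \<in> S" "x \<noteq> y" "\<And>z. z \<in> S \<Longrightarrow> generator S q x z = 0" by auto
    let ?t = "\<lambda>i::nat. if i = 0 then 0 else if i = 1 then a else b"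
    let ?x = "\<lambda>i::nat. if i = 0 then x0 else if i = 1 then x else y"
    have "prob {\<omega> \<in> space M. \<forall>i\<le>2. X (?t i) \<omega> = ?x i} = 0"
      using chain_fdd[of ?t 2 ?x] assms p x0 transition_function_absorbing[OF S p(2,3,5)]
      by (auto simp: numeral_2_eq_2 less_Suc_eq)
    moreover have set: "{\<omega> \<in> space M. \<forall>i\<le>2. X (?t i) \<omega> = ?x i} = {\<omega> \<in> space M. X 0 \<omega> = x0 \<and> X a \<omega> = x \<and> X b \<omega> = y}"
      by (auto simp: numeral_2_eq_2 le_Suc_eq)
    ultimately have "prob {\<omega> \<in> space M. X 0 \<omega> = x0 \<and> X a \<omega> = x \<and> X b \<omega> = y} = 0" by simp
    moreover have "{\<omega> \<in> space M. X 0 \<omega> = x0 \<and> X a \<omega> = x \<and> X b \<omega> = y} \<in> sets M"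
      using assms by (intro predE pred_intros_logic chain_pred) simp_all
    ultimately have "AE \<omega> in M. \<not> (X 0 \<omega> = x0 \<and> X a \<omega> = x \<and> X b \<omega> = y)"
      by (intro AE_I'[of "{\<omega> \<in> space M. X 0 \<omega> = x0 \<and> X a \<omega> = x \<and> X b \<omega> = y}"])
        (auto simp: null_sets_def emeasure_eq_measure)
    with chain_start show "AE \<omega> in M. case p of (x, y) \<Rightarrow> \<not> (X a \<omega> = x \<and> X b \<omega> = y)"
      by eventually_elim (auto simp: p(1))
  qed
  moreover have "AE \<omega> in M. X b \<omega> \<in> S" using assms by (intro chain_in_S) simp
  ultimately show ?thesis
  proof eventually_elim
    case (elim \<omega>)
    show ?case
    proof (intro impI, rule ccontr)
      assume a: "X a \<omega> \<in> S \<and> (\<forall>z\<in>S. generator S q (X a \<omega>) z = 0)" and ne: "X b \<omega> \<noteq> X a \<omega>"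
      then have "(X a \<omega>, X b \<omega>) \<in> {(x, y) \<in> S \<times> S. x \<noteq> y \<and> (\<forall>z\<in>S. generator S q x z = 0)}"
        using elim by auto
      from bspec[OF elim(1) this] show False by simp
    qed
  qed
qed

lemma right_cont_rational:
  assumes "\<omega> \<in> space M" "t \<ge> 0"
  shows "\<exists>p::rat. t < of_rat p \<and> X (of_rat p) \<omega> = X t \<omega>"
proof -
  obtain b where b: "b > t" "\<And>u. t < u \<Longrightarrow> u < b \<Longrightarrow> X u \<omega> = X t \<omega>"
    using chain_right_cont[OF assms] unfolding eventually_at_right_field by auto
  obtain p where "t < of_rat p" "of_rat p < b" using of_rat_dense[OF b(1)] by auto
  then show ?thesis using b by blast
qed

text \<open>\<open>chain_absorbed\<close> gives a null set for each pair of times. Taking rational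
  times keeps their union null, and right-continuity carries the statement to all real
  times.\<close>

lemma chain_absorbed_forever:
  "AE \<omega> in M. \<forall>n::nat. X (real n) \<omega> \<in> S \<and> (\<forall>z\<in>S. generator S q (X (real n) \<omega>) z = 0) \<longrightarrow>
     (\<forall>t\<ge>real n. X t \<omega> = X (real n) \<omega>)"
proof -
  have "AE \<omega> in M. \<forall>n::nat. \<forall>p::rat. real n \<le> of_rat p \<longrightarrow>
     X (real n) \<omega> \<in> S \<and> (\<forall>z\<in>S. generator S q (X (real n) \<omega>) z = 0) \<longrightarrow> X (of_rat p) \<omega> = X (real n) \<omega>"
    unfolding AE_all_countable
  proof (intro allI)
    fix n :: nat and p :: rat
    show "AE \<omega> in M. real n \<le> of_rat p \<longrightarrow>
       X (real n) \<omega> \<in> S \<and> (\<forall>z\<in>S. generator S q (X (real n) \<omega>) z = 0) \<longrightarrow> X (of_rat p) \<omega> = X (real n) \<omega>"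
    proof (cases "real n \<le> of_rat p")
      case True
      from chain_absorbed[OF _ this] show ?thesis by simp
    qed simp
  qed
  with AE_space show ?thesis
  proof eventually_elim
    case (elim \<omega>)
    show ?case
    proof (intro allI impI)
      fix n t assume a: "X (real n) \<omega> \<in> S \<and> (\<forall>z\<in>S. generator S q (X (real n) \<omega>) z = 0)" and t: "t \<ge> real n"
      obtain p where p: "t < of_rat p" "X (of_rat p) \<omega> = X t \<omega>"
        using right_cont_rational[OF elim(1), of t] t by auto
      then have "real n \<le> of_rat p" using t by simp
      then show "X t \<omega> = X (real n) \<omega>" using elim(2) a p by metis
    qed
  qed
qed

text \<open>For measurability, a quantification over real times has to become countable.
  Right-continuity allows it: every value of the path is also taken at a rational time shortly
  afterwards.\<close>

lemma eventually_at_top_iff_rat: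
  assumes "\<omega> \<in> space M"
  shows "(\<forall>\<^sub>F t in at_top. P (X t \<omega>)) \<longleftrightarrow> (\<exists>n::nat. \<forall>p::rat. real n \<le> of_rat p \<longrightarrow> P (X (of_rat p) \<omega>))"
proof
  assume "\<forall>\<^sub>F t in at_top. P (X t \<omega>)"
  then obtain T where T: "\<And>t. t \<ge> T \<Longrightarrow> P (X t \<omega>)" by (auto simp: eventually_at_top_linorder)
  obtain n :: nat where "T \<le> real n" using real_arch_simple by blast
  then show "\<exists>n::nat. \<forall>p::rat. real n \<le> of_rat p \<longrightarrow> P (X (of_rat p) \<omega>)"
    using T order_trans by blast
next
  assume "\<exists>n::nat. \<forall>p::rat. real n \<le> of_rat p \<longrightarrow> P (X (of_rat p) \<omega>)"
  then obtain n :: nat where n: "\<And>p::rat. real n \<le> of_rat p \<Longrightarrow> P (X (of_rat p) \<omega>)" by blast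
  show "\<forall>\<^sub>F t in at_top. P (X t \<omega>)"
    unfolding eventually_at_top_linorder
  proof (intro exI allI impI)
    fix t assume t: "real n \<le> t"
    obtain p where p: "t < of_rat p" "X (of_rat p) \<omega> = X t \<omega>"
      using right_cont_rational[OF assms, of t] t by auto
    then show "P (X t \<omega>)" using n[of p] t by simp
  qed
qed

lemma eventually_pred:
  "Measurable.pred M (\<lambda>\<omega>. \<forall>\<^sub>F t in at_top. P (X t \<omega>))"
proof -
  have "Measurable.pred M (\<lambda>\<omega>. \<exists>n::nat. \<forall>p::rat. real n \<le> of_rat p \<longrightarrow> P (X (of_rat p) \<omega>))"
  proof (intro pred_intros_countable)
    fix n :: nat and p :: rat
    show "Measurable.pred M (\<lambda>\<omega>. real n \<le> of_rat p \<longrightarrow> P (X (of_rat p) \<omega>))"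
    proof (cases "real n \<le> of_rat p")
      case True
      then have "(of_rat p :: real) \<ge> 0" by (meson of_nat_0_le_iff order_trans)
      from chain_pred[OF this, of P] show ?thesis using True by simp
    qed simp
  qed
  then show ?thesis
    by (rule iffD2[OF measurable_cong, rotated]) (rule eventually_at_top_iff_rat)
qed

end

subsection \<open>Fire dynamics on a fixed graph\<close>

lemma inflammable_cluster_eq: "inflammable_cluster E s e = cluster (inflammable_edges E s) e"
  by (simp add: inflammable_cluster_def cluster_def)

text \<open>The vertex argument of \<open>psi\<close> belonging to a configuration. When no edge is
  inflammable any more, these are exactly the fireproof vertices of \<open>V\<close>.\<close>

definition unburnt :: "'v set \<Rightarrow> 'v set set \<Rightarrow> ('v set \<Rightarrow> edge_state) \<Rightarrow> 'v set" where
  "unburnt V E s = {v\<in>V. \<forall>e\<in>E. v \<in> e \<longrightarrow> s e \<noteq> Burnt}"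

definition fireproof_count ::
    "'v set \<Rightarrow> 'v set set \<Rightarrow> (real \<Rightarrow> 'w \<Rightarrow> 'v set \<Rightarrow> edge_state) \<Rightarrow> 'w \<Rightarrow> nat" where
  "fireproof_count V E X \<omega> = card {i\<in>V. fireproof_vertex E (\<lambda>t. X t \<omega>) i}"

lemma fireproof_count_le: "finite V \<Longrightarrow> fireproof_count V E X \<omega> \<le> card V"
  unfolding fireproof_count_def by (intro card_mono) auto

lemma finite_configurations:
  assumes "finite E"
  shows "finite (configurations E)"
proof -
  have "UNIV = {Inflammable, Fireproof, Burnt}" using edge_state.exhaust by auto
  then have "finite (UNIV :: edge_state set)" by (metis finite.emptyI finite.insertI)
  then show ?thesis unfolding configurations_def using assms by (intro finite_PiE) auto
qed

context
  fixes V :: "'v set" and E :: "'v set set" and r :: real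
  assumes V: "finite V" and E: "finite E" and r: "r \<ge> 0"
begin

lemma inflammable_finite: "finite (inflammable_edges E s)"
  using E by (simp add: inflammable_edges_def)

lemma fire_cluster_subset: "e \<in> inflammable_edges E s \<Longrightarrow> inflammable_cluster E s e \<subseteq> inflammable_edges E s"
  unfolding inflammable_cluster_eq by (rule cluster_subset)

lemma fire_update_in:
  assumes "s \<in> configurations E" "e \<in> inflammable_edges E s"
  shows "s(e := Fireproof) \<in> configurations E" "set_on_fire E s e \<in> configurations E"
proof -
  have e: "e \<in> E" using assms(2) by (simp add: inflammable_edges_def)
  show "s(e := Fireproof) \<in> configurations E"
    using assms(1) e unfolding configurations_def by (auto simp: PiE_iff extensional_def)
  have "inflammable_cluster E s e \<subseteq> E"
    using fire_cluster_subset[OF assms(2)] by (auto simp: inflammable_edges_def)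
  then show "set_on_fire E s e \<in> configurations E"
    using assms(1) unfolding configurations_def set_on_fire_def by (auto simp: PiE_iff extensional_def)
qed

lemma inflammable_fireproof: "inflammable_edges E (s(e := Fireproof)) = inflammable_edges E s - {e}"
  by (auto simp: inflammable_edges_def)

lemma inflammable_fire:
  "inflammable_edges E (set_on_fire E s e) = inflammable_edges E s - inflammable_cluster E s e"
  by (auto simp: inflammable_edges_def set_on_fire_def)

lemma unburnt_fireproof:
  "e \<in> inflammable_edges E s \<Longrightarrow> unburnt V E (s(e := Fireproof)) = unburnt V E s"
  by (auto simp: unburnt_def inflammable_edges_def)

lemma unburnt_fire:
  assumes "e \<in> inflammable_edges E s"
  shows "unburnt V E (set_on_fire E s e) = unburnt V E s - \<Union>(inflammable_cluster E s e)"
proof -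
  have "inflammable_cluster E s e \<subseteq> E"
    using fire_cluster_subset[OF assms] by (auto simp: inflammable_edges_def)
  then show ?thesis unfolding unburnt_def set_on_fire_def by auto
qed

text \<open>\<open>fire_rate\<close> adds up the rates of events leading to the same configuration.
  Testing against \<open>h\<close> and exchanging the sums undoes this grouping, so that one can
  compute edge by edge.\<close>

lemma generator_fire:
  assumes s: "s \<in> configurations E"
  shows "(\<Sum>y\<in>configurations E. generator (configurations E) (fire_rate E r) s y * h y) =
    (\<Sum>e\<in>inflammable_edges E s. (h (s(e := Fireproof)) - h s) + r * (h (set_on_fire E s e) - h s))"
proof -
  let ?S = "configurations E" and ?I = "inflammable_edges E s"
  note fS = finite_configurations[OF E]
  have "(\<Sum>y\<in>?S. generator ?S (fire_rate E r) s y * h y) = (\<Sum>y\<in>?S. fire_rate E r s y * (h y - h s))"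
    by (rule sum_generator[OF fS s])
  also have "\<dots> = (\<Sum>y\<in>?S. \<Sum>e\<in>?I. (if y = s(e := Fireproof) then h y - h s else 0) +
      (if y = set_on_fire E s e then r * (h y - h s) else 0))"
    unfolding fire_rate_def sum_distrib_right by (intro sum.cong refl) (auto simp: algebra_simps)
  also have "\<dots> = (\<Sum>e\<in>?I. \<Sum>y\<in>?S. (if y = s(e := Fireproof) then h y - h s else 0) +
      (if y = set_on_fire E s e then r * (h y - h s) else 0))"
    by (rule sum.swap)
  also have "\<dots> = (\<Sum>e\<in>?I. (h (s(e := Fireproof)) - h s) + r * (h (set_on_fire E s e) - h s))"
    using fire_update_in[OF s] fS by (intro sum.cong refl) (simp add: sum.distrib)
  finally show ?thesis .
qed

definition fire_potential :: "nat \<Rightarrow> ('v set \<Rightarrow> edge_state) \<Rightarrow> real" where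
  "fire_potential k s = psi r k (unburnt V E s) (inflammable_edges E s)"

text \<open>Harmonicity is the recursion \<open>psi_rec\<close> for the current inflammable edges:
  each event at an edge changes the two arguments of \<open>psi\<close> exactly as in the
  recursion.\<close>

lemma fire_potential_harmonic:
  assumes "s \<in> configurations E"
  shows "(\<Sum>y\<in>configurations E. generator (configurations E) (fire_rate E r) s y * fire_potential k y) = 0"
proof -
  let ?I = "inflammable_edges E s" and ?h = "fire_potential k"
  have "(\<Sum>y\<in>configurations E. generator (configurations E) (fire_rate E r) s y * ?h y) =
    (\<Sum>e\<in>?I. (?h (s(e := Fireproof)) + r * ?h (set_on_fire E s e)) - (1 + r) * ?h s)"
    unfolding generator_fire[OF assms] by (intro sum.cong refl) (simp add: algebra_simps)
  also have "\<dots> = (\<Sum>e\<in>?I. psi r k (unburnt V E s) (?I - {e}) +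
      r * psi r k (unburnt V E s - \<Union>(cluster ?I e)) (?I - cluster ?I e)) - (1 + r) * real (card ?I) * ?h s"
    by (simp add: sum_subtractf fire_potential_def inflammable_fireproof inflammable_fire
        unburnt_fireproof unburnt_fire inflammable_cluster_eq)
  also have "\<dots> = 0"
    using psi_rec[OF inflammable_finite r, of s k "unburnt V E s"] by (simp add: fire_potential_def)
  finally show ?thesis .
qed

text \<open>A Lyapunov bound: each inflammable edge turns fireproof at rate 1, which lowers the
  count by 1, and fires can only lower it further.\<close>

lemma inflammable_count_decreasing:
  assumes "s \<in> configurations E"
  shows "(\<Sum>y\<in>configurations E. generator (configurations E) (fire_rate E r) s y * real (card (inflammable_edges E y)))
    \<le> - real (card (inflammable_edges E s))"
proof -
  let ?I = "inflammable_edges E s"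
  have "(\<Sum>y\<in>configurations E. generator (configurations E) (fire_rate E r) s y * real (card (inflammable_edges E y))) \<le>
     (\<Sum>e\<in>?I. - 1)"
    unfolding generator_fire[OF assms]
  proof (rule sum_mono)
    fix e assume e: "e \<in> ?I"
    have "card (?I - inflammable_cluster E s e) \<le> card ?I"
      by (intro card_mono inflammable_finite) auto
    then have "r * (real (card (?I - inflammable_cluster E s e)) - real (card ?I)) \<le> 0"
      using r by (simp add: mult_nonneg_nonpos)
    moreover have "card ?I > 0" using e inflammable_finite card_gt_0_iff by blast
    then have "real (card (?I - {e})) = real (card ?I) - 1"
      using e inflammable_finite by (simp add: of_nat_diff)
    ultimately show "real (card (inflammable_edges E (s(e := Fireproof)))) - real (card ?I) +
      r * (real (card (inflammable_edges E (set_on_fire E s e))) - real (card ?I)) \<le> - 1"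
      unfolding inflammable_fireproof inflammable_fire by linarith
  qed
  then show ?thesis by simp
qed

lemma generator_terminal:
  assumes "s \<in> configurations E" "inflammable_edges E s = {}"
  shows "generator (configurations E) (fire_rate E r) s z = 0"
proof -
  have "fire_rate E r s y = 0" for y using assms(2) by (simp add: fire_rate_def)
  then show ?thesis by (auto simp: generator_def)
qed

section \<open>Expectation of the terminal count\<close>

context
  fixes M :: "'w measure" and X
  assumes fd: "fire_dynamics M E r X"
begin

abbreviation initial :: "'v set \<Rightarrow> edge_state" where "initial \<equiv> \<lambda>e\<in>E. Inflammable"

lemma fire_chain: "markov_chain M (configurations E) (fire_rate E r) initial X"
  using fd by (simp add: fire_dynamics_def)

lemma initial_in: "initial \<in> configurations E"
  by (simp add: configurations_def)

lemmas chain_facts = fire_chain finite_configurations[OF E] initial_in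

text \<open>Gronwall's argument: by the Lyapunov bound the expected count \<open>u\<close> satisfies
  \<open>u' \<le> - u\<close>, so \<open>exp t * u t\<close> is nonincreasing, and at time 0 all
  edges are inflammable. By Markov's inequality the chain is terminal up to an exponentially small
  probability.\<close>

lemma inflammable_count_decay:
  assumes "t \<ge> 0"
  shows "(\<integral>\<omega>. real (card (inflammable_edges E (X t \<omega>))) \<partial>M) \<le> real (card E) * exp (- t)"
proof -
  let ?S = "configurations E"
  let ?P = "transition_function ?S (fire_rate E r)"
  let ?N = "\<lambda>y. real (card (inflammable_edges E y))"
  define u where "u t = (\<Sum>y\<in>?S. ?P t initial y * ?N y)" for t
  define u' where "u' t = (\<Sum>z\<in>?S. ?P t initial z * (\<Sum>y\<in>?S. generator ?S (fire_rate E r) z y * ?N y))" for t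
  have E': "(\<integral>\<omega>. ?N (X t \<omega>) \<partial>M) = u t" if "t \<ge> 0" for t
    unfolding u_def by (rule chain_expectation(2)[OF chain_facts that])
  have der: "(u has_field_derivative u' t) (at t)" for t
    unfolding u_def[abs_def] u'_def
    by (rule transition_function_has_derivative[OF finite_configurations[OF E]])
  have le: "u' t \<le> - u t" if "t \<ge> 0" for t
  proof -
    have "u' t \<le> (\<Sum>z\<in>?S. ?P t initial z * (- ?N z))"
      unfolding u'_def
      by (intro sum_mono mult_left_mono inflammable_count_decreasing transition_function_nonneg[OF chain_facts that])
    then show ?thesis by (simp add: u_def sum_negf)
  qed
  have "exp t * u t \<le> exp 0 * u 0"
  proof (rule DERIV_nonpos_imp_nonincreasing[OF assms])
    fix s :: real assume s: "0 \<le> s" "s \<le> t"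
    have "((\<lambda>s. exp s * u s) has_field_derivative (exp s * u s + u' s * exp s)) (at s)"
      using DERIV_mult[OF DERIV_exp der] by simp
    moreover have "exp s * u s + u' s * exp s = exp s * (u s + u' s)" by (simp add: algebra_simps)
    moreover have "exp s * (u s + u' s) \<le> 0" using le[OF s(1)] by (intro mult_nonneg_nonpos) auto
    ultimately show "\<exists>y. ((\<lambda>s. exp s * u s) has_real_derivative y) (at s) \<and> y \<le> 0" by metis
  qed
  also have "u 0 = (\<integral>\<omega>. ?N (X 0 \<omega>) \<partial>M)" by (simp add: E')
  also have "\<dots> = (\<integral>\<omega>. ?N initial \<partial>M)"
  proof (rule integral_cong_AE)
    show "(\<lambda>\<omega>. ?N (X 0 \<omega>)) \<in> borel_measurable M"
      by (rule measurable_compose[OF chain_measurable[OF chain_facts]]) simp_all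
    show "AE \<omega> in M. ?N (X 0 \<omega>) = ?N initial"
      using chain_start[OF chain_facts] by eventually_elim simp
  qed simp
  also have "\<dots> = real (card E)"
  proof -
    interpret prob_space M by (rule chain_prob_space[OF chain_facts])
    have "inflammable_edges E initial = E" by (auto simp: inflammable_edges_def)
    then show ?thesis by (simp add: prob_space)
  qed
  finally have "exp t * u t \<le> real (card E)" by simp
  then have "exp (- t) * (exp t * u t) \<le> exp (- t) * real (card E)" by (intro mult_left_mono) auto
  then show ?thesis unfolding E'[OF assms] by (simp add: mult.assoc[symmetric] mult.commute flip: exp_add)
qed

lemma fireproof_count_measurable: "fireproof_count V E X \<in> M \<rightarrow>\<^sub>M count_space UNIV"
proof -
  have p: "Measurable.pred M (\<lambda>\<omega>. fireproof_vertex E (\<lambda>t. X t \<omega>) i)" for i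
    unfolding fireproof_vertex_def
  proof (intro pred_intros_finite E)
    fix e
    show "Measurable.pred M (\<lambda>\<omega>. i \<in> e \<longrightarrow> (\<forall>\<^sub>F t in at_top. X t \<omega> e = Fireproof))"
      using eventually_pred[OF chain_facts, of "\<lambda>s. s e = Fireproof"] by (cases "i \<in> e") simp_all
  qed
  have "real (fireproof_count V E X \<omega>) = (\<Sum>i\<in>V. if fireproof_vertex E (\<lambda>t. X t \<omega>) i then 1 else 0)" for \<omega>
    unfolding fireproof_count_def card_eq_sum of_nat_sum of_nat_1 by (rule sum.inter_filter[OF V])
  then have "(\<lambda>\<omega>. real (fireproof_count V E X \<omega>)) =
      (\<lambda>\<omega>. \<Sum>i\<in>V. if fireproof_vertex E (\<lambda>t. X t \<omega>) i then 1 else 0)" by (rule ext)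
  also have "\<dots> \<in> borel_measurable M"
    using p by (intro borel_measurable_sum measurable_If) (auto simp: pred_def)
  finally have "(\<lambda>\<omega>. real (fireproof_count V E X \<omega>)) \<in> borel_measurable M" .
  \<comment> \<open>Measurability is available for real-valued sums of indicators; rounding brings
    the count back to the discrete space of natural numbers.\<close>
  then have "(\<lambda>\<omega>. \<lfloor>real (fireproof_count V E X \<omega>)\<rfloor>) \<in> M \<rightarrow>\<^sub>M count_space UNIV"
    by (rule measurable_compose[OF _ measurable_real_floor])
  then have "(\<lambda>\<omega>. nat \<lfloor>real (fireproof_count V E X \<omega>)\<rfloor>) \<in> M \<rightarrow>\<^sub>M count_space UNIV"
    by (rule measurable_compose) simp
  then show ?thesis by simp
qed

text \<open>A state without inflammable edges is absorbing, so the eventual state of each edge can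
  be read off at the integer time \<open>n\<close>. There fireproof means unburnt, and
  \<open>psi\<close> without edges is the binomial.\<close>

lemma terminal_value:
  "AE \<omega> in M. \<forall>n::nat. X (real n) \<omega> \<in> configurations E \<and> inflammable_edges E (X (real n) \<omega>) = {} \<longrightarrow>
     real (fireproof_count V E X \<omega> choose k) = fire_potential k (X (real n) \<omega>)"
  using chain_absorbed_forever[OF chain_facts]
proof eventually_elim
  case (elim \<omega>)
  show ?case
  proof (intro allI impI)
    fix n :: nat
    assume a: "X (real n) \<omega> \<in> configurations E \<and> inflammable_edges E (X (real n) \<omega>) = {}"
    let ?s = "X (real n) \<omega>"
    have const: "X t \<omega> = ?s" if "t \<ge> real n" for t
      using elim a generator_terminal that by blast
    have ev: "(\<forall>\<^sub>F t in at_top. X t \<omega> e = Fireproof) \<longleftrightarrow> ?s e \<noteq> Burnt" if e: "e \<in> E" for e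
    proof -
      have "?s e \<noteq> Inflammable" using a e by (auto simp: inflammable_edges_def)
      moreover have "(\<forall>\<^sub>F t in at_top. X t \<omega> e = Fireproof) \<longleftrightarrow> ?s e = Fireproof"
      proof
        assume "\<forall>\<^sub>F t in at_top. X t \<omega> e = Fireproof"
        then have "\<forall>\<^sub>F t in at_top. X t \<omega> e = Fireproof \<and> t \<ge> real n"
          using eventually_ge_at_top by (rule eventually_conj)
        then obtain t where "X t \<omega> e = Fireproof" "t \<ge> real n"
          using eventually_happens'[OF trivial_limit_at_top_linorder] by blast
        then show "?s e = Fireproof" using const[of t] by metis
      next
        assume se: "?s e = Fireproof"
        show "\<forall>\<^sub>F t in at_top. X t \<omega> e = Fireproof"
          using eventually_ge_at_top[of "real n"]
        proof eventually_elim
          case (elim t)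
          show ?case using const[OF elim] se by metis
        qed
      qed
      ultimately show ?thesis by (cases "?s e") auto
    qed
    have "{i\<in>V. fireproof_vertex E (\<lambda>t. X t \<omega>) i} = unburnt V E ?s"
      using ev by (auto simp: unburnt_def fireproof_vertex_def)
    then show "real (fireproof_count V E X \<omega> choose k) = fire_potential k ?s"
      using a by (simp add: fireproof_count_def fire_potential_def)
  qed
qed

text \<open>The potential has the same expectation at all times, namely its initial value
  \<open>psi r k V E\<close>. At time \<open>n\<close> it differs from the terminal binomial only if
  an edge is still inflammable, and that contribution decays like \<open>exp (- n)\<close>.\<close>

lemma fireproof_factorial_moment:
  "(\<integral>\<omega>. real (fireproof_count V E X \<omega> choose k) \<partial>M) = psi r k V E"
proof -
  interpret prob_space M by (rule chain_prob_space[OF chain_facts])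
  let ?S = "configurations E"
  let ?F = "\<lambda>\<omega>. real (fireproof_count V E X \<omega> choose k)"
  let ?h = "fire_potential k"
  let ?N = "\<lambda>y. real (card (inflammable_edges E y))"
  \<comment> \<open>\<open>B\<close> dominates the binomial and the potential together. Hence their
    difference is at most \<open>B\<close> times the number of inflammable edges: it is 0 if there
    are none, and the number is at least 1 otherwise.\<close>
  define B where "B = real (card V choose k) + (\<Sum>y\<in>?S. \<bar>?h y\<bar>)"
  have Fm: "?F \<in> borel_measurable M"
    by (rule measurable_compose[OF fireproof_count_measurable]) simp
  have Fb: "\<bar>?F \<omega>\<bar> \<le> real (card V choose k)" for \<omega>
    using binomial_right_mono[OF fireproof_count_le[OF V], of E X \<omega> k] by simp
  have Fi: "integrable M ?F"
    by (rule integrable_const_bound[of _ "real (card V choose k)"]) (use Fm Fb in auto)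
  have hb: "\<bar>?h y\<bar> \<le> (\<Sum>y\<in>?S. \<bar>?h y\<bar>)" if "y \<in> ?S" for y
    using finite_configurations[OF E] that by (intro member_le_sum) auto
  have start: "?h initial = psi r k V E"
  proof -
    have "inflammable_edges E initial = E" "unburnt V E initial = V"
      by (auto simp: inflammable_edges_def unburnt_def)
    then show ?thesis by (simp add: fire_potential_def)
  qed
  have bound: "\<bar>(\<integral>\<omega>. ?F \<omega> \<partial>M) - psi r k V E\<bar> \<le> B * (real (card E) * exp (- real n))" for n :: nat
  proof -
    note hi = chain_expectation[OF chain_facts, of "real n" ?h]
    note Ni = chain_expectation(1)[OF chain_facts, of "real n" ?N]
    have eh: "(\<integral>\<omega>. ?h (X (real n) \<omega>) \<partial>M) = psi r k V E"
      using hi(2) transition_function_harmonic[OF finite_configurations[OF E] initial_in fire_potential_harmonic]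
      by (simp add: start)
    have "\<bar>(\<integral>\<omega>. ?F \<omega> \<partial>M) - psi r k V E\<bar> = \<bar>\<integral>\<omega>. ?F \<omega> - ?h (X (real n) \<omega>) \<partial>M\<bar>"
      using Fi hi(1) eh by (subst Bochner_Integration.integral_diff) auto
    also have "\<dots> \<le> (\<integral>\<omega>. \<bar>?F \<omega> - ?h (X (real n) \<omega>)\<bar> \<partial>M)"
      by (rule integral_abs_bound)
    also have "\<dots> \<le> (\<integral>\<omega>. B * ?N (X (real n) \<omega>) \<partial>M)"
    proof (rule integral_mono_AE)
      show "integrable M (\<lambda>\<omega>. \<bar>?F \<omega> - ?h (X (real n) \<omega>)\<bar>)"
        using Fi hi(1) by (intro integrable_abs Bochner_Integration.integrable_diff) auto
      show "integrable M (\<lambda>\<omega>. B * ?N (X (real n) \<omega>))" using Ni by (intro integrable_mult_right) auto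
      have "AE \<omega> in M. X (real n) \<omega> \<in> ?S" by (rule chain_in_S[OF chain_facts]) simp
      with terminal_value[of k] show "AE \<omega> in M. \<bar>?F \<omega> - ?h (X (real n) \<omega>)\<bar> \<le> B * ?N (X (real n) \<omega>)"
      proof eventually_elim
        case (elim \<omega>)
        have B0: "B \<ge> 0" by (simp add: B_def sum_nonneg)
        show ?case
        proof (cases "inflammable_edges E (X (real n) \<omega>) = {}")
          case True
          then show ?thesis using elim by simp
        next
          case False
          then have "card (inflammable_edges E (X (real n) \<omega>)) > 0"
            using inflammable_finite by (simp add: card_gt_0_iff)
          then have "1 \<le> ?N (X (real n) \<omega>)" by simp
          then have "B * 1 \<le> B * ?N (X (real n) \<omega>)" using B0 by (intro mult_left_mono)
          moreover have "\<bar>?F \<omega> - ?h (X (real n) \<omega>)\<bar> \<le> B"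
            unfolding B_def using Fb[of \<omega>] hb[OF elim(2)] by linarith
          ultimately show ?thesis by linarith
        qed
      qed
    qed
    also have "\<dots> = B * (\<integral>\<omega>. ?N (X (real n) \<omega>) \<partial>M)" by simp
    also have "\<dots> \<le> B * (real (card E) * exp (- real n))"
      by (intro mult_left_mono inflammable_count_decay) (auto simp: B_def sum_nonneg)
    finally show ?thesis .
  qed
  have "(\<lambda>n. B * (real (card E) * exp (- real n))) \<longlonglongrightarrow> B * (real (card E) * 0)"
    by (intro tendsto_intros filterlim_compose[OF exp_at_bot]
        filterlim_compose[OF filterlim_uminus_at_bot_at_top filterlim_real_sequentially])
  then have "\<bar>(\<integral>\<omega>. ?F \<omega> \<partial>M) - psi r k V E\<bar> \<le> B * (real (card E) * 0)"
    by (rule LIMSEQ_le_const) (use bound in auto)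
  then show ?thesis by simp
qed

end

end

subsection \<open>The limit law\<close>

text \<open>Once the lower coefficients are known to vanish, division by \<open>t ^ m\<close> leaves
  \<open>d m\<close> plus a tail bounded by the geometric sum \<open>t / (1 - t)\<close>, and
  \<open>t\<close> tends to 0 from the right.\<close>

lemma power_series_unique_0:
  fixes d :: "nat \<Rightarrow> real"
  assumes b: "\<And>j. \<bar>d j\<bar> \<le> 1" and s: "\<And>t. 0 < t \<Longrightarrow> t < 1 \<Longrightarrow> (\<lambda>j. d j * t ^ j) sums 0"
  shows "d m = 0"
proof (induct m rule: less_induct)
  case (less m)
  have le: "\<bar>d m\<bar> \<le> t / (1 - t)" if t: "0 < t" "t < 1" for t
  proof -
    have "(\<lambda>j. d (j + m) * t ^ (j + m)) sums (0 - (\<Sum>j<m. d j * t ^ j))"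
      using s[OF t] sums_iff_shift[of "\<lambda>j. d j * t ^ j" m] by simp
    then have "(\<lambda>j. d (j + m) * t ^ (j + m)) sums 0" using less by simp
    then have "(\<lambda>j. d (j + m) * t ^ (j + m) / t ^ m) sums (0 / t ^ m)" by (rule sums_divide)
    then have "(\<lambda>j. d (j + m) * t ^ j) sums 0" using t by (simp add: power_add)
    then have "(\<lambda>j. d (Suc j + m) * t ^ Suc j) sums (0 - d m)"
      using sums_Suc_iff[of "\<lambda>j. d (j + m) * t ^ j" "- d m"] by simp
    then have 1: "(\<lambda>j. d (Suc j + m) * t ^ Suc j) sums (- d m)" by simp
    have 2: "(\<lambda>j. t * t ^ j) sums (t * (1 / (1 - t)))"
      using t by (intro sums_mult geometric_sums) auto
    have "\<bar>d (Suc j + m) * t ^ Suc j\<bar> \<le> t * t ^ j" for j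
      using b[of "Suc j + m"] t by (simp add: abs_mult mult_left_le_one_le)
    then have bnd: "d (Suc j + m) * t ^ Suc j \<le> t * t ^ j" "- (t * t ^ j) \<le> d (Suc j + m) * t ^ Suc j" for j
      unfolding abs_le_iff by (simp_all add: minus_le_iff)
    have "- d m \<le> t * (1 / (1 - t))" by (rule sums_le[OF bnd(1) 1 2])
    moreover have "- (t * (1 / (1 - t))) \<le> - d m" by (rule sums_le[OF bnd(2) sums_minus[OF 2] 1])
    ultimately show ?thesis by (simp add: abs_le_iff)
  qed
  have "((\<lambda>t::real. t / (1 - t)) \<longlongrightarrow> 0 / (1 - 0)) (at_right 0)"
    by (intro tendsto_intros) auto
  then have "\<bar>d m\<bar> \<le> 0 / (1 - 0)"
  proof (rule tendsto_lowerbound)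
    have "\<forall>\<^sub>F t in at_right (0::real). t \<in> {0<..<1}" by (rule eventually_at_right_real) simp
    then show "\<forall>\<^sub>F t in at_right 0. \<bar>d m\<bar> \<le> t / (1 - t)"
      by eventually_elim (use le in auto)
  qed simp
  then show ?case by simp
qed

text \<open>The point \<open>x\<close> of the unit interval with odds
  \<open>x / (1 - x) = v ^ 2\<close>; for a standard normal \<open>v\<close> this is the limit
  variable.\<close>

definition odds :: "real \<Rightarrow> real" where
  "odds v = v\<^sup>2 / (1 + v\<^sup>2)"

lemma one_plus_square_pos: "0 < 1 + (v::real)\<^sup>2" "1 + (v::real)\<^sup>2 \<noteq> 0"
  using add_pos_nonneg[of 1 "v\<^sup>2"] by auto

lemma odds_range: "0 \<le> odds v" "odds v < 1"
  using one_plus_square_pos[of v] by (auto simp: odds_def)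

lemma odds_measurable [measurable]: "odds \<in> borel_measurable borel"
  unfolding odds_def[abs_def] by measurable

definition limit_density :: "real \<Rightarrow> real" where
  "limit_density x = 1 / sqrt (2 * pi * x * (1 - x) ^ 3) * exp (- x / (2 * (1 - x)))"

text \<open>With \<open>x = odds v\<close> one has \<open>1 - x = 1 / (1 + v ^ 2)\<close>, so the
  exponent of the density becomes \<open>- v ^ 2 / 2\<close>, and the algebraic factor cancels
  against the derivative of \<open>odds\<close>. The 2 in front of the normal density reflects that
  \<open>v\<close> and \<open>- v\<close> have the same image.\<close>

lemma limit_density_odds:
  assumes "v > 0"
  shows "limit_density (odds v) * (2 * v / (1 + v\<^sup>2)\<^sup>2) = 2 * std_normal_density v"
proof -
  define w where "w = 1 + v\<^sup>2"
  have w: "w > 0" using one_plus_square_pos by (simp add: w_def)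
  have o: "odds v = v\<^sup>2 / w" "1 - odds v = 1 / w"
    using w by (auto simp: odds_def w_def field_simps)
  have "2 * pi * odds v * (1 - odds v) ^ 3 = (2 * pi) * (v / w\<^sup>2)\<^sup>2"
    unfolding o(2) unfolding o(1) using w by (simp add: field_simps power2_eq_square power3_eq_cube)
  then have s: "sqrt (2 * pi * odds v * (1 - odds v) ^ 3) = sqrt (2 * pi) * (v / w\<^sup>2)"
    using assms w by (simp only: real_sqrt_mult real_sqrt_abs) simp
  have e: "- odds v / (2 * (1 - odds v)) = - v\<^sup>2 / 2" unfolding o(2) unfolding o(1) using w by simp
  show ?thesis
    unfolding limit_density_def s e std_normal_density_def w_def[symmetric]
    using assms w by (simp add: field_simps)
qed

lemma std_normal_integrable_bounded:
  assumes [measurable]: "f \<in> borel_measurable borel" and "\<And>v. \<bar>f v\<bar> \<le> C"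
  shows "integrable lborel (\<lambda>v. std_normal_density v * f v)"
proof (rule Bochner_Integration.integrable_bound)
  show "integrable lborel (\<lambda>v. C * std_normal_density v)" by simp
  have "\<bar>f v\<bar> \<le> \<bar>C\<bar>" for v using assms(2)[of v] by linarith
  then show "AE v in lborel. norm (std_normal_density v * f v) \<le> norm (C * std_normal_density v)"
    by (auto simp: abs_mult mult.commute intro!: mult_right_mono)
qed simp

text \<open>Substitution \<open>x = odds v\<close> on the positive half-line. Nonnegativity of the
  integrand lets integrability be transferred along with the value.\<close>

lemma limit_density_moment:
  "has_bochner_integral lborel (\<lambda>x. indicator {0<..<1} x * (limit_density x * x ^ j))
     (LBINT v. std_normal_density v * odds v ^ j)"
proof -
  let ?f = "\<lambda>x. limit_density x * x ^ j"
  let ?g' = "\<lambda>v::real. 2 * v / (1 + v\<^sup>2)\<^sup>2"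
  have ob: "\<bar>odds v ^ j\<bar> \<le> 1" for v using odds_range[of v] by (simp add: power_abs power_le_one)
  have int: "integrable lborel (\<lambda>v. std_normal_density v * odds v ^ j)"
    by (rule std_normal_integrable_bounded[OF _ ob]) measurable
  have fg: "?f (odds v) * ?g' v = 2 * (std_normal_density v * odds v ^ j)" if "v > 0" for v
  proof -
    have "?f (odds v) * ?g' v = (limit_density (odds v) * ?g' v) * odds v ^ j" by (simp only: mult_ac)
    then show ?thesis unfolding limit_density_odds[OF that] by (simp only: mult_ac)
  qed
  have int2: "integrable lborel (\<lambda>v. indicator {0<..} v * (2 * (std_normal_density v * odds v ^ j)))"
    using int by (intro integrable_real_mult_indicator[of "{0<..}" lborel "\<lambda>v. 2 * (std_normal_density v * odds v ^ j)", simplified mult.commute[of _ "indicator _ _"]]) auto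
  have eqi: "indicator {0<..} v * (?f (odds v) * ?g' v) = indicator {0<..} v * (2 * (std_normal_density v * odds v ^ j))" for v
    using fg[of v] by (auto simp: indicator_def)
  have si: "set_integrable lborel {0<..} (\<lambda>v. ?f (odds v) * ?g' v)"
    unfolding set_integrable_def real_scaleR_def eqi by (rule int2)
  have ei: "einterval 0 \<infinity> = {0<..}" by (simp add: zero_ereal_def)
  have e01: "einterval (ereal 0) (ereal 1) = {0<..<1}" by simp
  have der: "DERIV odds v :> ?g' v" for v
    unfolding odds_def using one_plus_square_pos[of v]
    by (auto intro!: derivative_eq_intros simp: power2_eq_square field_simps)
  have pos: "0 < odds v" if "v > 0" for v using that by (simp add: odds_def add_pos_nonneg)
  have cont: "isCont ?f (odds v)" if "v > 0" for v
    unfolding limit_density_def using pos[OF that] odds_range(2)[of v]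
    by (intro continuous_intros) auto
  have A: "((ereal \<circ> odds \<circ> real_of_ereal) \<longlongrightarrow> ereal 0) (at_right 0)"
  proof -
    have "(odds \<longlongrightarrow> odds 0) (at_right 0)"
      by (rule tendsto_mono[OF at_le[OF subset_UNIV]]) (use DERIV_isCont[OF der[of 0]] in \<open>simp add: isCont_def\<close>)
    then show ?thesis unfolding zero_ereal_def ereal_tendsto_simps by (simp add: odds_def)
  qed
  have B: "((ereal \<circ> odds \<circ> real_of_ereal) \<longlongrightarrow> ereal 1) (at_left \<infinity>)"
  proof -
    have "((\<lambda>v::real. 1 - inverse (1 + v\<^sup>2)) \<longlongrightarrow> 1 - 0) at_top"
      by (intro tendsto_diff tendsto_const tendsto_inverse_0_at_top filterlim_tendsto_add_at_top[OF tendsto_const]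
          filterlim_pow_at_top filterlim_ident) simp
    moreover have "(\<lambda>v::real. 1 - inverse (1 + v\<^sup>2)) = odds"
      using one_plus_square_pos by (auto simp: odds_def fun_eq_iff field_simps)
    ultimately show ?thesis unfolding ereal_tendsto_simps by simp
  qed
  have p1: "isCont ?g' v" if "0 < ereal v" "ereal v < \<infinity>" for v
    using one_plus_square_pos[of v] by (intro continuous_intros) auto
  have p2: "0 \<le> ?f (odds v)" if "0 < ereal v" "ereal v < \<infinity>" for v
    using odds_range[of v] unfolding limit_density_def by (intro mult_nonneg_nonneg zero_le_power) auto
  have p3: "set_integrable lborel (einterval 0 \<infinity>) (\<lambda>v. ?f (odds v) * ?g' v)" unfolding ei by (rule si)
  have p4: "isCont ?f (odds v)" if "0 < ereal v" "ereal v < \<infinity>" for v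
    using that by (intro cont) simp
  have p5: "0 \<le> ?g' v" if "0 \<le> ereal v" "ereal v \<le> \<infinity>" for v using that by simp
  have p6: "(0::ereal) < \<infinity>" by simp
  note sub = interval_integral_substitution_nonneg[of 0 \<infinity> odds ?g' ?f, OF p6 der p4 p1 p2 p5 A B p3]
  \<comment> \<open>The integrand is even in \<open>v\<close>, so the half-line carries half of the
    Gaussian integral; this uses up the factor 2 from \<open>limit_density_odds\<close>.\<close>
  have half: "has_bochner_integral lborel (\<lambda>v. indicator {0..} v *\<^sub>R (std_normal_density v * odds v ^ j))
     ((LBINT v. std_normal_density v * odds v ^ j) / 2)"
  proof -
    let ?h = "\<lambda>v. std_normal_density v * odds v ^ j"
    have "integrable lborel (\<lambda>v. indicator {0..} v *\<^sub>R ?h v)"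
      using int by (intro integrable_mult_indicator) auto
    then have 1: "has_bochner_integral lborel (\<lambda>v. indicator {0..} v *\<^sub>R ?h v) (LBINT v. indicator {0..} v *\<^sub>R ?h v)"
      by (simp add: has_bochner_integral_iff)
    have "has_bochner_integral lborel ?h (2 *\<^sub>R (LBINT v. indicator {0..} v *\<^sub>R ?h v))"
      by (rule has_bochner_integral_even_function[OF 1]) (simp add: odds_def normal_density_def)
    then have "(LBINT v. ?h v) = 2 * (LBINT v. indicator {0..} v *\<^sub>R ?h v)" by (simp add: has_bochner_integral_iff)
    with 1 show ?thesis by simp
  qed
  have "(LBINT v=0..\<infinity>. ?f (odds v) * ?g' v) = (LBINT v. indicator {0<..} v * (2 * (std_normal_density v * odds v ^ j)))"
    unfolding interval_lebesgue_integral_0_infty set_lebesgue_integral_def real_scaleR_def eqi ..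
  also have "\<dots> = (LBINT v. 2 * (indicator {0..} v *\<^sub>R (std_normal_density v * odds v ^ j)))"
  proof (rule integral_cong_AE)
    show "AE v in lborel. indicator {0<..} v * (2 * (std_normal_density v * odds v ^ j)) =
       2 * (indicator {0..} v *\<^sub>R (std_normal_density v * odds v ^ j))"
      using AE_lborel_singleton[of "0::real"] by eventually_elim (auto simp: indicator_def)
  qed (use int2 half in \<open>auto simp: has_bochner_integral_iff\<close>)
  also have "\<dots> = (LBINT v. std_normal_density v * odds v ^ j)"
    using half by (simp add: has_bochner_integral_iff)
  finally have "(LBINT v=0..\<infinity>. ?f (odds v) * ?g' v) = (LBINT v. std_normal_density v * odds v ^ j)" .
  with sub(2) have "(LBINT x=ereal 0..ereal 1. ?f x) = (LBINT v. std_normal_density v * odds v ^ j)"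
    by (rule trans)
  moreover have "(LBINT x=ereal 0..ereal 1. ?f x) = (LBINT x. indicator {0<..<1} x * ?f x)"
    by (simp add: interval_lebesgue_integral_def set_lebesgue_integral_def)
  moreover have "integrable lborel (\<lambda>x. indicator {0<..<1} x * ?f x)"
    using sub(1) unfolding e01 set_integrable_def by simp
  ultimately show ?thesis by (simp add: has_bochner_integral_iff)
qed

section \<open>The limit law as a probability measure and its moments\<close>

lemma limit_law_eq: "limit_law = density lborel (\<lambda>x. ennreal (indicator {0<..<1} x * limit_density x))"
  by (simp add: limit_law_def limit_density_def)

lemma limit_density_measurable [measurable]: "limit_density \<in> borel_measurable borel"
  unfolding limit_density_def[abs_def] by measurable

lemma limit_density_nonneg: "0 \<le> indicator {0<..<1} x * limit_density x"
  by (auto simp: limit_density_def indicator_def)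

text \<open>The moment formula for \<open>j = 0\<close> reduces the total mass to that of the normal
  density.\<close>

lemma limit_law_prob_space: "prob_space limit_law"
proof
  have "emeasure limit_law (space limit_law) = (\<integral>\<^sup>+x. ennreal (indicator {0<..<1} x * limit_density x) \<partial>lborel)"
    by (simp add: limit_law_eq emeasure_density)
  also have "\<dots> = ennreal (LBINT x. indicator {0<..<1} x * limit_density x)"
    using limit_density_moment[of 0] limit_density_nonneg
    by (intro nn_integral_eq_integral) (auto simp: has_bochner_integral_iff)
  also have "\<dots> = 1" using limit_density_moment[of 0] by (simp add: has_bochner_integral_iff)
  finally show "emeasure limit_law (space limit_law) = 1" .
qed

lemma limit_law_real_distribution: "real_distribution limit_law"
  using limit_law_prob_space by (simp add: real_distribution_def real_distribution_axioms_def limit_law_def)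

lemma limit_law_supported: "AE x in limit_law. 0 \<le> x \<and> x \<le> 1"
  unfolding limit_law_eq by (subst AE_density) (auto simp: indicator_def)

lemma limit_law_moment: "(\<integral>x. x ^ j \<partial>limit_law) = (LBINT v. std_normal_density v * odds v ^ j)"
proof -
  have "(\<integral>x. x ^ j \<partial>limit_law) = (LBINT x. (indicator {0<..<1} x * limit_density x) *\<^sub>R x ^ j)"
    unfolding limit_law_eq using limit_density_nonneg by (intro integral_density) auto
  then show ?thesis using limit_density_moment[of j] by (simp add: has_bochner_integral_iff mult.assoc)
qed

section \<open>Exponential and Gaussian integrals, up to the resolvent identity\<close>

lemma std_normal_cos: "(LBINT v. std_normal_density v * cos (t * v)) = exp (- t\<^sup>2 / 2)"
proof -
  interpret real_distribution std_normal_distribution by (rule real_dist_normal_dist)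
  have "exp (- t\<^sup>2 / 2) = Re (char std_normal_distribution t)"
    by (simp add: char_std_normal_distribution)
  also have "\<dots> = (\<integral>v. Re (iexp (t * v)) \<partial>std_normal_distribution)"
    unfolding char_def by (intro integral_Re[symmetric] integrable_iexp) auto
  also have "\<dots> = (\<integral>v. cos (t * v) \<partial>std_normal_distribution)"
    by (simp add: Re_exp)
  also have "\<dots> = (LBINT v. std_normal_density v * cos (t * v))"
    by (subst integral_density) auto
  finally show ?thesis by simp
qed

definition exp_weight :: "real \<Rightarrow> real" where
  "exp_weight u = indicator {0<..} u * exp (- u)"

lemma exp_weight_measurable [measurable]: "exp_weight \<in> borel_measurable borel"
  unfolding exp_weight_def[abs_def] by measurable

lemma exp_weight_nonneg: "0 \<le> exp_weight u"
  by (simp add: exp_weight_def)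

lemma exp_neg_tendsto: "((\<lambda>u::real. exp (- u)) \<longlongrightarrow> 0) at_top"
  by (rule filterlim_compose[OF exp_at_bot filterlim_uminus_at_bot_at_top])

lemma has_integral_exp_weight: "has_bochner_integral lborel exp_weight 1"
proof -
  have ei: "einterval 0 \<infinity> = {0<..}" by (simp add: zero_ereal_def)
  have "((\<lambda>u::real. - exp (- u)) \<longlongrightarrow> - exp (- 0)) (at_right 0)"
    by (intro tendsto_intros)
  then have A: "(((\<lambda>u::real. - exp (- u)) \<circ> real_of_ereal) \<longlongrightarrow> - 1) (at_right 0)"
    unfolding zero_ereal_def ereal_tendsto_simps by simp
  have B: "(((\<lambda>u::real. - exp (- u)) \<circ> real_of_ereal) \<longlongrightarrow> - 0) (at_left \<infinity>)"
    unfolding ereal_tendsto_simps by (intro tendsto_minus exp_neg_tendsto)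
  have "set_integrable lborel (einterval 0 \<infinity>) (\<lambda>u. exp (- u))" "(LBINT u=0..\<infinity>. exp (- u)) = - 0 - (- 1)"
    by (rule interval_integral_FTC_nonneg[where F = "\<lambda>u. - exp (- u)", OF _ _ _ _ A B];
        auto intro!: derivative_eq_intros)+
  then show ?thesis
    unfolding ei interval_lebesgue_integral_0_infty
    by (simp add: has_bochner_integral_iff set_integrable_def set_lebesgue_integral_def exp_weight_def[abs_def])
qed

lemma exp_weight_integrable_bounded:
  assumes [measurable]: "f \<in> borel_measurable borel" and "\<And>v. \<bar>f v\<bar> \<le> C"
  shows "integrable lborel (\<lambda>u. exp_weight u * f u)"
proof (rule Bochner_Integration.integrable_bound)
  show "integrable lborel (\<lambda>v. C * exp_weight v)"
    using has_integral_exp_weight by (simp add: has_bochner_integral_iff)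
  have "\<bar>f v\<bar> \<le> \<bar>C\<bar>" for v using assms(2)[of v] by linarith
  then have "\<bar>exp_weight v\<bar> * \<bar>f v\<bar> \<le> \<bar>exp_weight v\<bar> * \<bar>C\<bar>" for v
    by (intro mult_left_mono) auto
  then show "AE v in lborel. norm (exp_weight v * f v) \<le> norm (C * exp_weight v)"
    by (intro AE_I2) (simp add: abs_mult mult.commute)
qed simp

text \<open>The real part of the characteristic function \<open>1 / (1 - i * a)\<close> of the
  exponential law. The antiderivative \<open>?F\<close> is the real part of
  \<open>- exp (- (1 - i * a) * u) / (1 - i * a)\<close>.\<close>

lemma exp_weight_cos: "(LBINT u. exp_weight u * cos (a * u)) = 1 / (1 + a\<^sup>2)"
proof -
  let ?F = "\<lambda>u. exp (- u) * (a * sin (a * u) - cos (a * u)) / (1 + a\<^sup>2)"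
  have ei: "einterval 0 \<infinity> = {0<..}" by (simp add: zero_ereal_def)
  note p = one_plus_square_pos[of a]
  have "(?F \<longlongrightarrow> exp (- 0) * (a * sin (a * 0) - cos (a * 0)) / (1 + a\<^sup>2)) (at_right 0)"
    using p by (intro tendsto_intros) auto
  then have A: "((?F \<circ> real_of_ereal) \<longlongrightarrow> - (1 / (1 + a\<^sup>2))) (at_right 0)"
    unfolding zero_ereal_def ereal_tendsto_simps by simp
  have "(?F \<longlongrightarrow> 0) at_top"
  proof (rule Lim_null_comparison)
    show "\<forall>\<^sub>F u in at_top. norm (?F u) \<le> exp (- u) * ((\<bar>a\<bar> + 1) / (1 + a\<^sup>2))"
    proof (rule always_eventually, rule allI)
      fix u
      have "\<bar>a * sin (a * u) - cos (a * u)\<bar> \<le> \<bar>a * sin (a * u)\<bar> + \<bar>cos (a * u)\<bar>" by linarith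
      also have "\<dots> \<le> \<bar>a\<bar> * 1 + 1"
        by (intro add_mono) (auto simp: abs_mult intro!: mult_left_le)
      finally have "\<bar>a * sin (a * u) - cos (a * u)\<bar> \<le> \<bar>a\<bar> + 1" by simp
      then have "exp (- u) * \<bar>a * sin (a * u) - cos (a * u)\<bar> / (1 + a\<^sup>2) \<le> exp (- u) * (\<bar>a\<bar> + 1) / (1 + a\<^sup>2)"
        using p by (intro divide_right_mono mult_left_mono) auto
      then show "norm (?F u) \<le> exp (- u) * ((\<bar>a\<bar> + 1) / (1 + a\<^sup>2))"
        using p by (simp add: abs_mult)
    qed
    show "((\<lambda>u. exp (- u) * ((\<bar>a\<bar> + 1) / (1 + a\<^sup>2))) \<longlongrightarrow> 0) at_top"
      using tendsto_mult[OF exp_neg_tendsto tendsto_const[of "(\<bar>a\<bar> + 1) / (1 + a\<^sup>2)"]] by simp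
  qed
  then have B: "((?F \<circ> real_of_ereal) \<longlongrightarrow> 0) (at_left \<infinity>)" unfolding ereal_tendsto_simps .
  have e: "indicator {0<..} u *\<^sub>R (exp (- u) * cos (a * u)) = exp_weight u * cos (a * u)" for u
    by (simp add: exp_weight_def)
  have "(LBINT u=0..\<infinity>. exp (- u) * cos (a * u)) = 0 - (- (1 / (1 + a\<^sup>2)))"
  proof (rule interval_integral_FTC_integrable[where F = ?F, OF _ _ _ _ A B])
    show "set_integrable lborel (einterval 0 \<infinity>) (\<lambda>u. exp (- u) * cos (a * u))"
      unfolding ei set_integrable_def e by (rule exp_weight_integrable_bounded[of _ 1]) auto
    fix u :: real
    have "(exp (- u) * (a * (cos (a * u) * a) + sin (a * u) * a) - exp (- u) * (a * sin (a * u) - cos (a * u))) =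
       (exp (- u) * cos (a * u)) * (1 + a\<^sup>2)" by (simp add: algebra_simps power2_eq_square)
    then have *: "(exp (- u) * (a * (cos (a * u) * a) + sin (a * u) * a) - exp (- u) * (a * sin (a * u) - cos (a * u))) / (1 + a\<^sup>2) =
       exp (- u) * cos (a * u)" using p by (simp add: field_simps)
    have "(?F has_real_derivative
       (exp (- u) * (a * (cos (a * u) * a) + sin (a * u) * a) - exp (- u) * (a * sin (a * u) - cos (a * u))) / (1 + a\<^sup>2)) (at u)"
      using p by (auto intro!: derivative_eq_intros)
    then show "(?F has_vector_derivative exp (- u) * cos (a * u)) (at u)"
      unfolding * by (simp add: has_real_derivative_iff_has_vector_derivative)
    show "isCont (\<lambda>u. exp (- u) * cos (a * u)) u" by (intro continuous_intros)
  qed simp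
  then show ?thesis unfolding interval_lebesgue_integral_0_infty set_lebesgue_integral_def e by simp
qed

text \<open>Both sides are the integral of \<open>exp (- u) * cos (sqrt \<kappa> * u * v)\<close> against the normal law of \<open>v\<close>.\<close>

lemma mills_identity:
  assumes "\<kappa> > 0"
  shows "(LBINT u. exp_weight u * exp (- \<kappa> * u\<^sup>2 / 2)) = (LBINT v. std_normal_density v * (1 / (1 + \<kappa> * v\<^sup>2)))"
proof -
  define c where "c = sqrt \<kappa>"
  have c: "c\<^sup>2 = \<kappa>" using assms by (simp add: c_def)
  let ?f = "\<lambda>u v. exp_weight u * (std_normal_density v * cos (c * u * v))"
  have int: "integrable (lborel \<Otimes>\<^sub>M lborel) (\<lambda>(u, v). ?f u v)"
  proof (rule lborel_pair.Fubini_integrable)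
    show "(\<lambda>(u, v). ?f u v) \<in> borel_measurable (lborel \<Otimes>\<^sub>M lborel)" by measurable
    have iv: "integrable lborel (\<lambda>v. std_normal_density v * cos (c * u * v))" for u
      by (rule std_normal_integrable_bounded[of _ 1]) auto
    then show "AE u in lborel. integrable lborel (\<lambda>v. case (u, v) of (u, v) \<Rightarrow> ?f u v)" by auto
    define n where "n u = (LBINT v. \<bar>std_normal_density v * cos (c * u * v)\<bar>)" for u
    have n: "\<bar>n u\<bar> \<le> 1" for u
    proof -
      have "n u \<le> (LBINT v. std_normal_density v)"
        unfolding n_def
      proof (intro integral_mono integrable_abs iv)
        fix v
        show "\<bar>std_normal_density v * cos (c * u * v)\<bar> \<le> std_normal_density v"
          by (auto simp: abs_mult intro!: mult_left_le)
      qed simp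
      moreover have "0 \<le> n u" unfolding n_def by simp
      ultimately show ?thesis by simp
    qed
    have [measurable]: "n \<in> borel_measurable borel" unfolding n_def by measurable
    have "integrable lborel (\<lambda>u. exp_weight u * n u)"
      by (rule exp_weight_integrable_bounded[OF _ n]) measurable
    moreover have "(LBINT v. norm (case (u, v) of (u, v) \<Rightarrow> ?f u v)) = exp_weight u * n u" for u
      using exp_weight_nonneg[of u] by (simp add: abs_mult n_def)
    ultimately show "integrable lborel (\<lambda>u. LBINT v. norm (case (u, v) of (u, v) \<Rightarrow> ?f u v))" by simp
  qed
  have fub: "(LBINT v. LBINT u. ?f u v) = (LBINT u. LBINT v. ?f u v)"
    by (rule lborel_pair.Fubini_integral[OF int])
  have i1: "(LBINT v. ?f u v) = exp_weight u * exp (- \<kappa> * u\<^sup>2 / 2)" for u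
    using std_normal_cos[of "c * u"] by (simp add: power_mult_distrib c)
  have i2: "(LBINT u. ?f u v) = std_normal_density v * (1 / (1 + \<kappa> * v\<^sup>2))" for v
  proof -
    have "(LBINT u. ?f u v) = (LBINT u. std_normal_density v * (exp_weight u * cos ((c * v) * u)))"
      by (simp add: mult_ac)
    also have "\<dots> = std_normal_density v * (1 / (1 + \<kappa> * v\<^sup>2))"
      using exp_weight_cos[of "c * v"] by (simp add: power_mult_distrib c)
    finally show ?thesis .
  qed
  show ?thesis by (rule fub[unfolded i1 i2, symmetric])
qed

text \<open>The integrand is the derivative of \<open>- exp (- u - \<kappa> * u ^ 2 / 2)\<close>,
  which rises from -1 at 0 to 0 at infinity.\<close>

lemma gauss_weight_integral:
  assumes "\<kappa> > 0"
  shows "(LBINT u. exp_weight u * exp (- \<kappa> * u\<^sup>2 / 2) * (1 + \<kappa> * u)) = 1"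
    and "integrable lborel (\<lambda>u. exp_weight u * exp (- \<kappa> * u\<^sup>2 / 2) * (1 + \<kappa> * u))"
proof -
  let ?F = "\<lambda>u. - exp (- u - \<kappa> * u\<^sup>2 / 2)"
  let ?f = "\<lambda>u. exp (- u - \<kappa> * u\<^sup>2 / 2) * (1 + \<kappa> * u)"
  have ei: "einterval 0 \<infinity> = {0<..}" by (simp add: zero_ereal_def)
  have "(?F \<longlongrightarrow> - exp (- 0 - \<kappa> * 0\<^sup>2 / 2)) (at_right 0)"
    by (intro tendsto_intros) auto
  then have A: "((?F \<circ> real_of_ereal) \<longlongrightarrow> - 1) (at_right 0)"
    unfolding zero_ereal_def ereal_tendsto_simps by simp
  have "(?F \<longlongrightarrow> 0) at_top"
    by (rule Lim_null_comparison[OF _ exp_neg_tendsto]) (use assms in auto)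
  then have B: "((?F \<circ> real_of_ereal) \<longlongrightarrow> 0) (at_left \<infinity>)" unfolding ereal_tendsto_simps .
  have e: "indicator {0<..} u *\<^sub>R ?f u = exp_weight u * exp (- \<kappa> * u\<^sup>2 / 2) * (1 + \<kappa> * u)" for u
  proof -
    have "exp (- u - \<kappa> * u\<^sup>2 / 2) = exp (- u) * exp (- \<kappa> * u\<^sup>2 / 2)" by (simp flip: exp_add)
    then show ?thesis by (simp add: exp_weight_def)
  qed
  have der: "(?F has_real_derivative ?f u) (at u)" for u
    by (auto intro!: derivative_eq_intros simp: algebra_simps)
  have nn: "AE u in lborel. 0 < ereal u \<longrightarrow> ereal u < \<infinity> \<longrightarrow> 0 \<le> ?f u"
    using assms by auto
  have cont: "isCont ?f u" for u by (intro continuous_intros) auto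
  have "(0::ereal) < \<infinity>" by simp
  note ftc = interval_integral_FTC_nonneg[of 0 \<infinity> ?F ?f, OF this der cont nn A B]
  have "set_integrable lborel (einterval 0 \<infinity>) ?f" "(LBINT u=0..\<infinity>. ?f u) = 0 - (- 1)"
    using ftc by auto
  then show "(LBINT u. exp_weight u * exp (- \<kappa> * u\<^sup>2 / 2) * (1 + \<kappa> * u)) = 1"
    "integrable lborel (\<lambda>u. exp_weight u * exp (- \<kappa> * u\<^sup>2 / 2) * (1 + \<kappa> * u))"
    unfolding ei interval_lebesgue_integral_0_infty set_lebesgue_integral_def set_integrable_def e by simp_all
qed

text \<open>After multiplication by \<open>\<kappa>\<close>, \<open>gauss_weight_integral\<close>
  turns the left side into 1 minus the left side of \<open>mills_identity\<close>. On the Gaussian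
  side, \<open>1 - 1 / (1 + \<kappa> * v ^ 2) = \<kappa> * v ^ 2 / (1 + \<kappa> * v ^
  2)\<close>.\<close>

lemma resolvent_identity:
  assumes \<kappa>: "\<kappa> > 0"
  shows "(LBINT u. exp_weight u * u * exp (- \<kappa> * u\<^sup>2 / 2)) = (LBINT v. std_normal_density v * (v\<^sup>2 / (1 + \<kappa> * v\<^sup>2)))"
proof -
  let ?w = "\<lambda>u. exp_weight u * exp (- \<kappa> * u\<^sup>2 / 2)"
  let ?n = "\<lambda>v. std_normal_density v * (1 / (1 + \<kappa> * v\<^sup>2))"
  have pos: "0 < 1 + \<kappa> * v\<^sup>2" for v :: real using \<kappa> by (simp add: add_pos_nonneg)
  have iw: "integrable lborel ?w"
    by (rule exp_weight_integrable_bounded[of _ 1]) (use \<kappa> in auto)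
  have iN: "integrable lborel ?n"
    by (rule std_normal_integrable_bounded[of _ 1]) (use pos \<kappa> in \<open>auto simp: divide_le_eq abs_of_pos\<close>)
  have "\<kappa> * (LBINT u. exp_weight u * u * exp (- \<kappa> * u\<^sup>2 / 2)) = (LBINT u. \<kappa> * (exp_weight u * u * exp (- \<kappa> * u\<^sup>2 / 2)))"
    by simp
  also have "\<dots> = (LBINT u. ?w u * (1 + \<kappa> * u) - ?w u)"
    by (intro Bochner_Integration.integral_cong refl) (simp add: algebra_simps)
  also have "\<dots> = 1 - (LBINT u. ?w u)"
    using gauss_weight_integral[OF \<kappa>] iw by (subst Bochner_Integration.integral_diff) auto
  also have "\<dots> = (LBINT v. std_normal_density v) - (LBINT v. ?n v)"
    unfolding mills_identity[OF \<kappa>] by simp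
  also have "\<dots> = (LBINT v. std_normal_density v - ?n v)"
    using iN by (subst Bochner_Integration.integral_diff) auto
  also have "\<dots> = (LBINT v. \<kappa> * (std_normal_density v * (v\<^sup>2 / (1 + \<kappa> * v\<^sup>2))))"
  proof (rule Bochner_Integration.integral_cong[OF refl])
    fix v :: real
    have "1 - 1 / (1 + \<kappa> * v\<^sup>2) = \<kappa> * (v\<^sup>2 / (1 + \<kappa> * v\<^sup>2))" using pos[of v] by (simp add: field_simps)
    then show "std_normal_density v - ?n v = \<kappa> * (std_normal_density v * (v\<^sup>2 / (1 + \<kappa> * v\<^sup>2)))"
      by (metis mult.left_commute mult.right_neutral right_diff_distrib)
  qed
  also have "\<dots> = \<kappa> * (LBINT v. std_normal_density v * (v\<^sup>2 / (1 + \<kappa> * v\<^sup>2)))"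
    by (rule integral_mult_right_zero)
  finally show ?thesis using \<kappa> by simp
qed

text \<open>
  Multiplying by \<open>t ^ q\<close> and summing over \<open>q\<close> turns the claim into the resolvent identity with
  \<open>\<kappa> = 1 - t\<close>.
\<close>

lemma limit_law_moment_Suc:
  "(\<integral>x. x ^ Suc q \<partial>limit_law) = (LBINT u. spine_density q u * exp (- u))"
proof -
  define m where "m j = (LBINT v. std_normal_density v * odds v ^ Suc j)" for j
  define \<mu> where "\<mu> j = (LBINT u. spine_density j u * exp (- u))" for j
  have m_int: "integrable lborel (\<lambda>v. std_normal_density v * odds v ^ Suc j)" for j
    by (rule std_normal_integrable_bounded[of _ 1]) (use odds_range in \<open>auto simp: power_abs power_le_one abs_mult less_imp_le intro!: mult_le_one\<close>)
  have m01: "0 \<le> m j \<and> m j \<le> 1" for j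
  proof
    show "0 \<le> m j" unfolding m_def using odds_range by (intro integral_nonneg_AE) auto
    have "m j \<le> (LBINT v. std_normal_density v)"
      unfolding m_def using m_int[of j] odds_range
      by (intro integral_mono) (auto intro!: mult_left_le power_le_one mult_le_one simp: less_imp_le)
    then show "m j \<le> 1" by simp
  qed
  have sd: "integrable lborel (spine_density j)" "(LBINT u. spine_density j u) = 1" for j
    using has_integral_spine_density[of j] by (auto simp: has_bochner_integral_iff)
  have le: "spine_density j u * exp (- u) \<le> spine_density j u" for j u
  proof (cases "u > 0")
    case True
    then show ?thesis by (intro mult_left_le spine_density_nonneg) simp
  qed (simp add: spine_density_def)
  have \<mu>_int: "integrable lborel (\<lambda>u. spine_density j u * exp (- u))" for j
    by (rule Bochner_Integration.integrable_bound[OF sd(1)[of j]])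
      (use le spine_density_nonneg in \<open>auto simp: abs_mult\<close>)
  have \<mu>01: "0 \<le> \<mu> j \<and> \<mu> j \<le> 1" for j
  proof
    show "0 \<le> \<mu> j" unfolding \<mu>_def using spine_density_nonneg by (intro integral_nonneg_AE) auto
    have "\<mu> j \<le> (LBINT u. spine_density j u)"
      unfolding \<mu>_def by (rule integral_mono[OF \<mu>_int sd(1) le])
    then show "\<mu> j \<le> 1" using sd(2) by simp
  qed
  have "(\<lambda>j. (m j - \<mu> j) * t ^ j) sums 0" if t: "0 < t" "t < 1" for t
  proof -
    have summ: "summable (\<lambda>j. x j * t ^ j)" if "\<And>j. 0 \<le> x j \<and> x j \<le> 1" for x :: "nat \<Rightarrow> real"
    proof (rule summable_comparison_test'[where g = "\<lambda>j. t ^ j" and N = 0])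
      show "summable (\<lambda>j. t ^ j)" using t by (intro summable_geometric) auto
      show "norm (x j * t ^ j) \<le> t ^ j" for j using that[of j] t by (simp add: abs_mult mult_left_le_one_le)
    qed
    have "(\<lambda>j. LBINT v. t ^ j * (std_normal_density v * odds v ^ Suc j)) sums
        (LBINT v. \<Sum>j. t ^ j * (std_normal_density v * odds v ^ Suc j))"
    proof (rule sums_integral)
      show "integrable lborel (\<lambda>v. t ^ j * (std_normal_density v * odds v ^ Suc j))" for j
        using m_int[of j] by simp
      have "norm (t * odds v) < 1" for v
        using odds_range[of v] t mult_strict_mono[of t 1 "odds v" 1] by (simp add: abs_mult)
      then have "summable (\<lambda>j. std_normal_density v * odds v * (t * odds v) ^ j)" for v
        by (intro summable_mult summable_geometric)
      then show "AE v in lborel. summable (\<lambda>j. norm (t ^ j * (std_normal_density v * odds v ^ Suc j)))"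
        using t odds_range by (simp add: abs_mult power_mult_distrib mult_ac)
      have "(LBINT v. norm (t ^ j * (std_normal_density v * odds v ^ Suc j))) = m j * t ^ j" for j
        using t odds_range by (simp add: abs_mult m_def power_abs)
      then show "summable (\<lambda>j. LBINT v. norm (t ^ j * (std_normal_density v * odds v ^ Suc j)))"
        using summ[of m] m01 by simp
    qed
    moreover have "(\<Sum>j. t ^ j * (std_normal_density v * odds v ^ Suc j)) = std_normal_density v * (v\<^sup>2 / (1 + (1 - t) * v\<^sup>2))" for v
    proof -
      have n: "norm (t * odds v) < 1"
        using odds_range[of v] t mult_strict_mono[of t 1 "odds v" 1] by (simp add: abs_mult)
      have "(\<lambda>j. std_normal_density v * odds v * (t * odds v) ^ j) sums (std_normal_density v * odds v * (1 / (1 - t * odds v)))"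
        by (intro sums_mult geometric_sums n)
      then have "(\<lambda>j. t ^ j * (std_normal_density v * odds v ^ Suc j)) sums (std_normal_density v * odds v * (1 / (1 - t * odds v)))"
        by (simp add: power_mult_distrib mult_ac)
      from sums_unique[OF this, symmetric]
      have "(\<Sum>j. t ^ j * (std_normal_density v * odds v ^ Suc j)) = std_normal_density v * (odds v * (1 / (1 - t * odds v)))"
        by (simp only: mult.assoc)
      moreover have "odds v * (1 / (1 - t * odds v)) = v\<^sup>2 / (1 + (1 - t) * v\<^sup>2)"
      proof -
        have "1 - t * odds v = (1 + (1 - t) * v\<^sup>2) / (1 + v\<^sup>2)"
          using one_plus_square_pos[of v] by (simp add: odds_def field_simps)
        then show ?thesis using one_plus_square_pos[of v] by (simp add: odds_def)
      qed
      ultimately show ?thesis by (simp only:)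
    qed
    ultimately have s1: "(\<lambda>j. m j * t ^ j) sums (LBINT v. std_normal_density v * (v\<^sup>2 / (1 + (1 - t) * v\<^sup>2)))"
      by (simp add: m_def mult.commute)
    \<comment> \<open>Apart from the factor \<open>u * exp (- u ^ 2 / 2)\<close>, the densities
      weighted with \<open>t ^ j\<close> are the terms of the series of
      \<open>exp (t * u ^ 2 / 2)\<close>; summing lowers the Gaussian exponent from 1 to
      \<open>1 - t\<close>.\<close>
    have ssd: "(\<lambda>j. t ^ j * (spine_density j u * exp (- u))) sums (exp_weight u * u * exp (- (1 - t) * u\<^sup>2 / 2))" for u
    proof -
      have "(\<lambda>j. (t * u\<^sup>2 / 2) ^ j /\<^sub>R fact j) sums exp (t * u\<^sup>2 / 2)" by (rule exp_converges)
      then have "(\<lambda>j. (exp_weight u * u * exp (- (u\<^sup>2 / 2))) * ((t * u\<^sup>2 / 2) ^ j /\<^sub>R fact j)) sums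
          ((exp_weight u * u * exp (- (u\<^sup>2 / 2))) * exp (t * u\<^sup>2 / 2))" by (rule sums_mult)
      moreover have "(exp_weight u * u * exp (- (u\<^sup>2 / 2))) * ((t * u\<^sup>2 / 2) ^ j /\<^sub>R fact j) = t ^ j * (spine_density j u * exp (- u))" for j
        by (simp add: exp_weight_def spine_density_def power_mult_distrib power_divide power_mult[symmetric] field_simps)
      moreover have "(exp_weight u * u * exp (- (u\<^sup>2 / 2))) * exp (t * u\<^sup>2 / 2) = exp_weight u * u * exp (- (1 - t) * u\<^sup>2 / 2)"
        by (simp add: mult.assoc field_simps flip: exp_add)
      ultimately show ?thesis by simp
    qed
    have "(\<lambda>j. LBINT u. t ^ j * (spine_density j u * exp (- u))) sums
        (LBINT u. \<Sum>j. t ^ j * (spine_density j u * exp (- u)))"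
    proof (rule sums_integral)
      show "integrable lborel (\<lambda>u. t ^ j * (spine_density j u * exp (- u)))" for j
        using \<mu>_int[of j] by simp
      show "AE u in lborel. summable (\<lambda>j. norm (t ^ j * (spine_density j u * exp (- u))))"
        using ssd t spine_density_nonneg by (auto simp: abs_mult sums_iff)
      have "(LBINT u. norm (t ^ j * (spine_density j u * exp (- u)))) = \<mu> j * t ^ j" for j
        using t spine_density_nonneg by (simp add: abs_mult \<mu>_def)
      then show "summable (\<lambda>j. LBINT u. norm (t ^ j * (spine_density j u * exp (- u))))"
        using summ[of \<mu>] \<mu>01 by simp
    qed
    moreover have "(\<Sum>j. t ^ j * (spine_density j u * exp (- u))) = exp_weight u * u * exp (- (1 - t) * u\<^sup>2 / 2)" for u
      using ssd[of u] by (simp add: sums_iff)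
    ultimately have s2: "(\<lambda>j. \<mu> j * t ^ j) sums (LBINT u. exp_weight u * u * exp (- (1 - t) * u\<^sup>2 / 2))"
      by (simp add: \<mu>_def mult.commute)
    have "1 - t > 0" using t by simp
    from sums_diff[OF s1 s2] show ?thesis unfolding resolvent_identity[OF \<open>1 - t > 0\<close>] by (simp add: left_diff_distrib)
  qed
  moreover have "\<bar>m j - \<mu> j\<bar> \<le> 1" for j using m01[of j] \<mu>01[of j] by linarith
  ultimately have "m q - \<mu> q = 0" by (intro power_series_unique_0[of "\<lambda>j. m j - \<mu> j"]) auto
  then show ?thesis unfolding limit_law_moment by (simp add: m_def \<mu>_def)
qed

subsection \<open>Method of moments and the fire dynamics on Cayley trees\<close>

lemma integrable_unit_interval:
  fixes f :: "real \<Rightarrow> real"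
  assumes "real_distribution \<mu>" "AE x in \<mu>. 0 \<le> x \<and> x \<le> 1" "f \<in> borel_measurable borel"
    "\<And>x. 0 \<le> x \<Longrightarrow> x \<le> 1 \<Longrightarrow> \<bar>f x\<bar> \<le> B"
  shows "integrable \<mu> f" "\<bar>integral\<^sup>L \<mu> f\<bar> \<le> B"
proof -
  interpret real_distribution \<mu> by (rule assms(1))
  have AE: "AE x in \<mu>. norm (f x) \<le> B" using assms(2) by eventually_elim (use assms(4) in auto)
  show i: "integrable \<mu> f" by (rule integrable_const_bound[OF AE]) (use assms(3) in simp)
  have "\<bar>integral\<^sup>L \<mu> f\<bar> \<le> (\<integral>x. \<bar>f x\<bar> \<partial>\<mu>)" by (rule integral_abs_bound)
  also have "\<dots> \<le> (\<integral>x. B \<partial>\<mu>)" by (rule integral_mono_AE) (use i AE in auto)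
  finally show "\<bar>integral\<^sup>L \<mu> f\<bar> \<le> B" using prob_space by simp
qed

text \<open>On the unit interval a continuous test function is uniformly approximated by a
  polynomial, whose integrals are finite combinations of moments. The approximation error is the
  same for all the measures, since all live on that interval.\<close>

lemma moments_imp_weak_conv:
  fixes \<mu> :: "nat \<Rightarrow> real measure"
  assumes \<mu>: "\<And>n. real_distribution (\<mu> n)" "\<And>n. AE x in \<mu> n. 0 \<le> x \<and> x \<le> 1"
    and \<nu>: "real_distribution \<nu>" "AE x in \<nu>. 0 \<le> x \<and> x \<le> 1"
    and mom: "\<And>k. (\<lambda>n. \<integral>x. x ^ k \<partial>\<mu> n) \<longlonglongrightarrow> (\<integral>x. x ^ k \<partial>\<nu>)"
  shows "weak_conv_m \<mu> \<nu>"
proof (rule integral_bdd_continuous_conv_imp_weak_conv[OF \<mu>(1) \<nu>(1)])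
  fix f :: "real \<Rightarrow> real"
  assume f: "\<And>x. isCont f x" "\<And>x. \<bar>f x\<bar> \<le> 1"
  have fm: "f \<in> borel_measurable borel"
    by (intro borel_measurable_continuous_onI continuous_at_imp_continuous_on ballI f(1))
  show "(\<lambda>n. integral\<^sup>L (\<mu> n) f) \<longlonglongrightarrow> integral\<^sup>L \<nu> f"
  proof (rule LIMSEQ_I)
    fix \<epsilon> :: real assume \<epsilon>: "\<epsilon> > 0"
    obtain g where g: "real_polynomial_function g" "\<And>x. x \<in> {0..1} \<Longrightarrow> \<bar>f x - g x\<bar> < \<epsilon> / 3"
      by (rule Stone_Weierstrass_real_polynomial_function[of "{0..1::real}" f "\<epsilon> / 3"])
        (use f \<epsilon> in \<open>auto intro: continuous_at_imp_continuous_on\<close>)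
    obtain a N where gs: "g = (\<lambda>x. \<Sum>i\<le>N. a i * x ^ i)"
      using g(1) unfolding real_polynomial_function_iff_sum by blast
    have ip: "integrable \<rho> (\<lambda>x. x ^ i)" if "real_distribution \<rho>" "AE x in \<rho>. 0 \<le> x \<and> x \<le> 1" for \<rho> i
      by (rule integrable_unit_interval(1)[OF that, of _ 1]) (auto simp: power_le_one)
    have ig: "integral\<^sup>L \<rho> g = (\<Sum>i\<le>N. a i * (\<integral>x. x ^ i \<partial>\<rho>))"
      if "real_distribution \<rho>" "AE x in \<rho>. 0 \<le> x \<and> x \<le> 1" for \<rho>
      unfolding gs using ip[OF that] by (subst Bochner_Integration.integral_sum) auto
    have igi: "integrable \<rho> g" if "real_distribution \<rho>" "AE x in \<rho>. 0 \<le> x \<and> x \<le> 1" for \<rho>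
      unfolding gs using ip[OF that] by (intro Bochner_Integration.integrable_sum) auto
    have close: "\<bar>integral\<^sup>L \<rho> f - integral\<^sup>L \<rho> g\<bar> \<le> \<epsilon> / 3"
      if \<rho>: "real_distribution \<rho>" "AE x in \<rho>. 0 \<le> x \<and> x \<le> 1" for \<rho>
    proof -
      have "integrable \<rho> f" by (rule integrable_unit_interval(1)[OF \<rho> fm f(2)])
      then have "integral\<^sup>L \<rho> f - integral\<^sup>L \<rho> g = (\<integral>x. f x - g x \<partial>\<rho>)"
        using igi[OF \<rho>] by simp
      moreover have "\<bar>\<integral>x. f x - g x \<partial>\<rho>\<bar> \<le> \<epsilon> / 3"
        by (rule integrable_unit_interval(2)[OF \<rho>]) (use fm g(2) in \<open>auto simp: gs less_imp_le\<close>)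
      ultimately show ?thesis by simp
    qed
    have "(\<lambda>n. integral\<^sup>L (\<mu> n) g) \<longlonglongrightarrow> integral\<^sup>L \<nu> g"
      unfolding ig[OF \<mu>] ig[OF \<nu>] by (intro tendsto_intros mom)
    from LIMSEQ_D[OF this, of "\<epsilon> / 3"] \<epsilon>
    obtain n0 where n0: "\<And>n. n \<ge> n0 \<Longrightarrow> \<bar>integral\<^sup>L (\<mu> n) g - integral\<^sup>L \<nu> g\<bar> < \<epsilon> / 3" by auto
    show "\<exists>n0. \<forall>n\<ge>n0. norm (integral\<^sup>L (\<mu> n) f - integral\<^sup>L \<nu> f) < \<epsilon>"
    proof (intro exI allI impI)
      fix n assume "n \<ge> n0"
      then show "norm (integral\<^sup>L (\<mu> n) f - integral\<^sup>L \<nu> f) < \<epsilon>"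
        using n0[of n] close[OF \<mu>, of n] close[OF \<nu>] unfolding real_norm_def by linarith
    qed
  qed
qed

text \<open>Passage from factorial to ordinary moments, with an error uniform in \<open>F\<close>.
  Both sides are products of \<open>k\<close> factors of modulus at most 1, so the difference is at
  most the sum of the differences of the factors.\<close>

lemma choose_ratio_close_power:
  assumes "F \<le> n" "2 * k \<le> n" "n > 0"
  shows "\<bar>real (F choose k) / real (n choose k) - (real F / real n) ^ k\<bar> \<le> 2 * (real k)\<^sup>2 / real n"
proof -
  have c: "real (m choose k) = (\<Prod>i\<in>{0..<k}. real m - real i) / fact k" for m
    by (simp add: binomial_gbinomial gbinomial_prod_rev)
  have "real (F choose k) / real (n choose k) = (\<Prod>i\<in>{0..<k}. (real F - real i) / (real n - real i))"
    unfolding c by (simp add: prod_dividef)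
  then have "\<bar>real (F choose k) / real (n choose k) - (real F / real n) ^ k\<bar> =
    norm ((\<Prod>i\<in>{0..<k}. (real F - real i) / (real n - real i)) - (\<Prod>i\<in>{0..<k}. real F / real n))"
    by simp
  also have "\<dots> \<le> (\<Sum>i\<in>{0..<k}. norm ((real F - real i) / (real n - real i) - real F / real n))"
  proof (rule norm_prod_diff)
    fix i assume i: "i \<in> {0..<k}"
    have "real i < real k" "2 * real k \<le> real n" "real F \<le> real n" using i assms by auto
    then have "\<bar>real F - real i\<bar> \<le> real n - real i" "real n - real i > 0" by linarith+
    then show "norm ((real F - real i) / (real n - real i)) \<le> 1" by simp
    show "norm (real F / real n) \<le> 1" using assms by simp
  qed
  also have "\<dots> \<le> (\<Sum>i\<in>{0..<k}. 2 * real k / real n)"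
  proof (rule sum_mono)
    fix i assume i: "i \<in> {0..<k}"
    have b: "real i \<le> real k" "real i < real k" "2 * real k \<le> real n" "real F \<le> real n" "0 < real n" using i assms by auto
    then have p: "real n - real i > 0" "real n / 2 \<le> real n - real i" by linarith+
    \<comment> \<open>The assumption \<open>2 * k \<le> n\<close> keeps the denominator
      \<open>n - i\<close> above \<open>n / 2\<close>, which is the source of the constant
      2.\<close>
    have "(real F - real i) / (real n - real i) - real F / real n = - (real i * ((real n - real F) / real n) / (real n - real i))"
      using p b(5) by (simp add: field_simps)
    then have "norm ((real F - real i) / (real n - real i) - real F / real n) = real i * ((real n - real F) / real n) / (real n - real i)"
      using p b by simp
    also have "\<dots> \<le> real k * 1 / (real n / 2)"
      using p b by (intro frac_le mult_mono) auto
    finally show "norm ((real F - real i) / (real n - real i) - real F / real n) \<le> 2 * real k / real n" by (simp add: mult.commute)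
  qed
  also have "\<dots> = 2 * (real k)\<^sup>2 / real n" by (simp add: power2_eq_square)
  finally show ?thesis .
qed

lemma (in prob_space) integral_uniform_measure:
  fixes f :: "'a \<Rightarrow> real"
  assumes "A \<in> events" "prob A > 0" "f \<in> borel_measurable M"
  shows "integral\<^sup>L (uniform_measure M A) f = (\<integral>x. indicator A x * f x \<partial>M) / prob A"
proof -
  have "uniform_measure M A = density M (\<lambda>x. ennreal (indicator A x / prob A))"
    unfolding uniform_measure_def
  proof (rule density_cong)
    show "AE x in M. indicator A x / emeasure M A = ennreal (indicator A x / prob A)"
      using assms(2) divide_ennreal[of 1 "prob A"] by (auto simp: emeasure_eq_measure indicator_def)
  qed (use assms in auto)
  then have "integral\<^sup>L (uniform_measure M A) f = (\<integral>x. (indicator A x / prob A) *\<^sub>R f x \<partial>M)"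
    using assms by (simp add: integral_density)
  also have "\<dots> = (\<integral>x. indicator A x * f x / prob A \<partial>M)" by simp
  finally show ?thesis by simp
qed

section \<open>Averaging over the random tree\<close>

lemma cayley_trees_eq: "cayley_trees n = Collect (is_tree {1..n})"
  by (simp add: cayley_trees_def)

lemma tree_num_moment:
  assumes "r \<ge> 0" "n \<ge> 1" "k \<ge> 1"
  shows "tree_num r k n = tree_num r 0 n *
    (\<Sum>m=1..n. (1 / (1 + r)) ^ (m - 1) * cut_weight r k m * spine_weight n m)"
  by (rule tree_moment_formula[OF assms(1) tree_num_rec[OF assms(1)] _ _ assms(2,3)]) simp_all

text \<open>The moment formula at rate 0, where every vertex survives in every tree. Both sides
  carry the number of trees as a factor, which has to be nonzero to be cancelled.\<close>

lemma spine_total: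
  assumes "n \<ge> 1" "cayley_trees n \<noteq> {}"
  shows "(\<Sum>m=1..n. cut_weight 0 (Suc q) m * spine_weight n m) = real (n choose Suc q)"
proof -
  have "tree_num 0 (Suc q) n = tree_num 0 0 n * (\<Sum>m=1..n. cut_weight 0 (Suc q) m * spine_weight n m)"
    using tree_num_moment[of 0 n "Suc q"] assms by simp
  moreover have "tree_num 0 (Suc q) n = real (n choose Suc q) * real (card (cayley_trees n))"
    "tree_num 0 0 n = real (card (cayley_trees n))"
    by (simp_all add: tree_num_def tree_sum_rate_0 cayley_trees_eq)
  moreover have "card (cayley_trees n) \<noteq> 0"
    using assms(2) finite_trees[of "{1..n}"] by (simp add: cayley_trees_eq)
  ultimately show ?thesis by simp
qed

context
  fixes M :: "'w measure" and n :: nat and r :: real and T X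
  assumes fire: "fire_on_cayley_tree M n r T X" and r: "r \<ge> 0" and n: "n \<ge> 1"
begin

lemma tree_prob_space: "prob_space M"
  using fire by (simp add: fire_on_cayley_tree_def)

lemma tree_measurable: "T \<in> M \<rightarrow>\<^sub>M count_space (cayley_trees n)"
  using fire by (simp add: fire_on_cayley_tree_def)

lemma finite_cayley: "finite (cayley_trees n)"
  by (simp add: cayley_trees_eq finite_trees)

lemma tree_event: "{\<omega> \<in> space M. T \<omega> = E} \<in> sets M"
proof -
  have "T -` ({E} \<inter> cayley_trees n) \<inter> space M \<in> sets M"
    by (rule measurable_sets[OF tree_measurable]) auto
  moreover have "T -` ({E} \<inter> cayley_trees n) \<inter> space M = {\<omega> \<in> space M. T \<omega> = E}"
    using measurable_space[OF tree_measurable] by auto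
  ultimately show ?thesis by simp
qed

lemma tree_event_prob:
  assumes "E \<in> cayley_trees n"
  shows "measure M {\<omega> \<in> space M. T \<omega> = E} = 1 / real (card (cayley_trees n))"
proof -
  have "measure M {\<omega> \<in> space M. T \<omega> = E} = measure (distr M (count_space (cayley_trees n)) T) {E}"
    using assms by (subst measure_distr[OF tree_measurable]) (auto intro!: arg_cong[where f = "measure M"])
  also have "\<dots> = measure (uniform_count_measure (cayley_trees n)) {E}"
    using fire by (simp add: fire_on_cayley_tree_def)
  also have "\<dots> = 1 / real (card (cayley_trees n))"
    using assms finite_cayley by (simp add: measure_uniform_count_measure)
  finally show ?thesis .
qed

text \<open>The random tree itself is the witness: a probability space has a point, and
  \<open>T\<close> maps it to a tree.\<close>

lemma cayley_nonempty: "cayley_trees n \<noteq> {}"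
proof -
  interpret prob_space M by (rule tree_prob_space)
  obtain \<omega> where "\<omega> \<in> space M" using not_empty by auto
  then show ?thesis using measurable_space[OF tree_measurable] by auto
qed

lemma tree_dynamics:
  "E \<in> cayley_trees n \<Longrightarrow> fire_dynamics (uniform_measure M {\<omega>\<in>space M. T \<omega> = E}) E r X"
  using fire by (simp add: fire_on_cayley_tree_def)

lemma cayley_finite_edges: "E \<in> cayley_trees n \<Longrightarrow> finite E"
  by (simp add: cayley_trees_eq is_tree_finite_edges)

abbreviation tree_count :: "'w \<Rightarrow> nat" where
  "tree_count \<omega> \<equiv> fireproof_count {1..n} (T \<omega>) X \<omega>"

lemma count_measurable:
  assumes "E \<in> cayley_trees n"
  shows "fireproof_count {1..n} E X \<in> M \<rightarrow>\<^sub>M count_space UNIV"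
proof -
  have "fireproof_count {1..n} E X \<in> uniform_measure M {\<omega>\<in>space M. T \<omega> = E} \<rightarrow>\<^sub>M count_space UNIV"
    by (rule fireproof_count_measurable[OF _ cayley_finite_edges[OF assms] r tree_dynamics[OF assms]]) simp
  then show ?thesis by (simp add: uniform_measure_def cong: measurable_cong_sets)
qed

lemma tree_count_measurable: "tree_count \<in> M \<rightarrow>\<^sub>M count_space UNIV"
  by (rule measurable_compose_countable'[OF count_measurable tree_measurable])
    (use finite_cayley in \<open>auto intro: countable_finite\<close>)

text \<open>Decomposition along the finitely many values of \<open>T\<close>. Given
  \<open>T = E\<close> the moment is that of the dynamics on the fixed tree \<open>E\<close>, and
  equal weights turn the average into \<open>tree_num r k n\<close> divided by the number of
  trees.\<close>

lemma tree_factorial_moment: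
  assumes k: "k \<ge> 1"
  shows "(\<integral>\<omega>. real (tree_count \<omega> choose k) \<partial>M) =
    (\<Sum>m=1..n. (1 / (1 + r)) ^ (m - 1) * cut_weight r k m * spine_weight n m)"
proof -
  interpret prob_space M by (rule tree_prob_space)
  let ?C = "cayley_trees n"
  let ?A = "\<lambda>E. {\<omega> \<in> space M. T \<omega> = E}"
  let ?f = "\<lambda>E \<omega>. real (fireproof_count {1..n} E X \<omega> choose k)"
  have N: "real (card ?C) > 0" using cayley_nonempty finite_cayley by (simp add: card_gt_0_iff)
  have m: "(\<lambda>\<omega>. ?f E \<omega>) \<in> borel_measurable M" if "E \<in> ?C" for E
    by (rule measurable_compose[OF count_measurable[OF that]]) simp
  have i: "integrable M (\<lambda>\<omega>. indicator (?A E) \<omega> * ?f E \<omega>)" if "E \<in> ?C" for E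
  proof (rule integrable_const_bound[of _ "real (n choose k)"])
    have "?f E \<omega> \<le> real (n choose k)" for \<omega>
      using binomial_right_mono[OF fireproof_count_le[of "{1..n}"], of E X \<omega> k] by simp
    then show "AE \<omega> in M. norm (indicator (?A E) \<omega> * ?f E \<omega>) \<le> real (n choose k)"
      by (intro AE_I2) (auto simp: indicator_def)
    show "(\<lambda>\<omega>. indicator (?A E) \<omega> * ?f E \<omega>) \<in> borel_measurable M"
      using m[OF that] tree_event by (intro borel_measurable_times borel_measurable_indicator) auto
  qed
  have "(\<integral>\<omega>. real (tree_count \<omega> choose k) \<partial>M) =
    (\<integral>\<omega>. (\<Sum>E\<in>?C. indicator (?A E) \<omega> * ?f E \<omega>) \<partial>M)"
  proof (rule Bochner_Integration.integral_cong[OF refl])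
    fix \<omega> assume \<omega>: "\<omega> \<in> space M"
    then have "T \<omega> \<in> ?C" using measurable_space[OF tree_measurable] by auto
    then have "(\<Sum>E\<in>?C. if E = T \<omega> then ?f E \<omega> else 0) = real (tree_count \<omega> choose k)"
      using finite_cayley by simp
    moreover have "indicator (?A E) \<omega> * ?f E \<omega> =
       (if E = T \<omega> then ?f E \<omega> else 0)" for E
      using \<omega> by (auto simp: indicator_def)
    ultimately show "real (tree_count \<omega> choose k) =
       (\<Sum>E\<in>?C. indicator (?A E) \<omega> * ?f E \<omega>)" by simp
  qed
  also have "\<dots> = (\<Sum>E\<in>?C. \<integral>\<omega>. indicator (?A E) \<omega> * ?f E \<omega> \<partial>M)"
    by (rule Bochner_Integration.integral_sum) (rule i)
  also have "\<dots> = (\<Sum>E\<in>?C. psi r k {1..n} E / real (card ?C))"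
  proof (rule sum.cong[OF refl])
    fix E assume E: "E \<in> ?C"
    have "psi r k {1..n} E = (\<integral>\<omega>. ?f E \<omega> \<partial>uniform_measure M (?A E))"
      by (rule fireproof_factorial_moment[OF _ cayley_finite_edges[OF E] r tree_dynamics[OF E], symmetric]) simp
    also have "\<dots> = (\<integral>\<omega>. indicator (?A E) \<omega> * ?f E \<omega> \<partial>M) / prob (?A E)"
      using N by (intro integral_uniform_measure tree_event m E) (simp add: tree_event_prob[OF E])
    finally show "(\<integral>\<omega>. indicator (?A E) \<omega> * ?f E \<omega> \<partial>M) = psi r k {1..n} E / real (card ?C)"
      using N by (simp add: tree_event_prob[OF E])
  qed
  also have "\<dots> = tree_num r k n / tree_num r 0 n"
    using tree_sum_0[OF _ r, of "{1..n}"]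
    by (simp add: tree_num_def tree_sum_def cayley_trees_eq sum_divide_distrib)
  also have "tree_num r 0 n = real (card ?C)"
    using tree_sum_0[OF _ r, of "{1..n}"] by (simp add: tree_num_def cayley_trees_eq)
  finally show ?thesis
    using tree_num_moment[OF r n k] tree_sum_0[OF _ r, of "{1..n}"] N
    by (simp add: tree_num_def cayley_trees_eq)
qed

end

theorem theorem1:
  fixes \<alpha> :: real
    and M :: "nat \<Rightarrow> 'w measure"
    and T :: "nat \<Rightarrow> 'w \<Rightarrow> nat set set"
    and X :: "nat \<Rightarrow> real \<Rightarrow> 'w \<Rightarrow> nat set \<Rightarrow> edge_state"
    and D :: "nat \<Rightarrow> 'w \<Rightarrow> real"
  assumes "\<alpha> > 0"
    and "\<And>n. n \<ge> 1 \<Longrightarrow> fire_on_cayley_tree (M n) n (real n powr (- \<alpha>)) (T n) (X n)"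
    and "\<And>n \<omega>. D n \<omega> = fireproof_density n (T n \<omega>) (\<lambda>t. X n t \<omega>)"
  shows "(\<alpha> > 1/2 \<longrightarrow> tendsto_in_prob M D 1) \<and>
         (\<alpha> = 1/2 \<longrightarrow> weak_conv_m (\<lambda>n. distr (M n) borel (D n)) limit_law) \<and>
         (\<alpha> < 1/2 \<longrightarrow> tendsto_in_prob M D 0)"
proof -
  define F where "F n \<omega> = fireproof_count {1..n} (T n \<omega>) (X n) \<omega>" for n \<omega>
  define L where "L q = (LBINT u. spine_density q u * survival \<alpha> u)" for q
  let ?r = "\<lambda>n. real n powr - \<alpha>"
  have r: "?r n \<ge> 0" for n by simp
  note fire = assms(2)
  have D: "D n \<omega> = real (F n \<omega>) / real n" for n \<omega>
    by (simp add: assms(3) fireproof_density_def fireproof_count_def F_def)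
  have Fle: "F n \<omega> \<le> n" for n \<omega>
    using fireproof_count_le[of "{1..n}"] by (simp add: F_def)
  have D01: "0 \<le> D n \<omega>" "D n \<omega> \<le> 1" for n \<omega>
    using Fle[of n \<omega>] by (auto simp: D divide_le_eq_1)
  have ps: "prob_space (M n)" if "n \<ge> 1" for n
    using tree_prob_space[OF fire[OF that] r that] .
  have Fm: "F n \<in> M n \<rightarrow>\<^sub>M count_space UNIV" if "n \<ge> 1" for n
    using tree_count_measurable[OF fire[OF that] r that] by (simp add: F_def[abs_def])
  have Dm: "D n \<in> borel_measurable (M n)" if "n \<ge> 1" for n
    unfolding D by (rule measurable_compose[OF Fm[OF that]]) simp
  have Di: "integrable (M n) (\<lambda>\<omega>. D n \<omega> ^ k)" if "n \<ge> 1" for n k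
  proof -
    interpret prob_space "M n" by (rule ps[OF that])
    show ?thesis
      by (rule integrable_const_bound[of _ 1]) (use Dm[OF that] D01 in \<open>auto simp: power_le_one\<close>)
  qed
  have fac: "(\<lambda>n. (\<integral>\<omega>. real (F n \<omega> choose Suc q) \<partial>M n) / real (n choose Suc q)) \<longlonglongrightarrow> L q" for q
  proof (rule Lim_transform_eventually)
    have "cayley_trees n \<noteq> {}" if "n \<ge> 1" for n
      using cayley_nonempty[OF fire[OF that] r that] .
    then show "(\<lambda>n. (\<Sum>m=1..n. (1 / (1 + ?r n)) ^ (m - 1) * cut_weight (?r n) (Suc q) m * spine_weight n m)
      / real (n choose Suc q)) \<longlonglongrightarrow> L q"
      unfolding L_def by (intro factorial_moment_limit assms(1) spine_total)
    show "\<forall>\<^sub>F n in sequentially. (\<Sum>m=1..n. (1 / (1 + ?r n)) ^ (m - 1) * cut_weight (?r n) (Suc q) m * spine_weight n m)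
      / real (n choose Suc q) = (\<integral>\<omega>. real (F n \<omega> choose Suc q) \<partial>M n) / real (n choose Suc q)"
      using eventually_ge_at_top[of 1]
    proof eventually_elim
      case (elim n)
      show ?case unfolding F_def using tree_factorial_moment[OF fire[OF elim] r elim, of "Suc q"] by simp
    qed
  qed
  \<comment> \<open>For \<open>q = 0\<close> the quotient of binomials is \<open>F / n\<close>,
    which is the density itself.\<close>
  have mean: "(\<lambda>n. \<integral>\<omega>. D n \<omega> \<partial>M n) \<longlonglongrightarrow> L 0"
    using fac[of 0] by (simp add: D)
  \<comment> \<open>In the regimes with a constant limit the first moment suffices: \<open>D\<close>
    lies between 0 and 1, so its mean distance to 0 or to 1 is its mean or 1 minus its mean, and
    Markov's inequality applies.\<close>
  have markov: "(\<lambda>n. measure (M n) {\<omega>\<in>space (M n). \<bar>D n \<omega> - c\<bar> > \<epsilon>}) \<longlonglongrightarrow> 0"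
    if \<epsilon>: "\<epsilon> > 0" and lim: "(\<lambda>n. \<integral>\<omega>. \<bar>D n \<omega> - c\<bar> \<partial>M n) \<longlonglongrightarrow> 0" for \<epsilon> c
  proof (rule tendsto_sandwich[of "\<lambda>n. 0" _ _ "\<lambda>n. (\<integral>\<omega>. \<bar>D n \<omega> - c\<bar> \<partial>M n) / \<epsilon>"])
    show "(\<lambda>n. (\<integral>\<omega>. \<bar>D n \<omega> - c\<bar> \<partial>M n) / \<epsilon>) \<longlonglongrightarrow> 0"
      using tendsto_divide[OF lim tendsto_const[of \<epsilon>]] \<epsilon> by simp
    show "\<forall>\<^sub>F n in sequentially. measure (M n) {\<omega>\<in>space (M n). \<bar>D n \<omega> - c\<bar> > \<epsilon>} \<le> (\<integral>\<omega>. \<bar>D n \<omega> - c\<bar> \<partial>M n) / \<epsilon>"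
      using eventually_ge_at_top[of 1]
    proof eventually_elim
      case (elim n)
      interpret prob_space "M n" by (rule ps[OF elim])
      have m [measurable]: "D n \<in> borel_measurable (M n)" by (rule Dm[OF elim])
      have i: "integrable (M n) (\<lambda>\<omega>. \<bar>D n \<omega> - c\<bar>)"
        using Di[OF elim, of 1] by (intro integrable_abs Bochner_Integration.integrable_diff) auto
      have "prob {\<omega>\<in>space (M n). \<bar>D n \<omega> - c\<bar> > \<epsilon>} \<le> prob {\<omega>\<in>space (M n). \<bar>D n \<omega> - c\<bar> \<ge> \<epsilon>}"
        by (intro finite_measure_mono) auto
      also have "\<dots> \<le> (\<integral>\<omega>. \<bar>D n \<omega> - c\<bar> \<partial>M n) / \<epsilon>"
        by (rule integral_Markov_inequality_measure[OF i sets.empty_sets]) (use \<epsilon> in auto)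
      finally show ?case .
    qed
  qed auto
  have "tendsto_in_prob M D 1" if "\<alpha> > 1 / 2"
    unfolding tendsto_in_prob_def
  proof (intro allI impI markov)
    have "L 0 = (LBINT u. spine_density 0 u)" using that by (simp add: L_def survival_def[abs_def])
    then have "L 0 = 1" using has_integral_spine_density[of 0] by (simp add: has_bochner_integral_iff)
    then have "(\<lambda>n. 1 - (\<integral>\<omega>. D n \<omega> \<partial>M n)) \<longlonglongrightarrow> 0"
      using tendsto_diff[OF tendsto_const[of 1] mean] by simp
    moreover have "\<forall>\<^sub>F n in sequentially. 1 - (\<integral>\<omega>. D n \<omega> \<partial>M n) = (\<integral>\<omega>. \<bar>D n \<omega> - 1\<bar> \<partial>M n)"
      using eventually_ge_at_top[of 1]
    proof eventually_elim
      case (elim n)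
      interpret prob_space "M n" by (rule ps[OF elim])
      have "(\<integral>\<omega>. \<bar>D n \<omega> - 1\<bar> \<partial>M n) = (\<integral>\<omega>. 1 - D n \<omega> \<partial>M n)"
        using D01 by (intro Bochner_Integration.integral_cong) auto
      then show ?case using Di[OF elim, of 1] by (simp add: prob_space)
    qed
    ultimately show "(\<lambda>n. \<integral>\<omega>. \<bar>D n \<omega> - 1\<bar> \<partial>M n) \<longlonglongrightarrow> 0" by (rule Lim_transform_eventually)
  qed
  moreover have "tendsto_in_prob M D 0" if "\<alpha> < 1 / 2"
    unfolding tendsto_in_prob_def
  proof (intro allI impI markov)
    have "L 0 = 0" using that by (simp add: L_def survival_def[abs_def])
    then show "(\<lambda>n. \<integral>\<omega>. \<bar>D n \<omega> - 0\<bar> \<partial>M n) \<longlonglongrightarrow> 0" using mean D01 by simp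
  qed
  moreover have "weak_conv_m (\<lambda>n. distr (M n) borel (D n)) limit_law" if \<alpha>: "\<alpha> = 1 / 2"
  proof -
    \<comment> \<open>At \<open>\<alpha> = 1 / 2\<close> the survival factor is
      \<open>exp (- u)\<close>, so the limits of the normalised factorial moments are the moments of
      the limit law; ordinary moments differ from them by at most \<open>2 * k ^ 2 / n\<close>. The
      case \<open>k = 0\<close> is the total mass.\<close>
    have mom: "(\<lambda>n. \<integral>\<omega>. D n \<omega> ^ k \<partial>M n) \<longlonglongrightarrow> (\<integral>x. x ^ k \<partial>limit_law)" for k
    proof (cases k)
      case 0
      have "\<forall>\<^sub>F n in sequentially. 1 = (\<integral>\<omega>. D n \<omega> ^ k \<partial>M n)"
        using eventually_ge_at_top[of 1]
      proof eventually_elim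
        case (elim n)
        interpret prob_space "M n" by (rule ps[OF elim])
        show ?case using 0 by (simp add: prob_space)
      qed
      moreover have "(\<integral>x. x ^ k \<partial>limit_law) = 1"
        using 0 prob_space.prob_space[OF limit_law_prob_space] by simp
      ultimately show ?thesis using Lim_transform_eventually[OF tendsto_const[of 1]] by simp
    next
      case (Suc q)
      let ?C = "\<lambda>n. (\<integral>\<omega>. real (F n \<omega> choose k) \<partial>M n) / real (n choose k)"
      have "L q = (\<integral>x. x ^ k \<partial>limit_law)"
        unfolding Suc limit_law_moment_Suc using \<alpha> by (simp add: L_def survival_def[abs_def])
      then have 1: "?C \<longlonglongrightarrow> (\<integral>x. x ^ k \<partial>limit_law)" using fac[of q] Suc by simp
      have 2: "(\<lambda>n. ?C n - (\<integral>\<omega>. D n \<omega> ^ k \<partial>M n)) \<longlonglongrightarrow> 0"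
      proof (rule Lim_null_comparison)
        show "(\<lambda>n. 2 * (real k)\<^sup>2 * inverse (real n)) \<longlonglongrightarrow> 0"
          using tendsto_mult[OF tendsto_const lim_inverse_n, of "2 * (real k)\<^sup>2"] by simp
        show "\<forall>\<^sub>F n in sequentially. norm (?C n - (\<integral>\<omega>. D n \<omega> ^ k \<partial>M n)) \<le> 2 * (real k)\<^sup>2 * inverse (real n)"
          using eventually_ge_at_top[of "2 * k + 1"]
        proof eventually_elim
          case (elim n)
          then have n: "n \<ge> 1" by simp
          interpret prob_space "M n" by (rule ps[OF n])
          have b: "\<bar>real (F n \<omega> choose k) / real (n choose k) - D n \<omega> ^ k\<bar> \<le> 2 * (real k)\<^sup>2 / real n" for \<omega>
            unfolding D using elim by (intro choose_ratio_close_power Fle) auto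
          have Cm: "(\<lambda>\<omega>. real (F n \<omega> choose k) / real (n choose k)) \<in> borel_measurable (M n)"
            by (rule measurable_compose[OF Fm[OF n]]) simp
          have Ci: "integrable (M n) (\<lambda>\<omega>. real (F n \<omega> choose k) / real (n choose k))"
            by (rule integrable_const_bound[of _ 1, OF _ Cm])
              (auto simp: binomial_right_mono[OF Fle] divide_le_eq_1)
          have i: "integrable (M n) (\<lambda>\<omega>. real (F n \<omega> choose k) / real (n choose k) - D n \<omega> ^ k)"
            by (intro Bochner_Integration.integrable_diff Ci Di n)
          have "?C n - (\<integral>\<omega>. D n \<omega> ^ k \<partial>M n) = (\<integral>\<omega>. real (F n \<omega> choose k) / real (n choose k) - D n \<omega> ^ k \<partial>M n)"
            using Ci Di[OF n, of k] by simp
          also have "\<bar>\<dots>\<bar> \<le> (\<integral>\<omega>. \<bar>real (F n \<omega> choose k) / real (n choose k) - D n \<omega> ^ k\<bar> \<partial>M n)"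
            by (rule integral_abs_bound)
          also have "\<dots> \<le> (\<integral>\<omega>. 2 * (real k)\<^sup>2 / real n \<partial>M n)"
            by (rule integral_mono) (use b i in auto)
          also have "\<dots> = 2 * (real k)\<^sup>2 * inverse (real n)" by (simp add: prob_space divide_inverse)
          finally show ?case by simp
        qed
      qed
      from tendsto_diff[OF 1 2] show ?thesis by simp
    qed
    \<comment> \<open>shifted, since \<open>M 0\<close> need not be a probability space\<close>
    have "weak_conv_m (\<lambda>n. distr (M (Suc n)) borel (D (Suc n))) limit_law"
    proof (rule moments_imp_weak_conv[OF _ _ limit_law_real_distribution limit_law_supported])
      fix n
      interpret prob_space "M (Suc n)" by (rule ps) simp
      have m: "D (Suc n) \<in> borel_measurable (M (Suc n))" by (rule Dm) simp
      show "real_distribution (distr (M (Suc n)) borel (D (Suc n)))"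
        by (rule real_distribution_distr[OF m])
      show "AE x in distr (M (Suc n)) borel (D (Suc n)). 0 \<le> x \<and> x \<le> 1"
        using m D01 by (subst AE_distr_iff) auto
    next
      fix k
      have "(\<integral>x. x ^ k \<partial>distr (M (Suc n)) borel (D (Suc n))) = (\<integral>\<omega>. D (Suc n) \<omega> ^ k \<partial>M (Suc n))" for n
        by (rule integral_distr[OF Dm]) auto
      then show "(\<lambda>n. \<integral>x. x ^ k \<partial>distr (M (Suc n)) borel (D (Suc n))) \<longlonglongrightarrow> (\<integral>x. x ^ k \<partial>limit_law)"
        using LIMSEQ_Suc[OF mom[of k]] by simp
    qed
    then show ?thesis
      unfolding weak_conv_m_def weak_conv_def by (auto intro: LIMSEQ_imp_Suc)
  qed
  ultimately show ?thesis by blast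
qed

end
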